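(* Let $\mathcal{L}_K$ be a positive integral operator on $L^2(S^m)$ generated by a $(T_t,B,\beta)$-Hölder kernel $K$, where $\beta\in(0,2]$ and $B\in L^\infty(S^m)$ is nonnegative. Let $k$ be a positive integer. Suppose there exists a fixed positive integer $q$ such that, for every $n=1,2,\ldots$ and every choice of positive integers $l$ and $\mu\ge 2$ with $l(\mu-1)=n$, the operator $\Phi_{n,k}$ satisfies $\rho(\Phi_{n,k})\le [q(n+1)]^{\alpha(m)}$. Then $$a_n(\mathcal{L}_K)=O(n^{-\beta/\alpha(m)})\quad (n\to\infty).$$ Further, if the range of $\mathcal{L}_K^{1/2}$ is entirely composed of continuous functions, then $$a_n(\mathcal{L}_K)=O(n^{-1-\beta/\alpha(m)})\quad (n\to\infty).$$
   Context: Sphere and norms. Fix a positive integer $m$. $S^m$ is the unit sphere of $\mathbb{R}^{m+1}$, $\sigma_m$ its surface measure, $\tau_m=\sigma_m(S^m)$; $L^p(S^m)=L^p(S^m,\sigma_m)$ (complex-valued functions) with norm $\|\cdot\|_p$, $p=1,2,\infty$. Put $d\omega_m(u)=(1-u^2)^{(m-2)/2}du$ on $[-1,1]$ and $\|\phi\|_{1,m}=\frac{\tau_{m-1}}{\tau_m}\int_{-1}^1|\phi(u)|\,d\omega_m(u)$ for $\phi\in L^1([-1,1],d\omega_m)$. The family. A family $\{\mathcal{Z}_t^m:t\in(0,\pi)\}$ of nonnegative functions in $L^1([-1,1],d\omega_m)$ is fixed (it is implicit that $(t,u)\mapsto\mathcal{Z}_t^m(u)$ is jointly measurable, so that the integrals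 in $t$ below make sense), with $Z_t^m(x,y)=\mathcal{Z}_t^m(x\cdot y)$, $x,y\in S^m$. Let $V_m(t)$ be the surface area of the support of $Z_t^m(x,\cdot)$ (the support is the complement in $S^m$ of the union of all open sets on which $Z_t^m(x,\cdot)$ vanishes $\sigma_m$-a.e.; its area does not depend on $x$). Assumed: (A1) $\{\mathcal{Z}_t^m\}$ is uniformly bounded in $L^1([-1,1],d\omega_m)$; (A2) there are a positive integer $\alpha(m)$ and constants $c_m,C_m>0$ with $V_m(t)\le C_mt^{\alpha(m)}$ for $t\in(0,\pi)$ and $c_mt^{\alpha(m)}\le V_m(t)$ for $t\in(0,\pi/2)$. Convolution operators. $T_t(f)(x)=\frac1{\tau_m}\int_{S^m}\mathcal{Z}_t^m(x\cdot y)f(y)\,d\sigma_m(y)$. Hölder condition. For $\beta\in(0,2]$ and nonnegative $B\in L^\infty(S^m)$, a kernel $K$ on $S^m$ is $(T_t,B,\beta)$-Hölder if $|T_t(K(y,\cdot))(x)-K(y,x)|\le B(y)t^\beta$ for all $x,y\in S^m$, $t\in(0,\pi)$. Approximating operators. For positive integers $l$ and $\mu\ge2$, put $\nu=l(\mu-1)$, and for a positive integer $n$ let $$J_{\nu,n}(t)=\frac1{c_{\nu,n}}\left[\frac{\sin(\mu t/2)}{\sin(t/2)}\right]^{2l},\qquad c_{\nu,n}=\int_0^\pi\left[\frac{\sin(\mu t/2)}{\sin(t/2)}\right]^{2l}V_m(t)(\sin t)^n\,dt,$$ (so $J_{\nu,n}$ depends on $l,\mu$ and not only on $\nu$), and $$\Phi_{\nu,n}(f)(x)=\int_0^\pi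 J_{\nu,n}(t)T_t(f)(x)V_m(t)(\sin t)^n\,dt,\quad f\in L^2(S^m),$$ a bounded linear operator on $L^2(S^m)$. Thus $\Phi_{n,k}$ has first index $\nu=n=l(\mu-1)$ and exponent $k$ of $\sin t$. Positive integral operators. For $K\in L^2(S^m\times S^m)$, $\mathcal{L}_K(f)(x)=\int_{S^m}K(x,y)f(y)\,d\sigma_m(y)$ on $L^2(S^m)$. It is called a positive integral operator if: $\int_{S^m}\mathcal{L}_K(f)(x)\overline{f(x)}\,d\sigma_m(x)\ge0$ for all $f\in L^2(S^m)$; the square root $\mathcal{L}_K^{1/2}$ is an integral operator on $L^2(S^m)$ generated by a hermitian kernel $K_{1/2}:S^m\times S^m\to\mathbb{C}$; and $\int_{S^m}K_{1/2}(x,y)K_{1/2}(w,x)\,d\sigma_m(x)=K(w,y)$ for $y,w\in S^m$. $\rho(U)$ denotes the rank of an operator $U$, and $a_n(T)=\min\{\|T-U\|:\rho(U)\le n-1\}$ (bounded linear $U$ on $L^2(S^m)$, operator norm) is the $n$-th approximation number of a compact operator $T$ on $L^2(S^m)$; $a_n(\mathcal{L}_K)$ equals the $n$-th eigenvalue of $\mathcal{L}_K$ in decreasing order with multiplicities. *)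

theory Defs
  imports "HOL-Analysis.Analysis" "HOL-Library.Nonpos_Ints" "HOL-Library.Extended_Nat"
    "HOL-Library.Landau_Symbols"
begin

section \<open>The sphere and its surface measure\<close>

text \<open>The sphere $S^m$ is \<open>sphere 0 1\<close> in a Euclidean space \<open>'a\<close> of dimension $m+1$. Its surface
  measure is obtained from Lebesgue measure by the cone construction
  $\sigma_m(A) = (m+1)\,\lambda(\{r x : x \in A,\ 0 < r < 1\})$; note that
  \<open>sgn x\<close> is \<open>x /\<^sub>R norm x\<close>.\<close>

definition sphere_measure :: "'a::euclidean_space measure" where
  "sphere_measure =
     scale_measure (ennreal (real DIM('a)))
       (distr (restrict_space lborel (ball 0 1 - {0})) (restrict_space borel (sphere 0 1)) sgn)"

text \<open>The total area $\tau_d$ of $S^d$ for a numerical $d$. It is needed because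
  $\tau_{m-1}$ refers to a sphere which does not live in \<open>'a\<close>.\<close>

definition sphere_area :: "nat \<Rightarrow> real" where
  "sphere_area d = real (d + 1) * unit_ball_vol (real (d + 1))"

lemma space_sphere_measure [simp]: "space (sphere_measure :: 'a::euclidean_space measure) = sphere 0 1"
  by (simp add: sphere_measure_def space_scale_measure space_restrict_space)

lemma sets_sphere_measure [measurable_cong]:
  "sets (sphere_measure :: 'a::euclidean_space measure) = sets (restrict_space borel (sphere 0 1))"
  by (simp add: sphere_measure_def)

lemma emeasure_sphere_measure:
  fixes A :: "'a::euclidean_space set"
  assumes "A \<in> sets (restrict_space borel (sphere 0 1))"
  shows "emeasure sphere_measure A =
    ennreal (real DIM('a)) * emeasure lborel (sgn -` A \<inter> (ball 0 1 - {0}))"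
proof -
  have m: "sgn \<in> measurable (restrict_space lborel (ball (0::'a) 1 - {0})) (restrict_space borel (sphere 0 1))"
    by (rule measurable_restrict_space2)
       (auto simp: space_restrict_space norm_sgn sgn_div_norm[abs_def]
             intro!: measurable_restrict_space1)
  have "sgn -` A \<inter> (ball 0 1 - {0}) \<inter> (ball 0 1 - {0}) = sgn -` A \<inter> (ball 0 1 - {0})"
    by auto
  then show ?thesis
    using assms m
    by (simp add: sphere_measure_def emeasure_distr emeasure_restrict_space space_restrict_space)
qed

lemma measure_sphere_measure:
  assumes "DIM('a::euclidean_space) = m + 1"
  shows "measure (sphere_measure :: 'a measure) (sphere 0 1) = sphere_area m"
proof -
  have s: "sphere (0::'a) 1 \<in> sets (restrict_space borel (sphere 0 1))"
    using sets.top[of "restrict_space borel (sphere (0::'a) 1)"] by (simp add: space_restrict_space)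
  have e: "sgn -` sphere 0 1 \<inter> (ball 0 1 - {0}) = ball 0 1 - {0::'a}"
    by (auto simp: norm_sgn)
  have "emeasure lborel (ball 0 1 - {0::'a}) = emeasure lborel (ball (0::'a) 1)"
    by (intro emeasure_Diff_null_set) auto
  also have "\<dots> = ennreal (unit_ball_vol (real DIM('a)))"
    by (simp add: emeasure_ball)
  finally show ?thesis
    using emeasure_sphere_measure[OF s] assms
    by (simp add: e measure_def sphere_area_def enn2real_mult del: of_nat_add of_nat_Suc)
qed

section \<open>$L^2$ spaces and bounded operators\<close>

text \<open>Elements of $L^2$ are represented by functions; equality of elements is equality almost
  everywhere.\<close>

definition L2 :: "'b measure \<Rightarrow> ('b \<Rightarrow> complex) set" where
  "L2 M = {f. f \<in> borel_measurable M \<and> integrable M (\<lambda>x. (cmod (f x))\<^sup>2)}"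

definition L2_norm :: "'b measure \<Rightarrow> ('b \<Rightarrow> complex) \<Rightarrow> real" where
  "L2_norm M f = sqrt (LINT x|M. (cmod (f x))\<^sup>2)"

text \<open>Bounded linear operators on $L^2$. Linearity almost everywhere and boundedness imply
  that almost everywhere equal functions have almost everywhere equal images.\<close>

definition L2_operator :: "'b measure \<Rightarrow> (('b \<Rightarrow> complex) \<Rightarrow> 'b \<Rightarrow> complex) \<Rightarrow> bool" where
  "L2_operator M U \<longleftrightarrow>
     (\<forall>f\<in>L2 M. U f \<in> L2 M) \<and>
     (\<forall>f\<in>L2 M. \<forall>g\<in>L2 M. \<forall>a b. AE x in M. U (\<lambda>y. a * f y + b * g y) x = a * U f x + b * U g x) \<and>
     (\<exists>C. \<forall>f\<in>L2 M. L2_norm M (U f) \<le> C * L2_norm M f)"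

definition op_norm :: "'b measure \<Rightarrow> (('b \<Rightarrow> complex) \<Rightarrow> 'b \<Rightarrow> complex) \<Rightarrow> real" where
  "op_norm M U = Sup {L2_norm M (U f) | f. f \<in> L2 M \<and> L2_norm M f \<le> 1}"

text \<open>The rank is the dimension of the range in $L^2$: the least size of a finite subset of the
  range spanning it (up to almost everywhere equality), and \<open>\<infinity>\<close> if there is none.\<close>

definition op_rank :: "'b measure \<Rightarrow> (('b \<Rightarrow> complex) \<Rightarrow> 'b \<Rightarrow> complex) \<Rightarrow> enat" where
  "op_rank M U =
     (INF G \<in> {G. finite G \<and> G \<subseteq> U ` L2 M \<and>
                  (\<forall>f\<in>L2 M. \<exists>c. AE x in M. U f x = (\<Sum>g\<in>G. c g * g x))}. enat (card G))"

text \<open>For the compact operators considered here the infimum is a minimum.\<close>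

definition approx_number :: "'b measure \<Rightarrow> nat \<Rightarrow> (('b \<Rightarrow> complex) \<Rightarrow> 'b \<Rightarrow> complex) \<Rightarrow> real" where
  "approx_number M n T =
     Inf {op_norm M (\<lambda>f x. T f x - U f x) | U. L2_operator M U \<and> op_rank M U \<le> enat (n - 1)}"

definition positive_operator :: "'b measure \<Rightarrow> (('b \<Rightarrow> complex) \<Rightarrow> 'b \<Rightarrow> complex) \<Rightarrow> bool" where
  "positive_operator M U \<longleftrightarrow> (\<forall>f\<in>L2 M. (LINT x|M. U f x * cnj (f x)) \<in> \<real>\<^sub>\<ge>\<^sub>0)"

text \<open>\<open>R\<close> represents the square root $T^{1/2}$ of the positive operator \<open>T\<close>.\<close>

definition is_square_root ::
  "'b measure \<Rightarrow> (('b \<Rightarrow> complex) \<Rightarrow> 'b \<Rightarrow> complex) \<Rightarrow> (('b \<Rightarrow> complex) \<Rightarrow> 'b \<Rightarrow> complex) \<Rightarrow> bool" where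
  "is_square_root M R T \<longleftrightarrow>
     L2_operator M R \<and> positive_operator M R \<and> (\<forall>f\<in>L2 M. AE x in M. R (R f) x = T f x)"

section \<open>Positive integral operators on the sphere\<close>

definition integral_op ::
  "('a \<Rightarrow> 'a \<Rightarrow> complex) \<Rightarrow> ('a \<Rightarrow> complex) \<Rightarrow> 'a::euclidean_space \<Rightarrow> complex" where
  "integral_op K f x = (LINT y|sphere_measure. K x y * f y)"

text \<open>\<open>integral_op K\<close> is a positive integral operator whose square root is generated by the
  hermitian kernel \<open>Kh\<close> (written $K_{1/2}$). Since the Bochner integral of a non-integrable
  function is 0, the existence of the integrals in the factorization is stated explicitly.\<close>

definition positive_integral_operator ::
  "('a::euclidean_space \<Rightarrow> 'a \<Rightarrow> complex) \<Rightarrow> ('a \<Rightarrow> 'a \<Rightarrow> complex) \<Rightarrow> bool" where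
  "positive_integral_operator K Kh \<longleftrightarrow>
     case_prod K \<in> L2 (sphere_measure \<Otimes>\<^sub>M sphere_measure) \<and>
     positive_operator sphere_measure (integral_op K) \<and>
     case_prod Kh \<in> borel_measurable (sphere_measure \<Otimes>\<^sub>M sphere_measure) \<and>
     (\<forall>x\<in>sphere 0 1. \<forall>y\<in>sphere 0 1. Kh x y = cnj (Kh y x)) \<and>
     is_square_root sphere_measure (integral_op Kh) (integral_op K) \<and>
     (\<forall>y\<in>sphere 0 1. \<forall>w\<in>sphere 0 1.
        integrable sphere_measure (\<lambda>x. Kh x y * Kh w x) \<and>
        (LINT x|sphere_measure. Kh x y * Kh w x) = K w y)"

section \<open>The family of zonal functions and the operators it generates\<close>

definition omega_measure :: "nat \<Rightarrow> real measure" where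
  "omega_measure m =
     density (restrict_space lborel {-1..1}) (\<lambda>u. ennreal ((1 - u\<^sup>2) powr ((real m - 2) / 2)))"

definition norm_1m :: "nat \<Rightarrow> (real \<Rightarrow> real) \<Rightarrow> real" where
  "norm_1m m \<phi> = sphere_area (m - 1) / sphere_area m * (LINT u|omega_measure m. \<bar>\<phi> u\<bar>)"

definition ess_support :: "('a::euclidean_space \<Rightarrow> real) \<Rightarrow> 'a set" where
  "ess_support f = sphere 0 1 -
     \<Union>{U. openin (top_of_set (sphere 0 1)) U \<and> (AE y in sphere_measure. y \<in> U \<longrightarrow> f y = 0)}"

text \<open>The number $V_m(t)$ for the kernel $(x,y) \mapsto Z_t(x \cdot y)$ on the unit sphere of
  \<open>'a\<close>. By rotation invariance the choice of the point \<open>x\<close> does not matter.\<close>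

definition support_area :: "'a::euclidean_space itself \<Rightarrow> (real \<Rightarrow> real \<Rightarrow> real) \<Rightarrow> real \<Rightarrow> real" where
  "support_area _ Z t =
     (let x = (SOME x::'a. x \<in> sphere 0 1) in measure sphere_measure (ess_support (\<lambda>y. Z t (x \<bullet> y))))"

definition conv_op ::
  "(real \<Rightarrow> real \<Rightarrow> real) \<Rightarrow> real \<Rightarrow> ('a \<Rightarrow> complex) \<Rightarrow> 'a::euclidean_space \<Rightarrow> complex" where
  "conv_op Z t f x =
     (LINT y|sphere_measure. of_real (Z t (x \<bullet> y)) * f y)
       /\<^sub>R measure (sphere_measure :: 'a measure) (sphere 0 1)"

text \<open>The Hoelder condition comprises the existence of the integrals defining
  $T_t(K(y,\cdot))(x)$ for all \<open>x\<close>, \<open>y\<close>, \<open>t\<close>.\<close>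

definition Holder_kernel ::
  "(real \<Rightarrow> real \<Rightarrow> real) \<Rightarrow> ('a \<Rightarrow> real) \<Rightarrow> real \<Rightarrow> ('a::euclidean_space \<Rightarrow> 'a \<Rightarrow> complex) \<Rightarrow> bool" where
  "Holder_kernel Z B \<beta> K \<longleftrightarrow>
     (\<forall>x\<in>sphere 0 1. \<forall>y\<in>sphere 0 1. \<forall>t\<in>{0<..<pi}.
        integrable sphere_measure (\<lambda>z. of_real (Z t (x \<bullet> z)) * K y z) \<and>
        cmod (conv_op Z t (K y) x - K y x) \<le> B y * t powr \<beta>)"

text \<open>The constant $c_{\nu,n}$, the function $J_{\nu,n}$ and the operator $\Phi_{\nu,n}$ with
  $\nu = l(\mu-1)$. As they depend on \<open>l\<close> and \<open>\<mu>\<close> and not only on $\nu$, they are indexed by the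
  former; \<open>n\<close> is the exponent of the sine.\<close>

definition jackson_const ::
  "'a::euclidean_space itself \<Rightarrow> (real \<Rightarrow> real \<Rightarrow> real) \<Rightarrow> nat \<Rightarrow> nat \<Rightarrow> nat \<Rightarrow> real" where
  "jackson_const A Z l \<mu> n =
     (LBINT t:{0<..<pi}. (sin (real \<mu> * t / 2) / sin (t / 2)) ^ (2 * l) * support_area A Z t * sin t ^ n)"

definition jackson_fun ::
  "'a::euclidean_space itself \<Rightarrow> (real \<Rightarrow> real \<Rightarrow> real) \<Rightarrow> nat \<Rightarrow> nat \<Rightarrow> nat \<Rightarrow> real \<Rightarrow> real" where
  "jackson_fun A Z l \<mu> n t =
     1 / jackson_const A Z l \<mu> n * (sin (real \<mu> * t / 2) / sin (t / 2)) ^ (2 * l)"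

definition Phi_op ::
  "(real \<Rightarrow> real \<Rightarrow> real) \<Rightarrow> nat \<Rightarrow> nat \<Rightarrow> nat \<Rightarrow> ('a \<Rightarrow> complex) \<Rightarrow> 'a::euclidean_space \<Rightarrow> complex" where
  "Phi_op Z l \<mu> n f x =
     (LBINT t:{0<..<pi}. of_real (jackson_fun TYPE('a) Z l \<mu> n t) * conv_op Z t f x
        * of_real (support_area TYPE('a) Z t * sin t ^ n))"

end

theory Submission
  imports Defs
begin

text \<open>Let \<open>R\<close> be the square root of \<open>\<L>\<^sub>K\<close>, let \<open>M\<close> be the surface measure of the sphere \<open>S\<close>, and let \<open>\<Phi>\<close> be the
  approximating operator for given \<open>l\<close> and \<open>\<mu>\<close>. Both rates follow from one estimate,
  \<open>a\<^sub>N(\<L>\<^sub>K) = O(N\<^sup>-\<^sup>1\<^sup>-\<^sup>\<beta>\<^sup>/\<^sup>\<alpha>)\<close>. It has three sources.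

  \<^emph>\<open>Smoothing.\<close> \<open>\<Phi>\<close> averages the operators \<open>T\<^sub>t\<close> with respect to a probability density on \<open>(0, \<pi>)\<close>
  that is concentrated at \<open>t \<approx> 1 / \<mu>\<close> (\<open>jackson_moment\<close>), and it is the operator of a symmetric
  nonnegative kernel with bounded row integrals. The bound on the rows is where the measure
  \<open>\<omega>\<^sub>m\<close> enters (\<open>zonal_integral_le\<close>). Averaging the Hoelder condition gives
  \<open>\<bar>K(y, x) - \<Phi>(K(y, \<cdot>))(x)\<bar> \<le> \<epsilon>\<close> with \<open>\<epsilon> = O(\<mu>\<^sup>-\<^sup>\<beta>)\<close>. This says that \<open>R R (1 - \<Phi>)\<close> maps \<open>L\<^sup>1\<close> to
  \<open>L\<^sup>\<infinity>\<close> with norm at most \<open>\<epsilon>\<close>; since \<open>\<Phi>\<close> and \<open>R\<close> are symmetric, duality yields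
  \<open>\<parallel>(1 - \<Phi>) R f\<parallel>\<^sub>\<infinity> \<le> \<delta> \<parallel>f\<parallel>\<^sub>2\<close> with \<open>\<delta>\<^sup>2 = O(\<mu>\<^sup>-\<^sup>\<beta>)\<close> (\<open>dual_bound\<close>). Passing through \<open>R\<close> instead of
  estimating \<open>(1 - \<Phi>) \<L>\<^sub>K\<close> is what makes the next step available.

  \<^emph>\<open>Hilbert-Schmidt gain.\<close> On a finite measure space an operator \<open>A\<close> from \<open>L\<^sup>2\<close> to \<open>L\<^sup>\<infinity>\<close> of norm \<open>\<delta>\<close> has
  squared Hilbert-Schmidt norm at most \<open>\<delta>\<^sup>2 M(S)\<close> (\<open>sum_square_norm_le_of_sup_bound\<close>). Hence, for any
  \<open>r\<close>, it has norm at most \<open>\<delta> sqrt (M(S) / r)\<close> on the orthogonal complement of at most \<open>r\<close> vectors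
  (\<open>orthonormal_exhaustion\<close>). For \<open>A = (1 - \<Phi>) R\<close> and \<open>r\<close> a bound for the rank of \<open>\<Phi>\<close> this makes \<open>R\<close> the
  sum of an operator of rank at most \<open>2 r\<close> and an operator \<open>W\<close> with \<open>\<parallel>W\<parallel>\<^sup>2 \<le> \<delta>\<^sup>2 M(S) / r\<close>.

  \<^emph>\<open>Squaring.\<close> \<open>\<L>\<^sub>K = R R\<close> differs from \<open>W W\<close> by an operator of rank at most \<open>4 r\<close>, so
  \<open>a\<^sub>N(\<L>\<^sub>K) \<le> \<delta>\<^sup>2 M(S) / r = O(\<mu>\<^sup>-\<^sup>\<beta> / r)\<close> for \<open>N > 4 r\<close>. With \<open>l\<close> fixed, \<open>r\<close> is comparable to \<open>\<mu>\<^sup>\<alpha>\<close>, and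
  \<open>\<mu> \<approx> N\<^sup>1\<^sup>/\<^sup>\<alpha>\<close> gives the estimate.

  Elements of \<open>L\<^sup>2\<close> are functions here, so linearity, rank and symmetry hold up to null sets
  throughout, and facts about individual points hold almost everywhere.\<close>

section \<open>The inner product of square integrable functions\<close>

lemma borel_measurable_cnj [measurable (raw)]:
  "f \<in> borel_measurable M \<Longrightarrow> (\<lambda>x. cnj (f x)) \<in> borel_measurable M"
  by (rule borel_measurable_continuous_on[OF continuous_on_cnj[OF continuous_on_id]])

definition L2_inner :: "'b measure \<Rightarrow> ('b \<Rightarrow> complex) \<Rightarrow> ('b \<Rightarrow> complex) \<Rightarrow> complex" where
  "L2_inner M f g = (LINT x|M. f x * cnj (g x))"

lemma L2_measurable: "f \<in> L2 M \<Longrightarrow> f \<in> borel_measurable M"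
  by (simp add: L2_def)

lemma L2_integrable_square: "f \<in> L2 M \<Longrightarrow> integrable M (\<lambda>x. (cmod (f x))\<^sup>2)"
  by (simp add: L2_def)

lemma L2_lincomb:
  assumes f: "f \<in> L2 M" and g: "g \<in> L2 M"
  shows "(\<lambda>x. a * f x + b * g x) \<in> L2 M"
proof -
  note [measurable] = L2_measurable[OF f] L2_measurable[OF g]
  have "integrable M (\<lambda>x. 2 * (cmod a)\<^sup>2 * (cmod (f x))\<^sup>2 + 2 * (cmod b)\<^sup>2 * (cmod (g x))\<^sup>2)"
    using L2_integrable_square[OF f] L2_integrable_square[OF g] by auto
  moreover have "(cmod (a * f x + b * g x))\<^sup>2
      \<le> 2 * (cmod a)\<^sup>2 * (cmod (f x))\<^sup>2 + 2 * (cmod b)\<^sup>2 * (cmod (g x))\<^sup>2" for x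
  proof -
    have "(cmod (a * f x + b * g x))\<^sup>2 \<le> (cmod (a * f x) + cmod (b * g x))\<^sup>2"
      by (intro power_mono norm_triangle_ineq) auto
    also have "\<dots> \<le> 2 * (cmod (a * f x))\<^sup>2 + 2 * (cmod (b * g x))\<^sup>2"
      using sum_squares_bound[of "cmod (a * f x)" "cmod (b * g x)"] by (simp add: power2_sum)
    finally show ?thesis by (simp add: norm_mult power_mult_distrib)
  qed
  ultimately have "integrable M (\<lambda>x. (cmod (a * f x + b * g x))\<^sup>2)"
    by (intro Bochner_Integration.integrable_bound[where g="\<lambda>x. (cmod (a * f x + b * g x))\<^sup>2"]) auto
  then show ?thesis by (simp add: L2_def)
qed

lemma L2_add: "f \<in> L2 M \<Longrightarrow> g \<in> L2 M \<Longrightarrow> (\<lambda>x. f x + g x) \<in> L2 M"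
  using L2_lincomb[of f M g 1 1] by simp

lemma L2_diff: "f \<in> L2 M \<Longrightarrow> g \<in> L2 M \<Longrightarrow> (\<lambda>x. f x - g x) \<in> L2 M"
  using L2_lincomb[of f M g 1 "-1"] by simp

lemma L2_scale: "f \<in> L2 M \<Longrightarrow> (\<lambda>x. a * f x) \<in> L2 M"
  using L2_lincomb[of f M f a 0] by simp

lemma L2_zero: "(\<lambda>x. 0) \<in> L2 M"
  by (simp add: L2_def)

lemma L2_sum: "finite I \<Longrightarrow> (\<And>i. i \<in> I \<Longrightarrow> f i \<in> L2 M) \<Longrightarrow> (\<lambda>x. \<Sum>i\<in>I. c i * f i x) \<in> L2 M"
  by (induction I rule: finite_induct) (auto simp: L2_zero intro!: L2_add L2_scale)

lemma L2_AE_cong: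
  assumes f: "f \<in> L2 M" and [measurable]: "g \<in> borel_measurable M" and eq: "AE x in M. f x = g x"
  shows "g \<in> L2 M"
proof -
  note [measurable] = L2_measurable[OF f]
  have "integrable M (\<lambda>x. (cmod (g x))\<^sup>2)"
    using L2_integrable_square[OF f] by (rule integrable_cong_AE_imp) (use eq in auto)
  then show ?thesis by (simp add: L2_def)
qed

lemma L2_norm_nonneg [simp]: "L2_norm M f \<ge> 0"
  by (simp add: L2_norm_def)

lemma L2_norm_power2: "(L2_norm M f)\<^sup>2 = (LINT x|M. (cmod (f x))\<^sup>2)"
  by (simp add: L2_norm_def)

lemma L2_norm_AE_cong:
  assumes "f \<in> borel_measurable M" "g \<in> borel_measurable M" "AE x in M. f x = g x"
  shows "L2_norm M f = L2_norm M g"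
  using assms by (auto simp: L2_norm_def intro!: integral_cong_AE arg_cong[where f=sqrt])

lemma L2_norm_eq_0:
  assumes "f \<in> L2 M" "L2_norm M f = 0"
  shows "AE x in M. f x = 0"
proof -
  have "(LINT x|M. (cmod (f x))\<^sup>2) = 0" using assms(2) by (simp add: L2_norm_def)
  then have "AE x in M. (cmod (f x))\<^sup>2 = 0"
    using integral_nonneg_eq_0_iff_AE[OF L2_integrable_square[OF assms(1)]] by simp
  then show ?thesis by simp
qed

lemma L2_norm_scale: "L2_norm M (\<lambda>x. a * f x) = cmod a * L2_norm M f"
  by (simp add: L2_norm_def norm_mult power_mult_distrib real_sqrt_mult)

lemma L2_integrable_mult:
  assumes f: "f \<in> L2 M" and g: "g \<in> L2 M"
  shows "integrable M (\<lambda>x. f x * g x)"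
proof -
  note [measurable] = L2_measurable[OF f] L2_measurable[OF g]
  have "integrable M (\<lambda>x. (cmod (f x))\<^sup>2 + (cmod (g x))\<^sup>2)"
    using L2_integrable_square[OF f] L2_integrable_square[OF g] by auto
  moreover have "cmod (f x * g x) \<le> (cmod (f x))\<^sup>2 + (cmod (g x))\<^sup>2" for x
  proof -
    have "0 \<le> cmod (f x) * cmod (g x)" by simp
    then show ?thesis
      using sum_squares_bound[of "cmod (f x)" "cmod (g x)"] unfolding norm_mult mult.assoc by linarith
  qed
  ultimately show ?thesis
    by (intro Bochner_Integration.integrable_bound[where g="\<lambda>x. f x * g x"]) auto
qed

lemma L2_cnj: "f \<in> L2 M \<Longrightarrow> (\<lambda>x. cnj (f x)) \<in> L2 M"
  by (auto simp: L2_def)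

lemma L2_inner_integrable:
  "f \<in> L2 M \<Longrightarrow> g \<in> L2 M \<Longrightarrow> integrable M (\<lambda>x. f x * cnj (g x))"
  by (intro L2_integrable_mult L2_cnj)

lemma L2_inner_self: "L2_inner M f f = of_real ((L2_norm M f)\<^sup>2)"
proof -
  have "L2_inner M f f = (LINT x|M. complex_of_real ((cmod (f x))\<^sup>2))"
    unfolding L2_inner_def by (simp only: complex_norm_square)
  then show ?thesis by (simp only: integral_complex_of_real L2_norm_power2)
qed

lemma L2_inner_lincomb_left:
  assumes "f \<in> L2 M" "g \<in> L2 M" "h \<in> L2 M"
  shows "L2_inner M (\<lambda>x. a * f x + b * g x) h = a * L2_inner M f h + b * L2_inner M g h"
  using L2_inner_integrable[OF assms(1,3)] L2_inner_integrable[OF assms(2,3)]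
  by (simp add: L2_inner_def ring_distribs mult.assoc)

lemma L2_inner_commute: "L2_inner M g f = cnj (L2_inner M f g)"
proof -
  have "cnj (L2_inner M f g) = (LINT x|M. cnj (f x * cnj (g x)))"
    unfolding L2_inner_def by (rule Bochner_Integration.integral_cnj[symmetric])
  also have "\<dots> = L2_inner M g f" by (simp add: L2_inner_def mult.commute)
  finally show ?thesis by simp
qed

lemma L2_inner_AE_cong:
  assumes "f \<in> borel_measurable M" "f' \<in> borel_measurable M" "g \<in> borel_measurable M" "g' \<in> borel_measurable M"
    and "AE x in M. f x = f' x" "AE x in M. g x = g' x"
  shows "L2_inner M f g = L2_inner M f' g'"
  using assms unfolding L2_inner_def by (intro integral_cong_AE) auto

lemma L2_inner_sum_left:
  assumes "finite I" "\<And>i. i \<in> I \<Longrightarrow> f i \<in> L2 M" "h \<in> L2 M"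
  shows "L2_inner M (\<lambda>x. \<Sum>i\<in>I. c i * f i x) h = (\<Sum>i\<in>I. c i * L2_inner M (f i) h)"
  using assms(1,2)
proof (induction I rule: finite_induct)
  case empty
  then show ?case by (simp add: L2_inner_def)
next
  case (insert i I)
  have "L2_inner M (\<lambda>x. c i * f i x + 1 * (\<Sum>i\<in>I. c i * f i x)) h
      = c i * L2_inner M (f i) h + 1 * L2_inner M (\<lambda>x. \<Sum>i\<in>I. c i * f i x) h"
    using insert assms by (intro L2_inner_lincomb_left L2_sum) auto
  then show ?case using insert by simp
qed

lemma integral_cmod_mult_le:
  assumes f: "f \<in> L2 M" and g: "g \<in> L2 M"
  shows "(LINT x|M. cmod (f x) * cmod (g x)) \<le> L2_norm M f * L2_norm M g"
proof -
  \<comment> \<open>the discriminant of \<open>s \<mapsto> \<parallel>\<bar>f\<bar> - s \<bar>g\<bar>\<parallel>\<^sup>2\<close>\<close>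
  note [measurable] = L2_measurable[OF f] L2_measurable[OF g]
  define a where "a = (LINT x|M. (cmod (f x))\<^sup>2)"
  define c where "c = (LINT x|M. (cmod (g x))\<^sup>2)"
  define b where "b = (LINT x|M. cmod (f x) * cmod (g x))"
  have int: "integrable M (\<lambda>x. cmod (f x) * cmod (g x))"
    using integrable_norm[OF L2_integrable_mult[OF f g]] by (simp add: norm_mult)
  have ac: "a \<ge> 0" "c \<ge> 0" by (simp_all add: a_def c_def)
  have q: "0 \<le> a - 2 * s * b + s\<^sup>2 * c" for s
  proof -
    have "0 \<le> (LINT x|M. (cmod (f x) - s * cmod (g x))\<^sup>2)" by simp
    also have "\<dots> = (LINT x|M. (cmod (f x))\<^sup>2 - 2 * s * (cmod (f x) * cmod (g x)) + s\<^sup>2 * (cmod (g x))\<^sup>2)"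
      by (intro Bochner_Integration.integral_cong) (auto simp: power2_eq_square algebra_simps)
    also have "\<dots> = a - 2 * s * b + s\<^sup>2 * c"
      using int L2_integrable_square[OF f] L2_integrable_square[OF g] by (simp add: a_def b_def c_def)
    finally show ?thesis .
  qed
  have "b\<^sup>2 \<le> a * c"
  proof (cases "c = 0")
    case True
    have "b = 0"
    proof (rule ccontr)
      assume "b \<noteq> 0"
      have "a - 2 * ((a + 1) / (2 * b)) * b = - 1" using \<open>b \<noteq> 0\<close> by (simp add: field_simps)
      then show False using q[of "(a + 1) / (2 * b)"] True by simp
    qed
    then show ?thesis using ac by simp
  next
    case False
    then have "c > 0" using ac by simp
    have "a - 2 * (b / c) * b + (b / c)\<^sup>2 * c = a - b\<^sup>2 / c"
      using \<open>c > 0\<close> by (simp add: power2_eq_square field_simps)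
    then have "b\<^sup>2 / c \<le> a" using q[of "b / c"] by simp
    then show ?thesis using \<open>c > 0\<close> by (simp add: field_simps)
  qed
  then have "b \<le> sqrt (a * c)" by (rule real_le_rsqrt)
  then show ?thesis by (simp add: a_def b_def c_def L2_norm_def real_sqrt_mult)
qed

lemma L2_Cauchy_Schwarz:
  assumes f: "f \<in> L2 M" and g: "g \<in> L2 M"
  shows "cmod (L2_inner M f g) \<le> L2_norm M f * L2_norm M g"
proof -
  have "cmod (L2_inner M f g) \<le> (LINT x|M. cmod (f x * cnj (g x)))"
    unfolding L2_inner_def by (rule integral_norm_bound)
  also have "\<dots> \<le> L2_norm M f * L2_norm M g"
    using integral_cmod_mult_le[OF f g] by (simp add: norm_mult)
  finally show ?thesis .
qed

lemma L2_norm_triangle: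
  assumes f: "f \<in> L2 M" and g: "g \<in> L2 M"
  shows "L2_norm M (\<lambda>x. a * f x + b * g x) \<le> cmod a * L2_norm M f + cmod b * L2_norm M g"
proof -
  let ?u = "\<lambda>x. a * f x" and ?v = "\<lambda>x. b * g x"
  have u: "?u \<in> L2 M" and v: "?v \<in> L2 M" using f g by (auto intro: L2_scale)
  have int: "integrable M (\<lambda>x. cmod (?u x) * cmod (?v x))"
    using integrable_norm[OF L2_integrable_mult[OF u v]] by (simp add: norm_mult)
  have "(L2_norm M (\<lambda>x. ?u x + ?v x))\<^sup>2
      \<le> (LINT x|M. (cmod (?u x))\<^sup>2 + 2 * (cmod (?u x) * cmod (?v x)) + (cmod (?v x))\<^sup>2)"
    unfolding L2_norm_power2
  proof (rule integral_mono)
    show "(cmod (?u x + ?v x))\<^sup>2 \<le> (cmod (?u x))\<^sup>2 + 2 * (cmod (?u x) * cmod (?v x)) + (cmod (?v x))\<^sup>2" for x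
      using power_mono[OF norm_triangle_ineq[of "?u x" "?v x"], of 2] by (simp add: power2_sum)
  qed (use int L2_integrable_square[OF u] L2_integrable_square[OF v]
        L2_integrable_square[OF L2_add[OF u v]] in auto)
  also have "\<dots> = (L2_norm M ?u)\<^sup>2 + 2 * (LINT x|M. cmod (?u x) * cmod (?v x)) + (L2_norm M ?v)\<^sup>2"
    using int L2_integrable_square[OF u] L2_integrable_square[OF v] by (simp only: L2_norm_power2) simp
  also have "\<dots> \<le> (L2_norm M ?u + L2_norm M ?v)\<^sup>2"
    using integral_cmod_mult_le[OF u v] by (simp add: power2_sum)
  finally have "L2_norm M (\<lambda>x. ?u x + ?v x) \<le> L2_norm M ?u + L2_norm M ?v"
    by (rule power2_le_imp_le) simp
  then show ?thesis by (simp add: L2_norm_scale)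
qed

section \<open>Bounded operators on square integrable functions\<close>

lemma L2_operator_in: "L2_operator M U \<Longrightarrow> f \<in> L2 M \<Longrightarrow> U f \<in> L2 M"
  by (simp add: L2_operator_def)

lemma L2_operator_lincomb:
  "L2_operator M U \<Longrightarrow> f \<in> L2 M \<Longrightarrow> g \<in> L2 M \<Longrightarrow>
    AE x in M. U (\<lambda>y. a * f y + b * g y) x = a * U f x + b * U g x"
  by (simp add: L2_operator_def)

lemma L2_operator_bound:
  assumes "L2_operator M U"
  obtains C where "C \<ge> 0" "\<And>f. f \<in> L2 M \<Longrightarrow> L2_norm M (U f) \<le> C * L2_norm M f"
proof -
  obtain C where C: "\<And>f. f \<in> L2 M \<Longrightarrow> L2_norm M (U f) \<le> C * L2_norm M f"
    using assms unfolding L2_operator_def by blast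
  show thesis
  proof (rule that[of "max C 0"])
    show "L2_norm M (U f) \<le> max C 0 * L2_norm M f" if "f \<in> L2 M" for f
      using C[OF that] mult_right_mono[of C "max C 0" "L2_norm M f"] by simp
  qed simp
qed

text \<open>The boundedness of \<open>U\<close>, applied to the null function \<open>f - g\<close>, makes \<open>U\<close> well defined on
  equivalence classes.\<close>

lemma L2_operator_AE_cong:
  assumes U: "L2_operator M U" and f: "f \<in> L2 M" and g: "g \<in> L2 M" and eq: "AE x in M. f x = g x"
  shows "AE x in M. U f x = U g x"
proof -
  let ?h = "\<lambda>x. 1 * f x + (- 1) * g x"
  have h: "?h \<in> L2 M" by (intro L2_lincomb f g)
  obtain C where C: "\<And>f. f \<in> L2 M \<Longrightarrow> L2_norm M (U f) \<le> C * L2_norm M f"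
    using L2_operator_bound[OF U] by blast
  have "L2_norm M ?h = L2_norm M (\<lambda>x. 0)"
    by (rule L2_norm_AE_cong) (use eq L2_measurable[OF h] in auto)
  then have "L2_norm M (U ?h) \<le> 0" using C[OF h] by (simp add: L2_norm_def)
  then have "AE x in M. U ?h x = 0"
    by (intro L2_norm_eq_0 L2_operator_in[OF U] h) (simp add: antisym)
  with L2_operator_lincomb[OF U f g, of 1 "-1"] show ?thesis by auto
qed

lemma L2_operator_sum:
  assumes U: "L2_operator M U" and "finite I" "\<And>i. i \<in> I \<Longrightarrow> f i \<in> L2 M"
  shows "AE x in M. U (\<lambda>y. \<Sum>i\<in>I. c i * f i y) x = (\<Sum>i\<in>I. c i * U (f i) x)"
  using assms(2,3)
proof (induction I rule: finite_induct)
  case empty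
  show ?case using L2_operator_lincomb[OF U L2_zero L2_zero, of 0 0] by simp
next
  case (insert i I)
  have "AE x in M. U (\<lambda>y. c i * f i y + 1 * (\<Sum>i\<in>I. c i * f i y)) x
      = c i * U (f i) x + 1 * U (\<lambda>y. \<Sum>i\<in>I. c i * f i y) x"
    using insert by (intro L2_operator_lincomb[OF U] L2_sum) auto
  moreover have "AE x in M. U (\<lambda>y. \<Sum>i\<in>I. c i * f i y) x = (\<Sum>i\<in>I. c i * U (f i) x)"
    using insert by auto
  ultimately show ?case using insert(1,2) by (auto elim!: eventually_elim2)
qed

lemma L2_operator_compose:
  assumes U: "L2_operator M U" and V: "L2_operator M V"
  shows "L2_operator M (\<lambda>f. U (V f))"
  unfolding L2_operator_def
proof (intro conjI ballI allI)
  fix f g a b assume f: "f \<in> L2 M" and g: "g \<in> L2 M"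
  have "AE x in M. U (V (\<lambda>y. a * f y + b * g y)) x = U (\<lambda>y. a * V f y + b * V g y) x"
    by (intro L2_operator_AE_cong[OF U] L2_operator_in[OF V] L2_lincomb
        L2_operator_lincomb[OF V] f g)
  moreover have "AE x in M. U (\<lambda>y. a * V f y + b * V g y) x = a * U (V f) x + b * U (V g) x"
    by (intro L2_operator_lincomb[OF U] L2_operator_in[OF V] f g)
  ultimately show "AE x in M. U (V (\<lambda>y. a * f y + b * g y)) x = a * U (V f) x + b * U (V g) x"
    by auto
next
  obtain C where C: "C \<ge> 0" "\<And>f. f \<in> L2 M \<Longrightarrow> L2_norm M (U f) \<le> C * L2_norm M f"
    using L2_operator_bound[OF U] by blast
  obtain D where D: "D \<ge> 0" "\<And>f. f \<in> L2 M \<Longrightarrow> L2_norm M (V f) \<le> D * L2_norm M f"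
    using L2_operator_bound[OF V] by blast
  show "\<exists>C. \<forall>f\<in>L2 M. L2_norm M (U (V f)) \<le> C * L2_norm M f"
  proof (intro exI ballI)
    fix f assume f: "f \<in> L2 M"
    have "L2_norm M (U (V f)) \<le> C * L2_norm M (V f)" by (intro C L2_operator_in[OF V] f)
    also have "\<dots> \<le> C * (D * L2_norm M f)" by (intro mult_left_mono C D f)
    finally show "L2_norm M (U (V f)) \<le> (C * D) * L2_norm M f" by (simp add: mult.assoc)
  qed
qed (intro L2_operator_in[OF U] L2_operator_in[OF V])

lemma L2_operator_diff:
  assumes U: "L2_operator M U" and V: "L2_operator M V"
  shows "L2_operator M (\<lambda>f x. U f x - V f x)"
  unfolding L2_operator_def
proof (intro conjI ballI allI)
  fix f g a b assume f: "f \<in> L2 M" and g: "g \<in> L2 M"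
  show "AE x in M. U (\<lambda>y. a * f y + b * g y) x - V (\<lambda>y. a * f y + b * g y) x
      = a * (U f x - V f x) + b * (U g x - V g x)"
    using L2_operator_lincomb[OF U f g, of a b] L2_operator_lincomb[OF V f g, of a b]
    by eventually_elim (simp add: algebra_simps)
next
  obtain C where C: "C \<ge> 0" "\<And>f. f \<in> L2 M \<Longrightarrow> L2_norm M (U f) \<le> C * L2_norm M f"
    using L2_operator_bound[OF U] by blast
  obtain D where D: "D \<ge> 0" "\<And>f. f \<in> L2 M \<Longrightarrow> L2_norm M (V f) \<le> D * L2_norm M f"
    using L2_operator_bound[OF V] by blast
  show "\<exists>C. \<forall>f\<in>L2 M. L2_norm M (\<lambda>x. U f x - V f x) \<le> C * L2_norm M f"
  proof (intro exI ballI)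
    fix f assume f: "f \<in> L2 M"
    have "L2_norm M (\<lambda>x. 1 * U f x + (-1) * V f x) \<le> cmod 1 * L2_norm M (U f) + cmod (-1) * L2_norm M (V f)"
      by (intro L2_norm_triangle L2_operator_in[OF U] L2_operator_in[OF V] f)
    also have "\<dots> \<le> C * L2_norm M f + D * L2_norm M f" using C(2)[OF f] D(2)[OF f] by simp
    finally show "L2_norm M (\<lambda>x. U f x - V f x) \<le> (C + D) * L2_norm M f" by (simp add: distrib_right)
  qed
qed (intro L2_diff L2_operator_in[OF U] L2_operator_in[OF V])

lemma L2_operator_AE_equal:
  assumes U: "L2_operator M U" and V: "\<And>f. f \<in> L2 M \<Longrightarrow> V f \<in> borel_measurable M"
    and eq: "\<And>f. f \<in> L2 M \<Longrightarrow> AE x in M. U f x = V f x"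
  shows "L2_operator M V"
  unfolding L2_operator_def
proof (intro conjI ballI allI)
  fix f g a b assume f: "f \<in> L2 M" and g: "g \<in> L2 M"
  show "AE x in M. V (\<lambda>y. a * f y + b * g y) x = a * V f x + b * V g x"
    using L2_operator_lincomb[OF U f g, of a b] eq[OF f] eq[OF g] eq[OF L2_lincomb[OF f g, of a b]]
    by eventually_elim simp
next
  have "L2_norm M (U f) = L2_norm M (V f)" if "f \<in> L2 M" for f
    using V[OF that] L2_measurable[OF L2_operator_in[OF U that]] eq[OF that] by (intro L2_norm_AE_cong)
  then show "\<exists>C. \<forall>f\<in>L2 M. L2_norm M (V f) \<le> C * L2_norm M f"
    using U by (simp add: L2_operator_def)
next
  fix f assume "f \<in> L2 M"
  then show "V f \<in> L2 M"
    using L2_AE_cong[OF L2_operator_in[OF U] V eq] by blast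
qed

text \<open>Polarization: since \<open>\<langle>R h, h\<rangle>\<close> is real for \<open>h = f + a g\<close>, so is its part linear in \<open>a\<close>; the values
  \<open>a = 1\<close> and \<open>a = \<i>\<close> determine it.\<close>

lemma positive_operator_symmetric:
  assumes R: "L2_operator M R" and pos: "positive_operator M R" and f: "f \<in> L2 M" and g: "g \<in> L2 M"
  shows "L2_inner M (R f) g = L2_inner M f (R g)"
proof -
  let ?p = "L2_inner M (R f) g" and ?q = "L2_inner M (R g) f"
  have real: "L2_inner M (R h) h \<in> \<real>" if "h \<in> L2 M" for h
    using pos that nonneg_Reals_subset_Reals unfolding positive_operator_def L2_inner_def by blast
  have *: "cnj a * ?p + a * ?q \<in> \<real>" for a
  proof -
    let ?h = "\<lambda>x. 1 * f x + a * g x"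
    note Rf = L2_operator_in[OF R f] and Rg = L2_operator_in[OF R g]
    have h: "?h \<in> L2 M" by (intro L2_lincomb f g)
    have "L2_inner M (R ?h) ?h = L2_inner M (\<lambda>x. 1 * R f x + a * R g x) ?h"
      using L2_operator_lincomb[OF R f g, of 1 a] h Rf Rg f g
      by (intro L2_inner_AE_cong L2_measurable L2_operator_in[OF R] L2_lincomb) auto
    also have "\<dots> = L2_inner M (R f) ?h + a * L2_inner M (R g) ?h"
      using L2_inner_lincomb_left[OF Rf Rg h, of 1 a] by simp
    also have "L2_inner M (R f) ?h = cnj (1 * L2_inner M f (R f) + a * L2_inner M g (R f))"
      using L2_inner_lincomb_left[OF f g Rf, of 1 a] L2_inner_commute[of M "R f" ?h] by simp
    also have "\<dots> = L2_inner M (R f) f + cnj a * ?p"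
      by (simp flip: L2_inner_commute)
    also have "L2_inner M (R g) ?h = cnj (1 * L2_inner M f (R g) + a * L2_inner M g (R g))"
      using L2_inner_lincomb_left[OF f g Rg, of 1 a] L2_inner_commute[of M "R g" ?h] by simp
    also have "\<dots> = ?q + cnj a * L2_inner M (R g) g"
      by (simp flip: L2_inner_commute)
    finally have e: "L2_inner M (R ?h) ?h
        = (cnj a * ?p + a * ?q) + (L2_inner M (R f) f + a * cnj a * L2_inner M (R g) g)"
      by (simp add: algebra_simps)
    have r: "L2_inner M (R f) f + a * cnj a * L2_inner M (R g) g \<in> \<real>"
    proof -
      have "a * cnj a \<in> \<real>" unfolding complex_norm_square[symmetric] by (rule Reals_of_real)
      then show ?thesis by (intro Reals_add Reals_mult[of "a * cnj a"] real f g)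
    qed
    show ?thesis using Reals_diff[OF real[OF h] r] unfolding e by simp
  qed
  have "?p + ?q \<in> \<real>" using *[of 1] by simp
  moreover have "- \<i> * ?p + \<i> * ?q \<in> \<real>" using *[of \<i>] by simp
  ultimately have "?p = cnj ?q"
    by (auto simp: complex_is_Real_iff complex_eq_iff)
  then show ?thesis by (simp flip: L2_inner_commute)
qed

section \<open>Rank up to almost everywhere equality\<close>

definition AE_spanned :: "'b measure \<Rightarrow> ('b \<Rightarrow> complex) set \<Rightarrow> ('b \<Rightarrow> complex) set \<Rightarrow> bool" where
  "AE_spanned M V F \<longleftrightarrow> (\<forall>v\<in>V. \<exists>c. AE x in M. v x = (\<Sum>g\<in>F. c g * g x))"

lemma AE_spanned_lincomb:
  assumes "\<exists>c. AE x in M. u x = (\<Sum>g\<in>F. c g * (g x::complex))" "\<exists>c. AE x in M. v x = (\<Sum>g\<in>F. c g * g x)"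
  shows "\<exists>c. AE x in M. a * u x + b * v x = (\<Sum>g\<in>F. c g * g x)"
proof -
  obtain c d where "AE x in M. u x = (\<Sum>g\<in>F. c g * g x)" "AE x in M. v x = (\<Sum>g\<in>F. d g * g x)"
    using assms by blast
  then have "AE x in M. a * u x + b * v x = (\<Sum>g\<in>F. (a * c g + b * d g) * g x)"
    by eventually_elim (simp add: sum_distrib_left sum.distrib algebra_simps)
  then show ?thesis by - (rule exI)
qed

lemma AE_spanned_mono:
  assumes "finite G" "F \<subseteq> G" "\<exists>c. AE x in M. v x = (\<Sum>g\<in>F. c g * (g x :: complex))"
  shows "\<exists>c. AE x in M. v x = (\<Sum>g\<in>G. c g * g x)"
proof -
  obtain c where c: "AE x in M. v x = (\<Sum>g\<in>F. c g * g x)" using assms(3) by blast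
  have "(\<Sum>g\<in>G. (if g \<in> F then c g else 0) * g x) = (\<Sum>g\<in>F. c g * g x)" for x
    using assms by (intro sum.mono_neutral_cong_right) auto
  with c show ?thesis by (intro exI[of _ "\<lambda>g. if g \<in> F then c g else 0"]) simp
qed

lemma sum_coeffs_image:
  fixes f :: "'i \<Rightarrow> 'b \<Rightarrow> complex"
  assumes "finite I"
  shows "\<exists>c. \<forall>x. (\<Sum>i\<in>I. a i * f i x) = (\<Sum>g\<in>f ` I. c g * g x)"
proof (intro exI allI)
  show "(\<Sum>i\<in>I. a i * f i x) = (\<Sum>g\<in>f ` I. (\<Sum>i\<in>{i\<in>I. f i = g}. a i) * g x)" for x
    by (subst sum.image_gen[OF assms, of _ f]) (auto simp: sum_distrib_right intro!: sum.cong)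
qed

text \<open>Exchange argument: an element of \<open>V\<close> involving the vector \<open>f\<close> replaces it, and
  eliminating \<open>f\<close> from the remaining elements leaves a subspace of the span of the others.\<close>

lemma AE_spanned_exchange:
  assumes "finite F" "AE_spanned M V F"
    and "\<And>u v a b. u \<in> V \<Longrightarrow> v \<in> V \<Longrightarrow> \<exists>w\<in>V. AE x in M. w x = a * u x + b * v x"
  shows "\<exists>G\<subseteq>V. finite G \<and> card G \<le> card F \<and> AE_spanned M V G"
  using assms
proof (induction F arbitrary: V rule: finite_induct)
  case empty
  then show ?case by (intro exI[of _ "{}"]) auto
next
  case (insert f F)
  show ?case
  proof (cases "AE_spanned M V F")
    case True
    from insert.IH[OF this insert.prems(2)] show ?thesis
      using insert.hyps by (auto simp: card_insert_if intro: le_SucI)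
  next
    case False
    then obtain v0 where v0: "v0 \<in> V" and nv0: "\<not> (\<exists>c. AE x in M. v0 x = (\<Sum>g\<in>F. c g * g x))"
      by (auto simp: AE_spanned_def)
    obtain c0 where c0: "AE x in M. v0 x = (\<Sum>g\<in>insert f F. c0 g * g x)"
      using insert.prems(1) v0 unfolding AE_spanned_def by blast
    have "c0 f \<noteq> 0" using nv0 c0 insert.hyps by auto
    define V' where "V' = {w\<in>V. \<exists>c. AE x in M. w x = (\<Sum>g\<in>F. c g * g x)}"
    have "\<exists>G\<subseteq>V'. finite G \<and> card G \<le> card F \<and> AE_spanned M V' G"
    proof (rule insert.IH)
      show "AE_spanned M V' F" by (simp add: AE_spanned_def V'_def)
      fix u v a b assume u: "u \<in> V'" and v: "v \<in> V'"
      then obtain w where w: "w \<in> V" "AE x in M. w x = a * u x + b * v x"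
        using insert.prems(2)[of u v a b] by (auto simp: V'_def)
      have "\<exists>c. AE x in M. a * u x + b * v x = (\<Sum>g\<in>F. c g * g x)"
        using u v by (intro AE_spanned_lincomb) (auto simp: V'_def)
      then obtain c where "AE x in M. a * u x + b * v x = (\<Sum>g\<in>F. c g * g x)" ..
      with w(2) have "AE x in M. w x = (\<Sum>g\<in>F. c g * g x)" by eventually_elim simp
      with w show "\<exists>w\<in>V'. AE x in M. w x = a * u x + b * v x" by (auto simp: V'_def)
    qed
    then obtain G where G: "G \<subseteq> V'" "finite G" "card G \<le> card F" "AE_spanned M V' G" by blast
    have "AE_spanned M V (insert v0 G)"
      unfolding AE_spanned_def
    proof
      fix v assume v: "v \<in> V"
      obtain c where c: "AE x in M. v x = (\<Sum>g\<in>insert f F. c g * g x)"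
        using insert.prems(1) v unfolding AE_spanned_def by blast
      \<comment> \<open>subtracting \<open>s v0\<close> from \<open>v\<close> eliminates \<open>f\<close>\<close>
      define s where "s = c f / c0 f"
      obtain w where w: "w \<in> V" "AE x in M. w x = 1 * v x + (- s) * v0 x"
        using insert.prems(2)[OF v v0] by blast
      have "AE x in M. w x = (\<Sum>g\<in>F. (c g - s * c0 g) * g x)"
        using w(2) c c0
      proof eventually_elim
        case (elim x)
        have "w x = c f * f x + (\<Sum>g\<in>F. c g * g x) - s * (c0 f * f x + (\<Sum>g\<in>F. c0 g * g x))"
          using elim insert.hyps by simp
        also have "\<dots> = (\<Sum>g\<in>F. c g * g x) - s * (\<Sum>g\<in>F. c0 g * g x)"
          using \<open>c0 f \<noteq> 0\<close> by (simp add: s_def field_simps)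
        also have "\<dots> = (\<Sum>g\<in>F. (c g - s * c0 g) * g x)"
          by (simp add: sum_distrib_left sum_subtractf algebra_simps)
        finally show ?case .
      qed
      with w(1) have "w \<in> V'" unfolding V'_def by (auto intro: exI[of _ "\<lambda>g. c g - s * c0 g"])
      then obtain d where d: "AE x in M. w x = (\<Sum>g\<in>G. d g * g x)"
        using G(4) by (auto simp: AE_spanned_def)
      have "\<exists>c. AE x in M. 1 * w x + s * v0 x = (\<Sum>g\<in>insert v0 G. c g * g x)"
      proof (rule AE_spanned_lincomb)
        show "\<exists>c. AE x in M. w x = (\<Sum>g\<in>insert v0 G. c g * g x)"
        proof (rule AE_spanned_mono[of _ G])
          show "\<exists>c. AE x in M. w x = (\<Sum>g\<in>G. c g * g x)" using d by - (rule exI)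
        qed (use G(2) in auto)
        show "\<exists>c. AE x in M. v0 x = (\<Sum>g\<in>insert v0 G. c g * g x)"
        proof (rule AE_spanned_mono[of _ "{v0}"])
          show "\<exists>c. AE x in M. v0 x = (\<Sum>g\<in>{v0}. c g * g x)" by (rule exI[of _ "\<lambda>_. 1"]) simp
        qed (use G(2) in auto)
      qed
      then obtain d' where "AE x in M. 1 * w x + s * v0 x = (\<Sum>g\<in>insert v0 G. d' g * g x)" ..
      with w(2) have "AE x in M. v x = (\<Sum>g\<in>insert v0 G. d' g * g x)" by eventually_elim simp
      then show "\<exists>c. AE x in M. v x = (\<Sum>g\<in>insert v0 G. c g * g x)" by - (rule exI)
    qed
    moreover have "insert v0 G \<subseteq> V" using G(1) v0 by (auto simp: V'_def)
    moreover have "card (insert v0 G) \<le> card (insert f F)"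
      using G(2,3) insert.hyps by (simp add: card_insert_if)
    ultimately show ?thesis using G(2) by blast
  qed
qed

text \<open>In contrast to \<open>op_rank\<close> the spanning set may be any subset of \<open>L\<^sup>2\<close>, which makes the
  behaviour under sums and compositions evident. For operators the two notions agree, by the
  exchange argument (\<open>op_rank_le_D\<close> with \<open>AE_rank_le_I\<close>, and \<open>op_rank_le_I\<close>).\<close>

definition AE_rank_le :: "'b measure \<Rightarrow> (('b \<Rightarrow> complex) \<Rightarrow> 'b \<Rightarrow> complex) \<Rightarrow> nat \<Rightarrow> bool" where
  "AE_rank_le M U r \<longleftrightarrow> (\<exists>F. finite F \<and> F \<subseteq> L2 M \<and> card F \<le> r \<and> AE_spanned M (U ` L2 M) F)"

lemma op_rank_le_D:
  assumes "op_rank M U \<le> enat r"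
  obtains F where "finite F" "card F \<le> r" "AE_spanned M (U ` L2 M) F"
proof -
  let ?S = "{G. finite G \<and> G \<subseteq> U ` L2 M \<and> (\<forall>f\<in>L2 M. \<exists>c. AE x in M. U f x = (\<Sum>g\<in>G. c g * g x))}"
  \<comment> \<open>the strict inequality also excludes the infimum over the empty set\<close>
  have "(INF G \<in> ?S. enat (card G)) < enat (Suc r)"
    using assms unfolding op_rank_def by (rule le_less_trans) simp
  then obtain G where "G \<in> ?S" "enat (card G) < enat (Suc r)"
    unfolding Inf_less_iff by blast
  then show thesis by (intro that[of G]) (auto simp: AE_spanned_def)
qed

lemma AE_lincomb_range:
  assumes "\<And>f g a b. f \<in> L2 M \<Longrightarrow> g \<in> L2 M \<Longrightarrow>
      AE x in M. U (\<lambda>y. a * f y + b * g y) x = a * U f x + b * U g x"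
    and "u \<in> U ` L2 M" "v \<in> U ` L2 M"
  shows "\<exists>w\<in>U ` L2 M. AE x in M. w x = a * u x + b * v x"
proof -
  obtain f g where fg: "f \<in> L2 M" "u = U f" "g \<in> L2 M" "v = U g" using assms(2,3) by blast
  show ?thesis
    using assms(1)[OF fg(1,3), of a b] fg
    by (intro bexI[of _ "U (\<lambda>y. a * f y + b * g y)"] imageI L2_lincomb) auto
qed

lemma AE_rank_le_I:
  assumes U: "L2_operator M U" and F: "finite F" "card F \<le> r" "AE_spanned M (U ` L2 M) F"
  shows "AE_rank_le M U r"
proof -
  obtain G where "G \<subseteq> U ` L2 M" "finite G" "card G \<le> card F" "AE_spanned M (U ` L2 M) G"
    using AE_spanned_exchange[OF F(1,3) AE_lincomb_range[OF L2_operator_lincomb[OF U]]] by blast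
  then show ?thesis
    unfolding AE_rank_le_def using F(2) L2_operator_in[OF U] by (intro exI[of _ G]) auto
qed

lemma op_rank_le_I:
  assumes U: "L2_operator M U" and "AE_rank_le M U r"
  shows "op_rank M U \<le> enat r"
proof -
  obtain F where F: "finite F" "card F \<le> r" "AE_spanned M (U ` L2 M) F"
    using assms(2) by (auto simp: AE_rank_le_def)
  obtain G where G: "G \<subseteq> U ` L2 M" "finite G" "card G \<le> card F" "AE_spanned M (U ` L2 M) G"
    using AE_spanned_exchange[OF F(1,3) AE_lincomb_range[OF L2_operator_lincomb[OF U]]] by blast
  have "op_rank M U \<le> enat (card G)"
    unfolding op_rank_def using G(1,2,4) by (intro INF_lower) (auto simp: AE_spanned_def)
  also have "\<dots> \<le> enat r" using G(3) F(2) by simp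
  finally show ?thesis .
qed

lemma AE_rank_le_add:
  assumes "AE_rank_le M U r" "AE_rank_le M V s"
  shows "AE_rank_le M (\<lambda>f x. U f x + V f x) (r + s)"
proof -
  obtain F where F: "finite F" "F \<subseteq> L2 M" "card F \<le> r" "AE_spanned M (U ` L2 M) F"
    using assms(1) by (auto simp: AE_rank_le_def)
  obtain G where G: "finite G" "G \<subseteq> L2 M" "card G \<le> s" "AE_spanned M (V ` L2 M) G"
    using assms(2) by (auto simp: AE_rank_le_def)
  have "AE_spanned M ((\<lambda>f x. U f x + V f x) ` L2 M) (F \<union> G)"
    unfolding AE_spanned_def
  proof safe
    fix f assume f: "f \<in> L2 M"
    have "\<exists>c. AE x in M. U f x = (\<Sum>g\<in>F \<union> G. c g * g x)"
      using F f G(1) by (intro AE_spanned_mono[of "F \<union> G" F]) (auto simp: AE_spanned_def)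
    moreover have "\<exists>c. AE x in M. V f x = (\<Sum>g\<in>F \<union> G. c g * g x)"
      using F f G by (intro AE_spanned_mono[of "F \<union> G" G]) (auto simp: AE_spanned_def)
    ultimately show "\<exists>c. AE x in M. U f x + V f x = (\<Sum>g\<in>F \<union> G. c g * g x)"
      using AE_spanned_lincomb[of "U f" "F \<union> G" M "V f" 1 1] by simp
  qed
  then show ?thesis
    unfolding AE_rank_le_def using F G card_Un_le[of F G] by (intro exI[of _ "F \<union> G"]) auto
qed

lemma AE_rank_le_AE_equal:
  assumes "AE_rank_le M U r" "\<And>f. f \<in> L2 M \<Longrightarrow> AE x in M. U f x = V f x"
  shows "AE_rank_le M V r"
proof -
  obtain F where F: "finite F" "F \<subseteq> L2 M" "card F \<le> r" "AE_spanned M (U ` L2 M) F"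
    using assms(1) by (auto simp: AE_rank_le_def)
  have "AE_spanned M (V ` L2 M) F"
    unfolding AE_spanned_def
  proof safe
    fix f assume f: "f \<in> L2 M"
    then obtain c where "AE x in M. U f x = (\<Sum>g\<in>F. c g * g x)"
      using F(4) by (auto simp: AE_spanned_def)
    with assms(2)[OF f] have "AE x in M. V f x = (\<Sum>g\<in>F. c g * g x)" by eventually_elim simp
    then show "\<exists>c. AE x in M. V f x = (\<Sum>g\<in>F. c g * g x)" by - (rule exI)
  qed
  with F show ?thesis by (auto simp: AE_rank_le_def)
qed

lemma AE_rank_le_compose_right:
  assumes "AE_rank_le M U r" "L2_operator M V"
  shows "AE_rank_le M (\<lambda>f. U (V f)) r"
proof -
  have "(\<lambda>f. U (V f)) ` L2 M \<subseteq> U ` L2 M" using L2_operator_in[OF assms(2)] by auto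
  then show ?thesis using assms(1) unfolding AE_rank_le_def AE_spanned_def by blast
qed

lemma AE_rank_le_compose_left:
  assumes U: "AE_rank_le M U r" "\<And>f. f \<in> L2 M \<Longrightarrow> U f \<in> L2 M" and W: "L2_operator M W"
  shows "AE_rank_le M (\<lambda>f. W (U f)) r"
proof -
  obtain F where F: "finite F" "F \<subseteq> L2 M" "card F \<le> r" "AE_spanned M (U ` L2 M) F"
    using U(1) by (auto simp: AE_rank_le_def)
  have "AE_spanned M ((\<lambda>f. W (U f)) ` L2 M) (W ` F)"
    unfolding AE_spanned_def
  proof safe
    fix f assume f: "f \<in> L2 M"
    then obtain c where c: "AE x in M. U f x = (\<Sum>g\<in>F. c g * g x)"
      using F(4) by (auto simp: AE_spanned_def)
    have "AE x in M. W (U f) x = W (\<lambda>x. \<Sum>g\<in>F. c g * g x) x"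
      using F f by (intro L2_operator_AE_cong[OF W] U(2) L2_sum c) auto
    moreover have "AE x in M. W (\<lambda>x. \<Sum>g\<in>F. c g * g x) x = (\<Sum>g\<in>F. c g * W g x)"
      using F by (intro L2_operator_sum[OF W]) auto
    \<comment> \<open>\<open>W\<close> need not be injective on \<open>F\<close>, so coefficients with the same image are collected\<close>
    moreover obtain d where "\<forall>x. (\<Sum>g\<in>F. c g * W g x) = (\<Sum>h\<in>W ` F. d h * h x)"
      using sum_coeffs_image[OF F(1), of c W] by blast
    ultimately have "AE x in M. W (U f) x = (\<Sum>h\<in>W ` F. d h * h x)"
      by auto
    then show "\<exists>c. AE x in M. W (U f) x = (\<Sum>g\<in>W ` F. c g * g x)" by - (rule exI)
  qed
  then show ?thesis
    unfolding AE_rank_le_def using F L2_operator_in[OF W] card_image_le[OF F(1), of W]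
    by (intro exI[of _ "W ` F"]) auto
qed

section \<open>A bound for approximation numbers\<close>

text \<open>The bound ensures that the supremum in \<open>op_norm\<close> is taken over a nonempty bounded set of reals,
  where it has its usual meaning.\<close>

lemma op_norm_nonneg_le:
  assumes "\<And>f. f \<in> L2 M \<Longrightarrow> L2_norm M (U f) \<le> C * L2_norm M f" "C \<ge> 0"
  shows "0 \<le> op_norm M U" "op_norm M U \<le> C"
proof -
  let ?S = "{L2_norm M (U f) | f. f \<in> L2 M \<and> L2_norm M f \<le> 1}"
  have le: "y \<le> C" if "y \<in> ?S" for y
  proof -
    obtain f where f: "f \<in> L2 M" "L2_norm M f \<le> 1" "y = L2_norm M (U f)" using \<open>y \<in> ?S\<close> by auto
    have "y \<le> C * L2_norm M f" using assms(1)[OF f(1)] f(3) by simp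
    also have "\<dots> \<le> C * 1" using f(2) assms(2) by (intro mult_left_mono)
    finally show ?thesis by simp
  qed
  have mem: "L2_norm M (U (\<lambda>x. 0)) \<in> ?S" using L2_zero[of M] by (auto simp: L2_norm_def)
  have bdd: "bdd_above ?S" using le by (rule bdd_aboveI)
  show "0 \<le> op_norm M U"
    unfolding op_norm_def using cSup_upper[OF mem bdd] L2_norm_nonneg[of M "U (\<lambda>x. 0)"] by linarith
  show "op_norm M U \<le> C" unfolding op_norm_def using le mem by (intro cSup_least) auto
qed

lemma approx_number_bounds:
  assumes T: "L2_operator M T" and U: "L2_operator M U" and rank: "AE_rank_le M U (n - 1)"
    and C: "\<And>f. f \<in> L2 M \<Longrightarrow> L2_norm M (\<lambda>x. T f x - U f x) \<le> C * L2_norm M f" "C \<ge> 0"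
  shows "0 \<le> approx_number M n T" "approx_number M n T \<le> C"
proof -
  let ?S = "{op_norm M (\<lambda>f x. T f x - U f x) | U. L2_operator M U \<and> op_rank M U \<le> enat (n - 1)}"
  have nonneg: "0 \<le> y" if "y \<in> ?S" for y
  proof -
    obtain V where V: "y = op_norm M (\<lambda>f x. T f x - V f x)" "L2_operator M V"
      using \<open>y \<in> ?S\<close> by blast
    obtain D where "D \<ge> 0" "\<And>f. f \<in> L2 M \<Longrightarrow> L2_norm M (\<lambda>x. T f x - V f x) \<le> D * L2_norm M f"
      using L2_operator_bound[OF L2_operator_diff[OF T V(2)]] by blast
    then show ?thesis unfolding V(1) by (intro op_norm_nonneg_le(1)[where C=D]) auto
  qed
  have mem: "op_norm M (\<lambda>f x. T f x - U f x) \<in> ?S"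
    using U op_rank_le_I[OF U rank] by auto
  show "0 \<le> approx_number M n T"
    unfolding approx_number_def using mem nonneg by (intro cInf_greatest) auto
  have "approx_number M n T \<le> op_norm M (\<lambda>f x. T f x - U f x)"
    unfolding approx_number_def using mem nonneg by (intro cInf_lower bdd_belowI[of _ 0]) auto
  also have "\<dots> \<le> C" using C by (rule op_norm_nonneg_le(2))
  finally show "approx_number M n T \<le> C" .
qed

text \<open>If \<open>R\<close> is within \<open>\<eta>\<close> of an operator of rank \<open>s\<close>, then \<open>R\<^sup>2\<close> is within \<open>\<eta>\<^sup>2\<close> of one of
  rank \<open>2 s\<close>: with \<open>W\<close> the small difference, \<open>R R - W W = W (R - W) + (R - W) R\<close>.\<close>

lemma approx_number_square_bounds:
  assumes T: "L2_operator M T" and R: "L2_operator M R" and W: "L2_operator M W"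
    and RRT: "\<And>f. f \<in> L2 M \<Longrightarrow> AE x in M. R (R f) x = T f x"
    and rank: "AE_rank_le M (\<lambda>f x. R f x - W f x) s"
    and \<eta>: "\<And>f. f \<in> L2 M \<Longrightarrow> L2_norm M (W f) \<le> \<eta> * L2_norm M f" "\<eta> \<ge> 0"
    and n: "2 * s < n"
  shows "0 \<le> approx_number M n T" "approx_number M n T \<le> \<eta>\<^sup>2"
proof -
  let ?D = "\<lambda>f x. R f x - W f x"
  let ?U = "\<lambda>f x. T f x - W (W f) x"
  have D: "L2_operator M ?D" by (intro L2_operator_diff R W)
  have WW: "L2_operator M (\<lambda>f. W (W f))" by (rule L2_operator_compose[OF W W])
  have U: "L2_operator M ?U" by (intro L2_operator_diff T WW)
  have "AE_rank_le M (\<lambda>f x. W (?D f) x + ?D (R f) x) (s + s)"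
    by (intro AE_rank_le_add AE_rank_le_compose_left[OF rank _ W]
        AE_rank_le_compose_right[OF rank R] L2_operator_in[OF D])
  then have "AE_rank_le M ?U (s + s)"
  proof (rule AE_rank_le_AE_equal)
    fix f assume f: "f \<in> L2 M"
    have "AE x in M. W (\<lambda>y. 1 * R f y + (-1) * W f y) x = 1 * W (R f) x + (-1) * W (W f) x"
      by (intro L2_operator_lincomb[OF W] L2_operator_in[OF R] L2_operator_in[OF W] f)
    with RRT[OF f] show "AE x in M. W (?D f) x + ?D (R f) x = ?U f x"
      by eventually_elim simp
  qed
  then have rank': "AE_rank_le M ?U (n - 1)"
    using n unfolding AE_rank_le_def by (auto elim!: ex_forward)
  have bd: "L2_norm M (\<lambda>x. T f x - ?U f x) \<le> \<eta>\<^sup>2 * L2_norm M f" if f: "f \<in> L2 M" for f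
  proof -
    have "L2_norm M (\<lambda>x. T f x - ?U f x) = L2_norm M (W (W f))" by simp
    also have "\<dots> \<le> \<eta> * L2_norm M (W f)" by (intro \<eta> L2_operator_in[OF W] f)
    also have "\<dots> \<le> \<eta> * (\<eta> * L2_norm M f)" by (intro mult_left_mono \<eta> f)
    finally show ?thesis by (simp add: power2_eq_square mult.assoc)
  qed
  show "0 \<le> approx_number M n T" "approx_number M n T \<le> \<eta>\<^sup>2"
    using approx_number_bounds[OF T U rank' bd] by simp_all
qed

section \<open>Operators into bounded functions\<close>

definition L2_orthonormal :: "'b measure \<Rightarrow> (nat \<Rightarrow> 'b \<Rightarrow> complex) \<Rightarrow> nat \<Rightarrow> bool" where
  "L2_orthonormal M q s \<longleftrightarrow> (\<forall>i<s. q i \<in> L2 M) \<and>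
     (\<forall>i<s. \<forall>j<s. L2_inner M (q i) (q j) = (if i = j then 1 else 0))"

lemma L2_orthonormal_inner_sum:
  assumes "L2_orthonormal M q s" "j < s"
  shows "L2_inner M (\<lambda>x. \<Sum>i<s. c i * q i x) (q j) = c j"
proof -
  have "L2_inner M (\<lambda>x. \<Sum>i<s. c i * q i x) (q j) = (\<Sum>i<s. c i * L2_inner M (q i) (q j))"
    using assms by (intro L2_inner_sum_left) (auto simp: L2_orthonormal_def)
  also have "\<dots> = (\<Sum>i<s. if i = j then c j else 0)"
    using assms by (intro sum.cong) (auto simp: L2_orthonormal_def)
  also have "\<dots> = c j" using assms by simp
  finally show ?thesis .
qed

lemma L2_orthonormal_norm_sum:
  assumes "L2_orthonormal M q s"
  shows "(L2_norm M (\<lambda>x. \<Sum>i<s. c i * q i x))\<^sup>2 = (\<Sum>i<s. (cmod (c i))\<^sup>2)"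
proof -
  let ?f = "\<lambda>x. \<Sum>i<s. c i * q i x"
  have q: "q i \<in> L2 M" if "i < s" for i using assms that by (simp add: L2_orthonormal_def)
  have f: "?f \<in> L2 M" using q by (intro L2_sum) auto
  have "complex_of_real ((L2_norm M ?f)\<^sup>2) = L2_inner M ?f ?f" by (simp add: L2_inner_self)
  also have "\<dots> = (\<Sum>i<s. c i * L2_inner M (q i) ?f)"
    using q f by (intro L2_inner_sum_left) auto
  also have "\<dots> = (\<Sum>i<s. c i * cnj (c i))"
  proof (rule sum.cong)
    show "c i * L2_inner M (q i) ?f = c i * cnj (c i)" if "i \<in> {..<s}" for i
      using L2_orthonormal_inner_sum[OF assms, of i c] that L2_inner_commute[of M "q i" ?f] by simp
  qed simp
  also have "\<dots> = complex_of_real (\<Sum>i<s. (cmod (c i))\<^sup>2)"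
    by (simp add: complex_norm_square[symmetric])
  finally show ?thesis by (simp only: of_real_eq_iff)
qed

text \<open>An operator mapping \<open>L\<^sup>2\<close> boundedly into the bounded functions is a Hilbert-Schmidt operator
  on a finite measure space. For fixed \<open>x\<close> the numbers \<open>A f\<^sub>j(x)\<close> are the coefficients of a functional
  on the span of the \<open>f\<^sub>j\<close> of norm at most \<open>\<delta>\<close>; a countable dense set of coefficient vectors
  gives a null set that serves all of them at once.\<close>

lemma sum_square_norm_le_of_sup_bound:
  assumes M: "finite_measure M" and A: "L2_operator M A"
    and sup: "\<And>f. f \<in> L2 M \<Longrightarrow> AE x in M. cmod (A f x) \<le> \<delta> * L2_norm M f"
    and "\<delta> \<ge> 0" and on: "L2_orthonormal M q s"
  shows "(\<Sum>j<s. (L2_norm M (A (q j)))\<^sup>2) \<le> \<delta>\<^sup>2 * measure M (space M)"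
proof -
  interpret finite_measure M by fact
  have q: "q i \<in> L2 M" if "i < s" for i using on that by (simp add: L2_orthonormal_def)
  obtain D :: "(nat \<Rightarrow> complex) set" where D: "countable D" "\<And>X. open X \<Longrightarrow> X \<noteq> {} \<Longrightarrow> \<exists>d\<in>D. d \<in> X"
    using countable_dense_setE by blast
  have "AE x in M. cmod (\<Sum>j<s. c j * A (q j) x) \<le> \<delta> * sqrt (\<Sum>j<s. (cmod (c j))\<^sup>2)" for c
  proof -
    have "AE x in M. A (\<lambda>y. \<Sum>j<s. c j * q j y) x = (\<Sum>j<s. c j * A (q j) x)"
      using q by (intro L2_operator_sum[OF A]) auto
    moreover have "AE x in M. cmod (A (\<lambda>y. \<Sum>j<s. c j * q j y) x) \<le> \<delta> * L2_norm M (\<lambda>y. \<Sum>j<s. c j * q j y)"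
      using q by (intro sup L2_sum) auto
    moreover have "L2_norm M (\<lambda>y. \<Sum>j<s. c j * q j y) = sqrt (\<Sum>j<s. (cmod (c j))\<^sup>2)"
      using L2_orthonormal_norm_sum[OF on, of c] by (metis L2_norm_nonneg real_sqrt_unique)
    ultimately show ?thesis by auto
  qed
  then have "AE x in M. \<forall>c\<in>D. cmod (\<Sum>j<s. c j * A (q j) x) \<le> \<delta> * sqrt (\<Sum>j<s. (cmod (c j))\<^sup>2)"
    using D(1) by (simp add: AE_ball_countable)
  then have "AE x in M. (\<Sum>j<s. (cmod (A (q j) x))\<^sup>2) \<le> \<delta>\<^sup>2"
  proof eventually_elim
    case (elim x)
    define a where "a j = A (q j) x" for j
    let ?X = "{c. \<delta> * sqrt (\<Sum>j<s. (cmod (c j))\<^sup>2) < cmod (\<Sum>j<s. c j * a j)}"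
    have "open ?X"
      by (intro open_Collect_less continuous_intros continuous_on_product_coordinates)
    have "c \<notin> ?X" for c
    proof
      assume "c \<in> ?X"
      then obtain d where "d \<in> D" "d \<in> ?X" using D(2)[OF \<open>open ?X\<close>] by blast
      then show False using elim by (auto simp: a_def not_less[symmetric])
    qed
    \<comment> \<open>the coefficients for which equality holds in the Cauchy-Schwarz inequality\<close>
    from this[of "\<lambda>j. cnj (a j)"]
    have "cmod (\<Sum>j<s. cnj (a j) * a j) \<le> \<delta> * sqrt (\<Sum>j<s. (cmod (cnj (a j)))\<^sup>2)"
      by (simp only: mem_Collect_eq not_less)
    moreover have "(\<Sum>j<s. cnj (a j) * a j) = complex_of_real (\<Sum>j<s. (cmod (a j))\<^sup>2)"
      by (simp add: mult.commute[of "cnj _"] complex_norm_square[symmetric])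
    ultimately have le: "(\<Sum>j<s. (cmod (a j))\<^sup>2) \<le> \<delta> * sqrt (\<Sum>j<s. (cmod (a j))\<^sup>2)"
      by (simp add: sum_nonneg del: of_real_sum)
    define S where "S = (\<Sum>j<s. (cmod (a j))\<^sup>2)"
    have S: "S \<ge> 0" "S \<le> \<delta> * sqrt S" using le by (auto simp: S_def sum_nonneg)
    have "sqrt S \<le> \<delta>"
    proof (cases "S = 0")
      case False
      then have "sqrt S > 0" using S(1) by simp
      moreover have "sqrt S * sqrt S \<le> \<delta> * sqrt S" using S by simp
      ultimately show ?thesis by (rule mult_right_le_imp_le[rotated])
    qed (use \<open>\<delta> \<ge> 0\<close> in simp)
    then have "S \<le> \<delta>\<^sup>2" using S(1) power_mono[OF \<open>sqrt S \<le> \<delta>\<close>, of 2] by simp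
    then show ?case by (simp add: S_def a_def)
  qed
  have int: "integrable M (\<lambda>x. (cmod (A (q j) x))\<^sup>2)" if "j < s" for j
    using q[OF that] by (intro L2_integrable_square L2_operator_in[OF A])
  have "(\<Sum>j<s. (L2_norm M (A (q j)))\<^sup>2) = (LINT x|M. (\<Sum>j<s. (cmod (A (q j) x))\<^sup>2))"
    unfolding L2_norm_power2 using int by (intro Bochner_Integration.integral_sum[symmetric]) auto
  also have "\<dots> \<le> (LINT x|M. \<delta>\<^sup>2)"
    using int \<open>AE x in M. (\<Sum>j<s. (cmod (A (q j) x))\<^sup>2) \<le> \<delta>\<^sup>2\<close> by (intro integral_mono_AE) auto
  finally show ?thesis by (simp add: mult.commute)
qed

text \<open>Greedy choice: as long as \<open>A\<close> exceeds \<open>sqrt (E / r)\<close> on a unit vector orthogonal to those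
  chosen so far, choose it. Each one uses up more than \<open>E / r\<close> of the total \<open>E\<close>, so this stops
  before \<open>r\<close> vectors have been chosen.\<close>

lemma orthonormal_exhaustion:
  assumes A: "L2_operator M A"
    and sum: "\<And>q s. L2_orthonormal M q s \<Longrightarrow> (\<Sum>j<s. (L2_norm M (A (q j)))\<^sup>2) \<le> E"
    and "r \<ge> 1"
  obtains q s where "s \<le> r" "L2_orthonormal M q s"
    "\<And>f. f \<in> L2 M \<Longrightarrow> (\<And>j. j < s \<Longrightarrow> L2_inner M f (q j) = 0) \<Longrightarrow>
      (L2_norm M (A f))\<^sup>2 \<le> E / real r * (L2_norm M f)\<^sup>2"
proof (rule ccontr)
  note choice = that
  assume not: "\<not> thesis"
  have ex: "\<exists>f\<in>L2 M. (\<forall>j<s. L2_inner M f (q j) = 0) \<and> E / real r * (L2_norm M f)\<^sup>2 < (L2_norm M (A f))\<^sup>2"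
    if "s \<le> r" "L2_orthonormal M q s" for q s
  proof (rule ccontr)
    assume "\<not> ?thesis"
    then show False using not choice[of s q] \<open>s \<le> r\<close> \<open>L2_orthonormal M q s\<close> by (auto simp: not_less)
  qed
  have "\<exists>q. L2_orthonormal M q s \<and> (\<forall>j<s. E / real r < (L2_norm M (A (q j)))\<^sup>2)" if "s \<le> r" for s
    using that
  proof (induction s)
    case 0
    then show ?case by (auto simp: L2_orthonormal_def)
  next
    case (Suc s)
    then obtain q where q: "L2_orthonormal M q s" "\<forall>j<s. E / real r < (L2_norm M (A (q j)))\<^sup>2" by auto
    obtain f where f: "f \<in> L2 M" "\<forall>j<s. L2_inner M f (q j) = 0"
        "E / real r * (L2_norm M f)\<^sup>2 < (L2_norm M (A f))\<^sup>2"
      using ex[OF _ q(1)] Suc.prems by auto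
    obtain C where C: "\<And>f. f \<in> L2 M \<Longrightarrow> L2_norm M (A f) \<le> C * L2_norm M f"
      using L2_operator_bound[OF A] by blast
    have "L2_norm M f \<noteq> 0"
    proof
      assume 0: "L2_norm M f = 0"
      then have "L2_norm M (A f) = 0" using C[OF f(1)] by (simp add: antisym)
      then show False using f(3) 0 by simp
    qed
    then have pos: "L2_norm M f > 0" using L2_norm_nonneg[of M f] by linarith
    define c where "c = complex_of_real (1 / L2_norm M f)"
    define g where "g = (\<lambda>x. c * f x)"
    have g: "g \<in> L2 M" unfolding g_def using f(1) by (rule L2_scale)
    have gn: "L2_norm M g = 1" unfolding g_def L2_norm_scale using pos by (simp add: c_def norm_divide)
    have inner: "L2_inner M g h = c * L2_inner M f h" if "h \<in> L2 M" for h
      using L2_inner_lincomb_left[OF f(1) f(1) that, of c 0] by (simp add: g_def)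
    have "AE x in M. A (\<lambda>y. c * f y + 0 * f y) x = c * A f x + 0 * A f x"
      by (rule L2_operator_lincomb[OF A f(1) f(1)])
    then have "L2_norm M (A g) = L2_norm M (\<lambda>x. c * A f x)"
      using L2_measurable[OF L2_operator_in[OF A f(1)]] L2_measurable[OF L2_operator_in[OF A g]]
      by (intro L2_norm_AE_cong) (auto simp: g_def)
    then have "(L2_norm M (A g))\<^sup>2 = (L2_norm M (A f))\<^sup>2 / (L2_norm M f)\<^sup>2"
      unfolding L2_norm_scale using pos by (simp add: c_def norm_divide power_divide)
    then have big: "E / real r < (L2_norm M (A g))\<^sup>2"
      using f(3) pos by (simp add: pos_less_divide_eq)
    have qs: "q j \<in> L2 M" if "j < s" for j using q(1) that by (simp add: L2_orthonormal_def)
    have gq: "L2_inner M g (q j) = 0" "L2_inner M (q j) g = 0" if "j < s" for j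
      using inner[OF qs[OF that]] f(2) that L2_inner_commute[of M "q j" g] by auto
    have "L2_orthonormal M (q(s := g)) (Suc s)"
      using q(1) g gq L2_inner_self[of M g] gn
      by (auto simp: L2_orthonormal_def less_Suc_eq)
    moreover have "\<forall>j<Suc s. E / real r < (L2_norm M (A ((q(s := g)) j)))\<^sup>2"
      using q(2) big by (auto simp: less_Suc_eq)
    ultimately show ?case by blast
  qed
  then obtain q where q: "L2_orthonormal M q r" "\<forall>j<r. E / real r < (L2_norm M (A (q j)))\<^sup>2" by blast
  have "(\<Sum>j<r. E / real r) < (\<Sum>j<r. (L2_norm M (A (q j)))\<^sup>2)"
    using q(2) \<open>r \<ge> 1\<close> by (intro sum_strict_mono) (auto simp: lessThan_empty_iff)
  then show False using sum[OF q(1)] \<open>r \<ge> 1\<close> by simp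
qed

text \<open>For orthonormal \<open>q\<close> this is the orthogonal projection onto the span of \<open>q\<^sub>0, \<dots>, q\<^sub>s\<^sub>-\<^sub>1\<close>.\<close>

definition L2_projection :: "'b measure \<Rightarrow> (nat \<Rightarrow> 'b \<Rightarrow> complex) \<Rightarrow> nat \<Rightarrow> ('b \<Rightarrow> complex) \<Rightarrow> 'b \<Rightarrow> complex" where
  "L2_projection M q s f x = (\<Sum>j<s. L2_inner M f (q j) * q j x)"

lemma L2_projection_complement:
  assumes on: "L2_orthonormal M q s" and f: "f \<in> L2 M"
  defines "g \<equiv> (\<lambda>x. f x - L2_projection M q s f x)"
  shows "L2_projection M q s f \<in> L2 M" "j < s \<Longrightarrow> L2_inner M g (q j) = 0" "L2_norm M g \<le> L2_norm M f"
proof -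
  let ?P = "L2_projection M q s f"
  have q: "q i \<in> L2 M" if "i < s" for i using on that by (simp add: L2_orthonormal_def)
  show P: "?P \<in> L2 M"
    unfolding L2_projection_def[abs_def] using q by (intro L2_sum) auto
  have g: "g \<in> L2 M" unfolding g_def by (intro L2_diff f P)
  have inner: "L2_inner M g h = L2_inner M f h - L2_inner M ?P h" if "h \<in> L2 M" for h
    using L2_inner_lincomb_left[OF f P that, of 1 "-1"] by (simp add: g_def)
  have orth: "L2_inner M g (q j) = 0" if "j < s" for j
    using inner[OF q[OF that]] L2_orthonormal_inner_sum[OF on that]
    by (simp add: L2_projection_def[abs_def])
  then show "L2_inner M g (q j) = 0" if "j < s" using that by blast
  have "L2_inner M ?P g = (\<Sum>j<s. L2_inner M f (q j) * L2_inner M (q j) g)"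
    unfolding L2_projection_def[abs_def] using q g by (intro L2_inner_sum_left) auto
  also have "\<dots> = 0"
  proof (rule sum.neutral, safe)
    fix j assume "j < s"
    then show "L2_inner M f (q j) * L2_inner M (q j) g = 0"
      using orth L2_inner_commute[of M "q j" g] by simp
  qed
  finally have "L2_inner M g g = L2_inner M f g" using inner[OF g] by simp
  then have "(L2_norm M g)\<^sup>2 \<le> L2_norm M f * L2_norm M g"
    using L2_Cauchy_Schwarz[OF f g] L2_inner_self[of M g] by (metis norm_of_real abs_of_nonneg zero_le_power2)
  then show "L2_norm M g \<le> L2_norm M f"
    using L2_norm_nonneg[of M g] L2_norm_nonneg[of M f]
    by (cases "L2_norm M g = 0") (auto simp: power2_eq_square)
qed

lemma L2_operator_projection:
  assumes on: "L2_orthonormal M q s"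
  shows "L2_operator M (L2_projection M q s)"
  unfolding L2_operator_def
proof (intro conjI ballI allI)
  have q: "q i \<in> L2 M" if "i < s" for i using on that by (simp add: L2_orthonormal_def)
  show "AE x in M. L2_projection M q s (\<lambda>y. a * f y + b * g y) x
      = a * L2_projection M q s f x + b * L2_projection M q s g x" if "f \<in> L2 M" "g \<in> L2 M" for f g a b
    using q that
    by (simp add: L2_projection_def L2_inner_lincomb_left sum_distrib_left sum.distrib distrib_right mult.assoc)
  show "\<exists>C. \<forall>f\<in>L2 M. L2_norm M (L2_projection M q s f) \<le> C * L2_norm M f"
  proof (intro exI ballI)
    fix f assume f: "f \<in> L2 M"
    note P = L2_projection_complement[OF on f]
    have "L2_norm M (\<lambda>x. 1 * f x + (-1) * (f x - L2_projection M q s f x))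
        \<le> cmod 1 * L2_norm M f + cmod (-1) * L2_norm M (\<lambda>x. f x - L2_projection M q s f x)"
      by (intro L2_norm_triangle L2_diff f P(1))
    also have "\<dots> \<le> 2 * L2_norm M f" using P(3) by simp
    finally show "L2_norm M (L2_projection M q s f) \<le> 2 * L2_norm M f" by simp
  qed
qed (rule L2_projection_complement(1)[OF on])

lemma L2_operator_id: "L2_operator M (\<lambda>f. f)"
  by (auto simp: L2_operator_def intro!: exI[of _ 1])

text \<open>The gain of the factor \<open>1 / r\<close>: subtracting from the small part \<open>A\<close> of \<open>R\<close> another operator of
  rank \<open>r\<close> lowers its operator norm to \<open>1 / sqrt r\<close> times its Hilbert-Schmidt norm.\<close>

lemma approx_number_le_of_sup_bound:
  assumes M: "finite_measure M" and T: "L2_operator M T" and R: "L2_operator M R" and A: "L2_operator M A"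
    and RRT: "\<And>f. f \<in> L2 M \<Longrightarrow> AE x in M. R (R f) x = T f x"
    and rank: "AE_rank_le M (\<lambda>f x. R f x - A f x) r" and "r \<ge> 1"
    and sup: "\<And>f. f \<in> L2 M \<Longrightarrow> AE x in M. cmod (A f x) \<le> \<delta> * L2_norm M f" and "\<delta> \<ge> 0"
    and n: "4 * r < n"
  shows "0 \<le> approx_number M n T" "approx_number M n T \<le> \<delta>\<^sup>2 * measure M (space M) / real r"
proof -
  define E where "E = \<delta>\<^sup>2 * measure M (space M)"
  have E: "E \<ge> 0" by (simp add: E_def)
  have sumE: "(\<Sum>j<s. (L2_norm M (A (q j)))\<^sup>2) \<le> E" if "L2_orthonormal M q s" for q s
    unfolding E_def by (rule sum_square_norm_le_of_sup_bound[OF M A sup \<open>\<delta> \<ge> 0\<close> that])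
  obtain q s where s: "s \<le> r" and on: "L2_orthonormal M q s"
    and small: "\<And>f. f \<in> L2 M \<Longrightarrow> (\<And>j. j < s \<Longrightarrow> L2_inner M f (q j) = 0) \<Longrightarrow>
      (L2_norm M (A f))\<^sup>2 \<le> E / real r * (L2_norm M f)\<^sup>2"
    using orthonormal_exhaustion[OF A sumE \<open>r \<ge> 1\<close>] by metis
  let ?P = "L2_projection M q s"
  \<comment> \<open>\<open>R - W\<close> is \<open>(R - A) + A P\<close>, of rank at most \<open>2 r\<close>\<close>
  let ?W = "\<lambda>f. A (\<lambda>x. f x - ?P f x)"
  have P: "L2_operator M ?P" by (rule L2_operator_projection[OF on])
  have W: "L2_operator M ?W"
    by (rule L2_operator_compose[OF A L2_operator_diff[OF L2_operator_id P]])
  have q: "q i \<in> L2 M" if "i < s" for i using on that by (simp add: L2_orthonormal_def)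
  have "AE_rank_le M ?P (card (q ` {..<s}))"
  proof (rule AE_rank_le_I[OF P])
    show "AE_spanned M (?P ` L2 M) (q ` {..<s})"
      unfolding AE_spanned_def
    proof safe
      fix f assume "f \<in> L2 M"
      show "\<exists>c. AE x in M. ?P f x = (\<Sum>g\<in>q ` {..<s}. c g * g x)"
        using sum_coeffs_image[of "{..<s}" "\<lambda>j. L2_inner M f (q j)" q] by (auto simp: L2_projection_def)
    qed
  qed auto
  then have "AE_rank_le M ?P r"
    using card_image_le[of "{..<s}" q] s unfolding AE_rank_le_def by (auto elim!: ex_forward)
  then have "AE_rank_le M (\<lambda>f. A (?P f)) r"
    by (rule AE_rank_le_compose_left[OF _ L2_operator_in[OF P] A])
  with rank have "AE_rank_le M (\<lambda>f x. (R f x - A f x) + A (?P f) x) (r + r)"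
    by (rule AE_rank_le_add)
  then have rank': "AE_rank_le M (\<lambda>f x. R f x - ?W f x) (r + r)"
  proof (rule AE_rank_le_AE_equal)
    fix f assume f: "f \<in> L2 M"
    have "AE x in M. A (\<lambda>y. 1 * f y + (-1) * ?P f y) x = 1 * A f x + (-1) * A (?P f) x"
      by (intro L2_operator_lincomb[OF A] f L2_operator_in[OF P])
    then show "AE x in M. R f x - A f x + A (?P f) x = R f x - ?W f x"
      by eventually_elim simp
  qed
  have Wb: "L2_norm M (?W f) \<le> sqrt (E / real r) * L2_norm M f" if f: "f \<in> L2 M" for f
  proof -
    note C = L2_projection_complement[OF on f]
    have "(L2_norm M (?W f))\<^sup>2 \<le> E / real r * (L2_norm M (\<lambda>x. f x - ?P f x))\<^sup>2"
      by (intro small L2_diff f C)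
    also have "\<dots> \<le> E / real r * (L2_norm M f)\<^sup>2"
      using E C(3) by (intro mult_left_mono power_mono) auto
    also have "\<dots> = (sqrt (E / real r) * L2_norm M f)\<^sup>2"
      using E by (simp add: power_mult_distrib)
    finally show ?thesis by (rule power2_le_imp_le) (use E in auto)
  qed
  have "2 * (r + r) < n" using n by simp
  note final = approx_number_square_bounds[OF T R W RRT rank' Wb _ this]
  show "0 \<le> approx_number M n T" using final(1) E by simp
  show "approx_number M n T \<le> \<delta>\<^sup>2 * measure M (space M) / real r"
    using final(2) E by (simp add: E_def)
qed

section \<open>Averaging by a symmetric kernel\<close>

lemma norm_integral_le_nn_integral:
  fixes f :: "'b \<Rightarrow> complex"
  shows "ennreal (norm (LINT x|M. f x)) \<le> (\<integral>\<^sup>+x. ennreal (norm (f x)) \<partial>M)"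
  by (cases "integrable M f") (auto simp: integral_norm_bound_ennreal not_integrable_integral_eq)

text \<open>By symmetry the column integrals are bounded by \<open>C\<close> as well, so the operator \<open>avg\<close> of the kernel is
  bounded on \<open>L\<^sup>1\<close> and on \<open>L\<^sup>\<infinity>\<close>, and it is its own adjoint.\<close>

locale averaging_kernel = finite_measure M for M :: "'b measure" +
  fixes P :: "'b \<Rightarrow> 'b \<Rightarrow> real" and C :: real
  assumes P_measurable [measurable]: "(\<lambda>(x, y). P x y) \<in> borel_measurable (M \<Otimes>\<^sub>M M)"
    and P_nonneg: "\<And>x y. x \<in> space M \<Longrightarrow> y \<in> space M \<Longrightarrow> 0 \<le> P x y"
    and P_symmetric: "\<And>x y. x \<in> space M \<Longrightarrow> y \<in> space M \<Longrightarrow> P x y = P y x"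
    and C_nonneg: "0 \<le> C"
    and row_integral: "\<And>x. x \<in> space M \<Longrightarrow> (\<integral>\<^sup>+y. ennreal (P x y) \<partial>M) \<le> ennreal C"
begin

definition avg :: "('b \<Rightarrow> complex) \<Rightarrow> 'b \<Rightarrow> complex" where
  "avg f x = (LINT y|M. of_real (P x y) * f y)"

sublocale MM: pair_sigma_finite M M ..

lemma avg_measurable [measurable]:
  assumes [measurable]: "f \<in> borel_measurable M"
  shows "avg f \<in> borel_measurable M"
  unfolding avg_def[abs_def] by measurable

lemma L2_integrable: "f \<in> L2 M \<Longrightarrow> integrable M f"
proof -
  assume f: "f \<in> L2 M"
  have "integrable M (\<lambda>x. f x * 1)"
    by (intro L2_integrable_mult f) (simp add: L2_def)
  then show ?thesis by simp
qed

lemma bounded_L2: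
  assumes [measurable]: "h \<in> borel_measurable M" and h: "\<And>x. x \<in> space M \<Longrightarrow> cmod (h x) \<le> c"
  shows "h \<in> L2 M"
proof -
  have "integrable M (\<lambda>x. (cmod (h x))\<^sup>2)"
    by (rule integrable_const_bound[where B="c\<^sup>2"]) (auto intro!: AE_I2 power_mono h)
  then show ?thesis by (simp add: L2_def)
qed

text \<open>This justifies the applications of Fubini's theorem below. The value \<open>avg f x\<close> itself is
  meaningful for almost every \<open>x\<close> only, unless \<open>f\<close> is bounded.\<close>

lemma pair_integrable:
  assumes f: "integrable M f"
    and [measurable]: "h \<in> borel_measurable M" and h: "\<And>x. x \<in> space M \<Longrightarrow> cmod (h x) \<le> c"
  shows "integrable (M \<Otimes>\<^sub>M M) (\<lambda>(x, y). complex_of_real (P x y) * f y * h x)"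
proof -
  have fm [measurable]: "f \<in> borel_measurable M" using f by simp
  let ?F = "\<lambda>(x, y). complex_of_real (P x y) * f y * h x"
  have [measurable]: "?F \<in> borel_measurable (M \<Otimes>\<^sub>M M)" by measurable
  have "(\<integral>\<^sup>+z. ennreal (norm (?F z)) \<partial>(M \<Otimes>\<^sub>M M)) = (\<integral>\<^sup>+y. \<integral>\<^sup>+x. ennreal (norm (?F (x, y))) \<partial>M \<partial>M)"
    by (rule MM.nn_integral_snd[symmetric]) simp
  also have "\<dots> \<le> (\<integral>\<^sup>+y. ennreal (cmod (f y)) * (ennreal C * ennreal (max c 0)) \<partial>M)"
  proof (rule nn_integral_mono)
    fix y assume y: "y \<in> space M"
    have "(\<integral>\<^sup>+x. ennreal (norm (?F (x, y))) \<partial>M)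
        \<le> (\<integral>\<^sup>+x. (ennreal (cmod (f y)) * ennreal (max c 0)) * ennreal (P y x) \<partial>M)"
    proof (rule nn_integral_mono)
      fix x assume x: "x \<in> space M"
      have "norm (?F (x, y)) = (cmod (f y) * cmod (h x)) * P y x"
        using P_nonneg[OF x y] P_symmetric[OF x y] by (simp add: norm_mult)
      also have "\<dots> \<le> (cmod (f y) * max c 0) * P y x"
        using P_nonneg[OF y x] h[OF x] by (intro mult_mono mult_left_mono) auto
      finally show "ennreal (norm (?F (x, y))) \<le> (ennreal (cmod (f y)) * ennreal (max c 0)) * ennreal (P y x)"
        using P_nonneg[OF y x] by (simp add: ennreal_mult'[symmetric] ennreal_leI)
    qed
    also have "\<dots> = (ennreal (cmod (f y)) * ennreal (max c 0)) * (\<integral>\<^sup>+x. ennreal (P y x) \<partial>M)"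
      using y by (intro nn_integral_cmult) measurable
    also have "\<dots> \<le> (ennreal (cmod (f y)) * ennreal (max c 0)) * ennreal C"
      by (intro mult_left_mono row_integral y) auto
    finally show "(\<integral>\<^sup>+x. ennreal (norm (?F (x, y))) \<partial>M)
        \<le> ennreal (cmod (f y)) * (ennreal C * ennreal (max c 0))" by (simp add: mult_ac)
  qed
  also have "\<dots> = (\<integral>\<^sup>+y. ennreal (cmod (f y)) \<partial>M) * (ennreal C * ennreal (max c 0))"
    by (rule nn_integral_multc) simp
  also have "\<dots> < \<infinity>"
    using f by (auto simp: integrable_iff_bounded ennreal_mult_less_top simp flip: ennreal_mult')
  finally show ?thesis by (simp add: integrable_iff_bounded)
qed

lemma AE_integrable_row:
  fixes f :: "'b \<Rightarrow> complex"
  assumes f: "integrable M f"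
  shows "AE x in M. integrable M (\<lambda>y. of_real (P x y) * f y)"
proof -
  have "integrable (M \<Otimes>\<^sub>M M) (\<lambda>(x, y). complex_of_real (P x y) * f y * (1::complex))"
    by (rule pair_integrable[OF f]) auto
  from MM.AE_integrable_fst'[OF this] show ?thesis by simp
qed

lemma avg_integrable:
  assumes f: "integrable M f"
  shows "integrable M (avg f)"
proof -
  have "integrable (M \<Otimes>\<^sub>M M) (\<lambda>(x, y). complex_of_real (P x y) * f y * (1::complex))"
    by (rule pair_integrable[OF f]) auto
  from MM.integrable_fst'[OF this] show ?thesis by (simp add: avg_def[abs_def])
qed

lemma avg_lincomb:
  assumes "integrable M f" "integrable M g"
  shows "AE x in M. avg (\<lambda>y. a * f y + b * g y) x = a * avg f x + b * avg g x"
  using AE_integrable_row[OF assms(1)] AE_integrable_row[OF assms(2)]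
proof eventually_elim
  case (elim x)
  have "avg (\<lambda>y. a * f y + b * g y) x
      = (LINT y|M. a * (of_real (P x y) * f y) + b * (of_real (P x y) * g y))"
    by (simp add: avg_def algebra_simps)
  then show ?case using elim by (simp add: avg_def)
qed

lemma avg_adjoint:
  assumes f: "integrable M f"
    and [measurable]: "h \<in> borel_measurable M" and h: "\<And>x. x \<in> space M \<Longrightarrow> cmod (h x) \<le> c"
  shows "(LINT x|M. avg f x * h x) = (LINT y|M. f y * avg h y)"
proof -
  have [measurable]: "f \<in> borel_measurable M" using f by simp
  have "(LINT x|M. avg f x * h x) = (LINT x|M. LINT y|M. complex_of_real (P x y) * f y * h x)"
    by (simp add: avg_def)
  also have "\<dots> = (LINT y|M. LINT x|M. complex_of_real (P x y) * f y * h x)"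
    by (rule MM.Fubini_integral[symmetric, OF pair_integrable[OF f _ h]]) auto
  also have "\<dots> = (LINT y|M. f y * avg h y)"
  proof (rule Bochner_Integration.integral_cong)
    fix y assume y: "y \<in> space M"
    have "(LINT x|M. complex_of_real (P x y) * f y * h x) = (LINT x|M. f y * (complex_of_real (P y x) * h x))"
      using P_symmetric[OF _ y] by (intro Bochner_Integration.integral_cong) (auto simp: mult_ac)
    then show "(LINT x|M. complex_of_real (P x y) * f y * h x) = f y * avg h y" by (simp add: avg_def)
  qed simp
  finally show ?thesis .
qed

lemma norm_avg_le:
  assumes [measurable]: "h \<in> borel_measurable M" and h: "\<And>x. x \<in> space M \<Longrightarrow> cmod (h x) \<le> c"
    and "c \<ge> 0" and x: "x \<in> space M"
  shows "cmod (avg h x) \<le> C * c"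
proof -
  have "ennreal (cmod (avg h x)) \<le> (\<integral>\<^sup>+y. ennreal (norm (complex_of_real (P x y) * h y)) \<partial>M)"
    unfolding avg_def by (rule norm_integral_le_nn_integral)
  also have "\<dots> \<le> (\<integral>\<^sup>+y. ennreal c * ennreal (P x y) \<partial>M)"
    using P_nonneg[OF x] h
    by (intro nn_integral_mono) (auto simp: norm_mult ennreal_mult'[symmetric] \<open>c \<ge> 0\<close> mult.commute[of c]
        intro!: ennreal_leI mult_left_mono)
  also have "\<dots> = ennreal c * (\<integral>\<^sup>+y. ennreal (P x y) \<partial>M)"
    using x by (intro nn_integral_cmult) measurable
  also have "\<dots> \<le> ennreal c * ennreal C" by (intro mult_left_mono row_integral x) auto
  finally show ?thesis using \<open>c \<ge> 0\<close> C_nonneg by (simp add: ennreal_mult'[symmetric] mult.commute)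
qed

text \<open>Testing \<open>avg h\<close> against its phase moves the average to a function bounded by 1.\<close>

lemma integral_norm_avg_le:
  assumes h: "integrable M h"
  shows "(LINT x|M. cmod (avg h x)) \<le> C * (LINT x|M. cmod (h x))"
proof -
  have [measurable]: "h \<in> borel_measurable M" using h by simp
  define g where "g x = cnj (avg h x) / of_real (cmod (avg h x))" for x
  have gm [measurable]: "g \<in> borel_measurable M" unfolding g_def[abs_def] by measurable
  have g1: "cmod (g x) \<le> 1" for x by (simp add: g_def norm_divide)
  have ag: "cmod (avg g x) \<le> C" if "x \<in> space M" for x
    using norm_avg_le[OF gm g1 _ that] by simp
  have gh: "avg h x * g x = of_real (cmod (avg h x))" for x
    unfolding g_def times_divide_eq_right complex_norm_square[symmetric] by (simp add: power2_eq_square)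
  have "complex_of_real (LINT x|M. cmod (avg h x)) = (LINT x|M. avg h x * g x)"
    by (simp add: gh integral_complex_of_real)
  also have "\<dots> = (LINT x|M. h x * avg g x)" by (rule avg_adjoint[OF h gm g1])
  finally have "cmod (complex_of_real (LINT x|M. cmod (avg h x))) = cmod (LINT x|M. h x * avg g x)"
    by (rule arg_cong)
  then have "(LINT x|M. cmod (avg h x)) = cmod (LINT x|M. h x * avg g x)"
    by (simp only: norm_of_real) simp
  also have "\<dots> \<le> (LINT x|M. cmod (h x * avg g x))" by (rule integral_norm_bound)
  also have "\<dots> \<le> (LINT x|M. C * cmod (h x))"
  proof (rule integral_mono)
    show le: "cmod (h x * avg g x) \<le> C * cmod (h x)" if "x \<in> space M" for x
      using ag[OF that] by (simp add: norm_mult mult.commute[of C] mult_left_mono)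
    show i: "integrable M (\<lambda>x. C * cmod (h x))" using h by simp
    show "integrable M (\<lambda>x. cmod (h x * avg g x))"
      by (rule Bochner_Integration.integrable_bound[OF i]) (use le C_nonneg in \<open>auto intro!: AE_I2\<close>)
  qed
  finally show ?thesis by simp
qed

end

text \<open>The converse of Hoelder's inequality for the exponents 1 and \<open>\<infinity>\<close>. The test function is the phase
  of \<open>a\<close> on the set where the bound fails.\<close>

lemma (in finite_measure) AE_norm_le_of_dual_bound:
  fixes a :: "'a \<Rightarrow> complex"
  assumes a: "integrable M a" and "D \<ge> 0"
    and dual: "\<And>h. h \<in> borel_measurable M \<Longrightarrow> (\<And>x. cmod (h x) \<le> 1) \<Longrightarrow>
      cmod (LINT x|M. a x * cnj (h x)) \<le> D * (LINT x|M. cmod (h x))"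
  shows "AE x in M. cmod (a x) \<le> D"
proof -
  have [measurable]: "a \<in> borel_measurable M" using a by simp
  define S where "S = {x\<in>space M. D < cmod (a x)}"
  have [measurable]: "S \<in> sets M" unfolding S_def by measurable
  define h where "h x = (if x \<in> S then a x / of_real (cmod (a x)) else 0)" for x
  have [measurable]: "h \<in> borel_measurable M" unfolding h_def[abs_def] by measurable
  have nz: "a x \<noteq> 0" if "x \<in> S" for x using that \<open>D \<ge> 0\<close> by (auto simp: S_def)
  have h1: "cmod (h x) = indicator S x" for x
    using nz[of x] by (auto simp: h_def norm_divide)
  have ah: "a x * cnj (h x) = of_real (indicator S x * cmod (a x))" for x
  proof (cases "x \<in> S")
    case True
    have "a x * cnj (a x) = of_real (cmod (a x)) * of_real (cmod (a x))"
      unfolding complex_norm_square[symmetric] by (simp add: power2_eq_square)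
    then show ?thesis using True nz[OF True] by (simp add: h_def)
  qed (simp add: h_def)
  have int: "integrable M (\<lambda>x. indicator S x * cmod (a x))"
    using integrable_mult_indicator[of S M "\<lambda>x. cmod (a x)"] a by auto
  have "(LINT x|M. indicator S x * cmod (a x)) \<le> cmod (LINT x|M. a x * cnj (h x))"
    unfolding ah integral_complex_of_real norm_of_real by simp
  also have "\<dots> \<le> D * (LINT x|M. cmod (h x))" by (rule dual) (auto simp: h1 indicator_def)
  also have "\<dots> = (LINT x|M. D * indicator S x)" by (simp add: h1)
  finally have le: "(LINT x|M. indicator S x * cmod (a x)) \<le> (LINT x|M. D * indicator S x)" .
  have intS: "integrable M (\<lambda>x. D * indicator S x :: real)"
    by (rule integrable_const_bound[where B=D]) (use \<open>D \<ge> 0\<close> in \<open>auto simp: indicator_def\<close>)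
  have "(LINT x|M. indicator S x * cmod (a x) - D * indicator S x) \<le> 0"
    unfolding Bochner_Integration.integral_diff[OF int intS] using le by linarith
  moreover have nn: "0 \<le> indicator S x * cmod (a x) - D * indicator S x" for x
    by (auto simp: indicator_def S_def)
  moreover have int': "integrable M (\<lambda>x. indicator S x * cmod (a x) - D * indicator S x)"
    by (rule Bochner_Integration.integrable_diff[OF int intS])
  moreover have "0 \<le> (LINT x|M. indicator S x * cmod (a x) - D * indicator S x)"
    by (rule Bochner_Integration.integral_nonneg) (rule nn)
  ultimately have "(LINT x|M. indicator S x * cmod (a x) - D * indicator S x) = 0"
    by linarith
  then have "AE x in M. indicator S x * cmod (a x) - D * indicator S x = 0"
    using integral_nonneg_eq_0_iff_AE[OF int'] nn by auto
  then show ?thesis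
    using AE_space by eventually_elim (auto simp: S_def indicator_def split: if_splits)
qed

context averaging_kernel
begin

text \<open>Testing \<open>R f - avg (R f)\<close> against \<open>h\<close> moves \<open>1 - avg\<close> to \<open>h\<close> and \<open>R\<close> to \<open>k = h - avg h\<close>. There
  \<open>\<parallel>R k\<parallel>\<^sup>2 = \<langle>R (R k), k\<rangle>\<close>, and moving \<open>1 - avg\<close> once more, now to the kernel \<open>K\<close> of \<open>R\<^sup>2\<close>, bounds
  \<open>R (R k)\<close> uniformly by \<open>\<epsilon> \<parallel>h\<parallel>\<^sub>1\<close>. Working with \<open>\<langle>R (R k), k\<rangle>\<close> avoids evaluating functions in the
  range of \<open>R\<close> at points.\<close>

lemma dual_bound:
  assumes R: "L2_operator M R" and pos: "positive_operator M R"
    and K: "case_prod K \<in> L2 (M \<Otimes>\<^sub>M M)"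
    and RRK: "\<And>f. f \<in> L2 M \<Longrightarrow> AE y in M. R (R f) y = (LINT x|M. K y x * f x)"
    and close: "AE y in M. AE x in M. cmod (K y x - avg (K y) x) \<le> \<epsilon>" and "\<epsilon> \<ge> 0"
    and f: "f \<in> L2 M"
    and hm [measurable]: "h \<in> borel_measurable M" and h1: "\<And>x. cmod (h x) \<le> 1"
  shows "cmod (LINT x|M. (R f x - avg (R f) x) * cnj (h x))
    \<le> sqrt (\<epsilon> * (1 + C)) * L2_norm M f * (LINT x|M. cmod (h x))"
proof -
  let ?H = "LINT x|M. cmod (h x)"
  define k where "k x = h x - avg h x" for x
  have [measurable]: "k \<in> borel_measurable M" unfolding k_def[abs_def] by measurable
  have avh: "cmod (avg h x) \<le> C" if "x \<in> space M" for x
    using norm_avg_le[of h 1 x] h1 that by simp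
  have kb: "cmod (k x) \<le> 1 + C" if "x \<in> space M" for x
    unfolding k_def using norm_triangle_ineq4[of "h x" "avg h x"] h1[of x] avh[OF that] by simp
  have k: "k \<in> L2 M" and h: "h \<in> L2 M" and ah: "avg h \<in> L2 M"
    using kb h1 avh by (auto intro!: bounded_L2)
  have Rf: "R f \<in> L2 M" by (rule L2_operator_in[OF R f])
  have int: "integrable M (\<lambda>x. R f x * cnj (h x))" by (rule L2_inner_integrable[OF Rf h])
  have int': "integrable M (\<lambda>x. avg (R f) x * cnj (h x))"
  proof (rule Bochner_Integration.integrable_bound[OF integrable_norm[OF avg_integrable[OF L2_integrable[OF Rf]]]])
    have [measurable]: "R f \<in> borel_measurable M" by (rule L2_measurable[OF Rf])
    show "(\<lambda>x. avg (R f) x * cnj (h x)) \<in> borel_measurable M" by measurable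
    show "AE x in M. norm (avg (R f) x * cnj (h x)) \<le> norm (norm (avg (R f) x))"
      using h1 by (auto simp: norm_mult intro!: mult_left_le)
  qed
  have cnj_avg: "avg (\<lambda>x. cnj (h x)) y = cnj (avg h y)" for y
  proof -
    have "cnj (avg h y) = (LINT x|M. cnj (of_real (P y x) * h x))"
      unfolding avg_def by (rule Bochner_Integration.integral_cnj[symmetric])
    then show ?thesis by (simp add: avg_def)
  qed
  have "(LINT x|M. (R f x - avg (R f) x) * cnj (h x))
      = (LINT x|M. R f x * cnj (h x)) - (LINT x|M. avg (R f) x * cnj (h x))"
    using int int' by (simp add: left_diff_distrib)
  also have "(LINT x|M. avg (R f) x * cnj (h x)) = (LINT x|M. R f x * cnj (avg h x))"
    using avg_adjoint[OF L2_integrable[OF Rf], of "\<lambda>x. cnj (h x)" 1] h1 by (simp add: cnj_avg)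
  also have "(LINT x|M. R f x * cnj (h x)) - (LINT x|M. R f x * cnj (avg h x)) = L2_inner M (R f) k"
    using int L2_inner_integrable[OF Rf ah] by (simp add: L2_inner_def k_def right_diff_distrib)
  also have "\<dots> = L2_inner M f (R k)" by (rule positive_operator_symmetric[OF R pos f k])
  finally have eq: "(LINT x|M. (R f x - avg (R f) x) * cnj (h x)) = L2_inner M f (R k)" .

  have Rk: "R k \<in> L2 M" by (rule L2_operator_in[OF R k])
  have RRk: "R (R k) \<in> L2 M" by (rule L2_operator_in[OF R Rk])
  have [measurable]: "(\<lambda>(y, x). K y x) \<in> borel_measurable (M \<Otimes>\<^sub>M M)" using L2_measurable[OF K] by simp
  have "AE y in M. integrable M (\<lambda>x. (cmod (K y x))\<^sup>2)"
    using MM.AE_integrable_fst'[OF L2_integrable_square[OF K]] by simp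
  then have Ky: "AE y in M. K y \<in> L2 M"
    using AE_space by eventually_elim (auto simp: L2_def)
  have "AE y in M. cmod (R (R k) y) \<le> \<epsilon> * ?H"
    using RRK[OF k] Ky close
  proof eventually_elim
    case (elim y)
    note Kint = L2_integrable[OF elim(2)]
    have i1: "integrable M (\<lambda>x. K y x * h x)" and i2: "integrable M (\<lambda>x. K y x * avg h x)"
      using L2_integrable_mult[OF elim(2) h] L2_integrable_mult[OF elim(2) ah] by auto
    have i3: "integrable M (\<lambda>x. avg (K y) x * h x)"
    proof (rule Bochner_Integration.integrable_bound[OF integrable_norm[OF avg_integrable[OF Kint]]])
      have [measurable]: "K y \<in> borel_measurable M" by (rule L2_measurable[OF elim(2)])
      show "(\<lambda>x. avg (K y) x * h x) \<in> borel_measurable M" by measurable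
      show "AE x in M. norm (avg (K y) x * h x) \<le> norm (norm (avg (K y) x))"
        using h1 by (auto simp: norm_mult intro!: mult_left_le)
    qed
    have "R (R k) y = (LINT x|M. K y x * h x) - (LINT x|M. K y x * avg h x)"
      using elim(1) i1 i2 by (simp add: k_def right_diff_distrib)
    also have "(LINT x|M. K y x * avg h x) = (LINT x|M. avg (K y) x * h x)"
      using avg_adjoint[OF Kint hm, of 1] h1 by simp
    also have "(LINT x|M. K y x * h x) - (LINT x|M. avg (K y) x * h x)
        = (LINT x|M. (K y x - avg (K y) x) * h x)"
      using i1 i3 by (simp add: left_diff_distrib)
    finally have "cmod (R (R k) y) \<le> (LINT x|M. cmod ((K y x - avg (K y) x) * h x))"
      by (simp add: integral_norm_bound)
    also have "\<dots> \<le> (LINT x|M. \<epsilon> * cmod (h x))"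
    proof (rule integral_mono_AE)
      show "integrable M (\<lambda>x. cmod ((K y x - avg (K y) x) * h x))"
        using Bochner_Integration.integrable_diff[OF i1 i3] by (simp add: left_diff_distrib)
      show "integrable M (\<lambda>x. \<epsilon> * cmod (h x))" using L2_integrable[OF h] by simp
      show "AE x in M. cmod ((K y x - avg (K y) x) * h x) \<le> \<epsilon> * cmod (h x)"
        using elim(3) by eventually_elim (auto simp: norm_mult intro!: mult_right_mono)
    qed
    finally show ?case by simp
  qed
  then have "(LINT y|M. cmod (R (R k) y) * cmod (k y))
      \<le> (LINT y|M. (\<epsilon> * ?H) * cmod (k y))"
    using integrable_norm[OF L2_integrable_mult[OF RRk k]] L2_integrable[OF k]
    by (intro integral_mono_AE) (auto simp: norm_mult elim!: eventually_mono intro!: mult_right_mono)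
  also have "\<dots> = \<epsilon> * ?H * (LINT y|M. cmod (k y))" by simp
  also have "(LINT y|M. cmod (k y)) \<le> (LINT y|M. cmod (h y) + cmod (avg h y))"
    using L2_integrable[OF h] L2_integrable[OF k] L2_integrable[OF ah]
    by (intro integral_mono) (auto simp: k_def norm_triangle_ineq4)
  also have "\<dots> \<le> (1 + C) * ?H"
    using L2_integrable[OF h] L2_integrable[OF ah] integral_norm_avg_le[OF L2_integrable[OF h]]
    by (simp add: distrib_right)
  finally have RRk_k: "(LINT y|M. cmod (R (R k) y) * cmod (k y))
      \<le> \<epsilon> * ?H * ((1 + C) * ?H)"
    using \<open>\<epsilon> \<ge> 0\<close> by (simp add: mult_left_mono)
  have "complex_of_real ((L2_norm M (R k))\<^sup>2) = L2_inner M (R (R k)) k"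
    using L2_inner_self[of M "R k"] positive_operator_symmetric[OF R pos Rk k] by simp
  then have "(L2_norm M (R k))\<^sup>2 = cmod (L2_inner M (R (R k)) k)"
    by (metis norm_of_real abs_of_nonneg zero_le_power2)
  also have "\<dots> \<le> (LINT y|M. cmod (R (R k) y * cnj (k y)))"
    unfolding L2_inner_def by (rule integral_norm_bound)
  also have "\<dots> \<le> \<epsilon> * (1 + C) * ?H\<^sup>2"
    using RRk_k by (simp add: norm_mult power2_eq_square mult_ac)
  also have "\<dots> = (sqrt (\<epsilon> * (1 + C)) * ?H)\<^sup>2"
    using \<open>\<epsilon> \<ge> 0\<close> C_nonneg by (simp add: power_mult_distrib)
  finally have Rkn: "L2_norm M (R k) \<le> sqrt (\<epsilon> * (1 + C)) * ?H"
    by (rule power2_le_imp_le) (use \<open>\<epsilon> \<ge> 0\<close> C_nonneg in auto)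
  have "cmod (L2_inner M f (R k)) \<le> L2_norm M f * L2_norm M (R k)" by (rule L2_Cauchy_Schwarz[OF f Rk])
  also have "\<dots> \<le> L2_norm M f * (sqrt (\<epsilon> * (1 + C)) * ?H)"
    by (intro mult_left_mono Rkn) simp
  finally show ?thesis unfolding eq by (simp add: mult_ac)
qed

text \<open>The summary for operators: the closeness \<open>\<epsilon>\<close> of \<open>K\<close> to its averages and the rank \<open>r\<close> of the
  averaging operator control the approximation numbers of \<open>R\<^sup>2\<close> beyond \<open>4 r\<close>.\<close>

theorem approx_number_integral_operator_le:
  assumes R: "L2_operator M R" and pos: "positive_operator M R"
    and K: "case_prod K \<in> L2 (M \<Otimes>\<^sub>M M)"
    and RRK: "\<And>f. f \<in> L2 M \<Longrightarrow> AE y in M. R (R f) y = (LINT x|M. K y x * f x)"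
    and close: "AE y in M. AE x in M. cmod (K y x - avg (K y) x) \<le> \<epsilon>" and "\<epsilon> \<ge> 0"
    and F: "finite F" "card F \<le> r" "AE_spanned M (avg ` L2 M) F" and "r \<ge> 1" and "4 * r < n"
  shows "0 \<le> approx_number M n (\<lambda>f y. LINT x|M. K y x * f x)"
    "approx_number M n (\<lambda>f y. LINT x|M. K y x * f x) \<le> \<epsilon> * (1 + C) * measure M (space M) / real r"
proof -
  let ?T = "\<lambda>f y. LINT x|M. K y x * f x"
  let ?A = "\<lambda>f x. R f x - avg (R f) x"
  let ?\<delta> = "sqrt (\<epsilon> * (1 + C))"
  \<comment> \<open>\<open>avg\<close> is applied to the range of \<open>R\<close> only, where \<open>R f - avg (R f)\<close> is bounded and hence in \<open>L\<^sup>2\<close>\<close>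
  have \<delta>: "?\<delta> \<ge> 0" using \<open>\<epsilon> \<ge> 0\<close> C_nonneg by simp
  have [measurable]: "(\<lambda>(y, x). K y x) \<in> borel_measurable (M \<Otimes>\<^sub>M M)" using L2_measurable[OF K] by simp
  have \<delta>2: "?\<delta>\<^sup>2 = \<epsilon> * (1 + C)"
    by (rule real_sqrt_pow2) (use \<open>\<epsilon> \<ge> 0\<close> C_nonneg in simp)
  have T: "L2_operator M ?T"
  proof (rule L2_operator_AE_equal[OF L2_operator_compose[OF R R] _ RRK])
    fix f assume "f \<in> L2 M"
    then have [measurable]: "f \<in> borel_measurable M" by (rule L2_measurable)
    show "?T f \<in> borel_measurable M" by measurable
  qed
  have Rf: "R f \<in> L2 M" if "f \<in> L2 M" for f by (rule L2_operator_in[OF R that])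
  have A_meas: "?A f \<in> borel_measurable M" if "f \<in> L2 M" for f
    using L2_measurable[OF Rf[OF that]] by measurable
  have sup: "AE x in M. cmod (?A f x) \<le> ?\<delta> * L2_norm M f" if f: "f \<in> L2 M" for f
  proof (rule AE_norm_le_of_dual_bound)
    show "integrable M (?A f)" using L2_integrable[OF Rf[OF f]] avg_integrable by auto
    show "0 \<le> ?\<delta> * L2_norm M f" using \<delta> by simp
  qed (rule dual_bound[OF R pos K RRK close \<open>\<epsilon> \<ge> 0\<close> f])
  have A2: "?A f \<in> L2 M" "(L2_norm M (?A f))\<^sup>2 \<le> (?\<delta> * L2_norm M f)\<^sup>2 * measure M (space M)"
    if f: "f \<in> L2 M" for f
  proof -
    have [measurable]: "?A f \<in> borel_measurable M" by (rule A_meas[OF f])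
    have b: "AE x in M. (cmod (?A f x))\<^sup>2 \<le> (?\<delta> * L2_norm M f)\<^sup>2"
      using sup[OF f] by eventually_elim (intro power_mono, auto)
    have int: "integrable M (\<lambda>x. (cmod (?A f x))\<^sup>2)"
      by (rule integrable_const_bound[where B="(?\<delta> * L2_norm M f)\<^sup>2"]) (use b in auto)
    then show "?A f \<in> L2 M" by (simp add: L2_def)
    have "(L2_norm M (?A f))\<^sup>2 \<le> (LINT x|M. (?\<delta> * L2_norm M f)\<^sup>2)"
      unfolding L2_norm_power2 using int b by (intro integral_mono_AE) auto
    then show "(L2_norm M (?A f))\<^sup>2 \<le> (?\<delta> * L2_norm M f)\<^sup>2 * measure M (space M)"
      by (simp add: mult.commute)
  qed
  have A: "L2_operator M ?A"
    unfolding L2_operator_def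
  proof (intro conjI ballI allI)
    fix f g a b assume f: "f \<in> L2 M" and g: "g \<in> L2 M"
    have l: "(\<lambda>y. a * f y + b * g y) \<in> L2 M" by (rule L2_lincomb[OF f g])
    have Rl: "AE x in M. R (\<lambda>y. a * f y + b * g y) x = a * R f x + b * R g x"
      by (rule L2_operator_lincomb[OF R f g])
    have "AE x in M. avg (R (\<lambda>y. a * f y + b * g y)) x = avg (\<lambda>y. a * R f y + b * R g y) x"
    proof (rule AE_I2)
      fix x assume x: "x \<in> space M"
      have [measurable]: "R (\<lambda>y. a * f y + b * g y) \<in> borel_measurable M" "R f \<in> borel_measurable M"
          "R g \<in> borel_measurable M"
        using Rf[OF l] Rf[OF f] Rf[OF g] by (auto intro: L2_measurable)
      show "avg (R (\<lambda>y. a * f y + b * g y)) x = avg (\<lambda>y. a * R f y + b * R g y) x"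
        unfolding avg_def using Rl x by (intro integral_cong_AE) (auto elim!: eventually_mono)
    qed
    moreover have "AE x in M. avg (\<lambda>y. a * R f y + b * R g y) x = a * avg (R f) x + b * avg (R g) x"
      by (intro avg_lincomb L2_integrable Rf f g)
    ultimately show "AE x in M. ?A (\<lambda>y. a * f y + b * g y) x = a * ?A f x + b * ?A g x"
      using Rl by eventually_elim (simp add: algebra_simps)
  next
    show "\<exists>D. \<forall>f\<in>L2 M. L2_norm M (?A f) \<le> D * L2_norm M f"
    proof (intro exI ballI)
      fix f assume f: "f \<in> L2 M"
      have "(L2_norm M (?A f))\<^sup>2 \<le> (?\<delta> * sqrt (measure M (space M)) * L2_norm M f)\<^sup>2"
        using A2(2)[OF f] by (simp add: power_mult_distrib mult_ac)
      then show "L2_norm M (?A f) \<le> (?\<delta> * sqrt (measure M (space M))) * L2_norm M f"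
        by (rule power2_le_imp_le) (use \<delta> in auto)
    qed
  qed (rule A2(1))
  have "AE_rank_le M (\<lambda>f x. R f x - ?A f x) r"
  proof (rule AE_rank_le_I[OF L2_operator_diff[OF R A] F(1,2)])
    show "AE_spanned M ((\<lambda>f x. R f x - ?A f x) ` L2 M) F"
      using F(3) Rf by (auto simp: AE_spanned_def)
  qed
  note final = approx_number_le_of_sup_bound[where A = ?A and R = R and T = ?T and \<delta> = ?\<delta>, OF finite_measure_axioms T R A RRK this \<open>r \<ge> 1\<close> sup \<delta> \<open>4 * r < n\<close>]
  show "0 \<le> approx_number M n ?T" by (rule final(1))
  show "approx_number M n ?T \<le> \<epsilon> * (1 + C) * measure M (space M) / real r"
    using final(2) unfolding \<delta>2 .
qed

end

section \<open>The Jackson kernel\<close>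

text \<open>From \<open>sin y \<ge> y cos y\<close> for \<open>y = x / 2\<close>, as \<open>sin x = 2 sin y cos y\<close> and \<open>2 cos\<^sup>2 y = 1 + cos x\<close>.\<close>

lemma sin_ge_half:
  assumes "0 \<le> x" "x \<le> pi / 2"
  shows "x / 2 \<le> sin x"
proof (cases "x = 0")
  case False
  define y where "y = x / 2"
  have y: "0 < y" "y < pi / 2" using assms False by (auto simp: y_def)
  obtain z where z: "0 < z" "z < y" "sin y - sin 0 = (y - 0) * cos z"
    using MVT2[of 0 y sin cos] y DERIV_sin by blast
  have "cos y \<le> cos z" using z y by (intro cos_monotone_0_pi_le) auto
  then have "y * cos y \<le> sin y" using z y by simp
  moreover have "0 \<le> cos y" using y by (intro cos_ge_zero) auto
  ultimately have "2 * (y * cos y) * cos y \<le> 2 * sin y * cos y" by (intro mult_right_mono) auto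
  also have "\<dots> = sin x" by (simp add: y_def sin_double[symmetric])
  also have "2 * (y * cos y) * cos y = y * (1 + cos x)"
    using cos_double_cos[of y] by (simp add: y_def power2_eq_square algebra_simps)
  finally have "y * (1 + cos x) \<le> sin x" .
  moreover have "0 \<le> cos x" using assms by (intro cos_ge_zero) auto
  ultimately show ?thesis using y(1) mult_nonneg_nonneg[of y "cos x"] unfolding y_def distrib_left by linarith
qed simp

text \<open>Decay away from the origin on the scale \<open>1 / \<mu>\<close>: \<open>\<bar>sin (\<mu> t / 2)\<bar>\<close> is at most both 1 and \<open>\<mu> t / 2\<close>.\<close>

lemma sine_quotient_upper:
  assumes t: "0 < t" "t < pi" and \<mu>: "\<mu> > 0"
  shows "(sin (\<mu> * t / 2) / sin (t / 2))\<^sup>2 \<le> 32 * \<mu>\<^sup>2 / (1 + (\<mu> * t)\<^sup>2)"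
proof -
  define s where "s = \<mu> * t"
  have s: "s > 0" using t \<mu> by (simp add: s_def)
  have "t / 4 \<le> sin (t / 2)" using sin_ge_half[of "t / 2"] t by simp
  then have den: "(t / 4)\<^sup>2 \<le> (sin (t / 2))\<^sup>2" using t by (intro power_mono) auto
  have "(sin (s / 2))\<^sup>2 \<le> 1" by (simp add: abs_square_le_1)
  moreover have "\<bar>sin (s / 2)\<bar> \<le> \<bar>s / 2\<bar>" by (rule abs_sin_x_le_abs_x)
  then have "(sin (s / 2))\<^sup>2 \<le> (s / 2)\<^sup>2" by (simp only: abs_le_square_iff)
  ultimately have "(1 + s\<^sup>2) * (sin (s / 2))\<^sup>2 \<le> s\<^sup>2 / 4 + s\<^sup>2 * 1"
    using mult_left_mono[of "(sin (s / 2))\<^sup>2" 1 "s\<^sup>2"] by (simp add: distrib_right power_divide)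
  also have "\<dots> \<le> 2 * s\<^sup>2" by simp
  finally have num: "(sin (s / 2))\<^sup>2 \<le> 2 * s\<^sup>2 / (1 + s\<^sup>2)"
    by (simp add: pos_le_divide_eq add_pos_nonneg mult.commute)
  have "(sin (s / 2) / sin (t / 2))\<^sup>2 \<le> (2 * s\<^sup>2 / (1 + s\<^sup>2)) / (t / 4)\<^sup>2"
    unfolding power_divide[of "sin (s / 2)"] using num den t by (intro frac_le) auto
  also have "\<dots> = 32 * \<mu>\<^sup>2 / (1 + s\<^sup>2)"
    using t by (simp add: s_def power_mult_distrib power_divide)
  finally show ?thesis by (simp add: s_def)
qed

lemma sine_quotient_lower:
  assumes \<mu>: "\<mu> \<ge> 2" and t: "pi / (2 * \<mu>) \<le> t" "t \<le> pi / \<mu>"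
  shows "\<mu> / 4 \<le> sin (\<mu> * t / 2) / sin (t / 2)"
proof -
  have t0: "0 < t" using t \<mu> pi_gt_zero by (smt (verit) divide_pos_pos)
  have "t \<le> pi / 2" using t(2) \<mu> by (smt (verit) frac_le pi_gt_zero)
  have s: "pi / 2 \<le> \<mu> * t" "\<mu> * t \<le> pi" using t \<mu> by (auto simp: field_simps)
  have "pi / 8 \<le> (\<mu> * t / 2) / 2" using s by simp
  also have "\<dots> \<le> sin (\<mu> * t / 2)" using s \<mu> t0 by (intro sin_ge_half) auto
  finally have num: "pi / 8 \<le> sin (\<mu> * t / 2)" .
  have den: "0 < sin (t / 2)" using t0 \<open>t \<le> pi / 2\<close> by (intro sin_gt_zero) auto
  have "sin (t / 2) \<le> t / 2" using t0 by (intro sin_x_le_x) auto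
  also have "\<dots> \<le> pi / (2 * \<mu>)" using t(2) by simp
  finally have "\<mu> / 4 * sin (t / 2) \<le> \<mu> / 4 * (pi / (2 * \<mu>))" using \<mu> by (intro mult_left_mono) auto
  also have "\<dots> = pi / 8" using \<mu> by simp
  finally show ?thesis using num den by (simp add: pos_le_divide_eq)
qed

lemma set_integral_subset_mono:
  fixes f :: "'b \<Rightarrow> real"
  assumes int: "set_integrable M B f" and A: "A \<in> sets M" "A \<subseteq> B" and f: "\<And>x. x \<in> B \<Longrightarrow> 0 \<le> f x"
  shows "(LINT x:A|M. f x) \<le> (LINT x:B|M. f x)"
  using int set_integrable_subset[OF int A] A(2) f
  unfolding set_lebesgue_integral_def set_integrable_def
  by (intro integral_mono) (auto simp: indicator_def)

lemma integral_inverse_one_plus_square: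
  assumes \<mu>: "\<mu> > 0"
  shows "set_integrable lborel {0<..<pi} (\<lambda>t. 1 / (1 + (\<mu> * t)\<^sup>2))"
    and "(LBINT t:{0<..<pi}. 1 / (1 + (\<mu> * t)\<^sup>2)) \<le> pi / (2 * \<mu>)"
proof -
  have nz: "1 + (\<mu> * t)\<^sup>2 \<noteq> 0" for t :: real using add_pos_nonneg[of 1 "(\<mu> * t)\<^sup>2"] by simp
  have "has_bochner_integral lborel (\<lambda>t. 1 / (1 + (\<mu> * t)\<^sup>2) * indicator {0..pi} t)
      (arctan (\<mu> * pi) / \<mu> - arctan (\<mu> * 0) / \<mu>)"
  proof (rule has_bochner_integral_FTC_Icc_real)
    show "((\<lambda>t. arctan (\<mu> * t) / \<mu>) has_real_derivative 1 / (1 + (\<mu> * t)\<^sup>2)) (at t)" for t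
    proof -
      have "((\<lambda>t. arctan (\<mu> * t)) has_real_derivative \<mu> * (1 / (1 + (\<mu> * t)\<^sup>2))) (at t)"
        by (auto intro!: derivative_eq_intros simp: field_simps)
      from DERIV_cdivide[OF this, of \<mu>] show ?thesis using \<mu> by simp
    qed
    show "isCont (\<lambda>t. 1 / (1 + (\<mu> * t)\<^sup>2)) t" for t
      using nz by (intro continuous_intros) auto
  qed simp
  then have hb: "has_bochner_integral lborel (\<lambda>t. indicator {0..pi} t *\<^sub>R (1 / (1 + (\<mu> * t)\<^sup>2))) (arctan (\<mu> * pi) / \<mu>)"
    by (simp add: mult.commute)
  then have i: "set_integrable lborel {0..pi} (\<lambda>t. 1 / (1 + (\<mu> * t)\<^sup>2))"
    and e: "(LBINT t:{0..pi}. 1 / (1 + (\<mu> * t)\<^sup>2)) = arctan (\<mu> * pi) / \<mu>"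
    unfolding set_integrable_def set_lebesgue_integral_def
    by (auto simp: has_bochner_integral_iff)
  show i': "set_integrable lborel {0<..<pi} (\<lambda>t. 1 / (1 + (\<mu> * t)\<^sup>2))"
    by (rule set_integrable_subset[OF i]) auto
  have "(LBINT t:{0<..<pi}. 1 / (1 + (\<mu> * t)\<^sup>2)) \<le> (LBINT t:{0..pi}. 1 / (1 + (\<mu> * t)\<^sup>2))"
    by (rule set_integral_subset_mono[OF i]) auto
  also have "\<dots> \<le> (pi / 2) / \<mu>"
    unfolding e using arctan_ubound[of "\<mu> * pi"] \<mu> by (intro divide_right_mono) auto
  finally show "(LBINT t:{0<..<pi}. 1 / (1 + (\<mu> * t)\<^sup>2)) \<le> pi / (2 * \<mu>)" by simp
qed

text \<open>The weight is concentrated at \<open>t \<approx> 1 / \<mu>\<close>. Interpolating \<open>t\<^sup>\<beta> \<le> \<mu>\<^sup>-\<^sup>\<beta> (1 + (\<mu> t)\<^sup>2)\<close> reduces all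
  \<open>\<beta> \<le> 2\<close> to the second moment, for which the exponent \<open>2 l = 2 (\<alpha> + k + 2)\<close> gives integrable
  tails; the lower bound for the total mass comes from \<open>\<pi> / (2 \<mu>) < t < \<pi> / \<mu>\<close>.\<close>

lemma jackson_moment:
  fixes V :: "real \<Rightarrow> real" and \<alpha> k :: nat and \<beta> c C :: real
  assumes V_meas [measurable]: "(\<lambda>t. indicator {0<..<pi} t * V t) \<in> borel_measurable lborel"
    and V0: "\<And>t. t \<in> {0<..<pi} \<Longrightarrow> 0 \<le> V t" and "c > 0" and "C > 0"
    and Vu: "\<And>t. t \<in> {0<..<pi} \<Longrightarrow> V t \<le> C * t ^ \<alpha>"
    and Vl: "\<And>t. t \<in> {0<..<pi / 2} \<Longrightarrow> c * t ^ \<alpha> \<le> V t"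
    and \<beta>: "0 < \<beta>" "\<beta> \<le> 2"
  defines "l \<equiv> \<alpha> + k + 2"
  defines "w \<equiv> (\<lambda>\<mu>::nat. \<lambda>t. (sin (real \<mu> * t / 2) / sin (t / 2)) ^ (2 * l) * V t * sin t ^ k)"
  shows "\<exists>A>0. \<forall>\<mu>\<ge>2. set_integrable lborel {0<..<pi} (w \<mu>) \<and> 0 < (LBINT t:{0<..<pi}. w \<mu> t) \<and>
    set_integrable lborel {0<..<pi} (\<lambda>t. w \<mu> t * t powr \<beta>) \<and>
    (LBINT t:{0<..<pi}. w \<mu> t * t powr \<beta>) \<le> A * real \<mu> powr (- \<beta>) * (LBINT t:{0<..<pi}. w \<mu> t)"
proof -
  define I where "I = {0<..<pi}"
  \<comment> \<open>\<open>w \<mu> t \<le> U \<mu>\<^sup>l\<^sup>+\<^sup>2 / (1 + (\<mu> t)\<^sup>2)\<close>, and \<open>w \<mu> t \<ge> L \<mu>\<^sup>l\<^sup>+\<^sup>2\<close> on \<open>(\<pi> / (2 \<mu>), \<pi> / \<mu>)\<close>; here \<open>l + 2 = 2 l - \<alpha> - k\<close>\<close>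
  define U where "U = C * 32 ^ l"
  define L where "L = (1 / 16) ^ l * c * (1 / 2) ^ k"
  have UL: "U > 0" "L > 0" using \<open>c > 0\<close> \<open>C > 0\<close> by (auto simp: U_def L_def)
  define A where "A = U * (pi / 2) / L"
  have "set_integrable lborel I (w \<mu>) \<and> 0 < (LBINT t:I. w \<mu> t) \<and>
      set_integrable lborel I (\<lambda>t. w \<mu> t * t powr \<beta>) \<and>
      (LBINT t:I. w \<mu> t * t powr \<beta>) \<le> A * real \<mu> powr (- \<beta>) * (LBINT t:I. w \<mu> t)"
    if "\<mu> \<ge> 2" for \<mu> :: nat
  proof -
    define m where "m = real \<mu>"
    have m: "m \<ge> 2" using that by (simp add: m_def)
    let ?g = "\<lambda>t. 1 / (1 + (m * t)\<^sup>2)"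
    note g = integral_inverse_one_plus_square[of m, folded I_def]
    have D_nonneg: "0 \<le> (sin (m * t / 2) / sin (t / 2)) ^ (2 * l)" for t by simp
    have w0: "0 \<le> w \<mu> t" if "t \<in> I" for t
      using that V0[of t] sin_gt_zero[of t] by (simp add: w_def I_def)
    have up: "w \<mu> t * (1 + (m * t)\<^sup>2) \<le> U * m ^ (l + 2) * ?g t" if t: "t \<in> I" for t
    proof -
      have t': "0 < t" "t < pi" using t by (auto simp: I_def)
      define s where "s = m * t"
      have s: "0 < s" using m t' by (simp add: s_def)
      have ps: "1 + s\<^sup>2 > 0" by (simp add: add_pos_nonneg)
      have "(sin (m * t / 2) / sin (t / 2)) ^ (2 * l) = ((sin (m * t / 2) / sin (t / 2))\<^sup>2) ^ l"
        by (simp add: power_mult)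
      also have "\<dots> \<le> (32 * m\<^sup>2 / (1 + s\<^sup>2)) ^ l"
        unfolding s_def using t' m by (intro power_mono sine_quotient_upper) auto
      finally have 1: "(sin (m * t / 2) / sin (t / 2)) ^ (2 * l) \<le> (32 * m\<^sup>2 / (1 + s\<^sup>2)) ^ l" .
      have 2: "sin t ^ k \<le> t ^ k" using t' sin_gt_zero[of t] sin_x_le_x[of t] by (intro power_mono) auto
      have "s \<le> 1 + s\<^sup>2"
        using sum_squares_bound[of 1 s] s by (simp add: power2_eq_square)
      then have "s ^ (\<alpha> + k) \<le> (1 + s\<^sup>2) ^ (\<alpha> + k)" using s by (intro power_mono) auto
      then have "(s / m) ^ (\<alpha> + k) \<le> (1 + s\<^sup>2) ^ (\<alpha> + k) / m ^ (\<alpha> + k)"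
        using m by (simp add: power_divide divide_right_mono)
      then have 3: "t ^ (\<alpha> + k) \<le> (1 + s\<^sup>2) ^ (\<alpha> + k) / m ^ (\<alpha> + k)" using m by (simp add: s_def)
      have "w \<mu> t \<le> (32 * m\<^sup>2 / (1 + s\<^sup>2)) ^ l * (C * t ^ \<alpha>) * t ^ k"
        unfolding w_def m_def[symmetric]
        using 1 2 Vu[of t] V0[of t] t \<open>C > 0\<close> t' sin_gt_zero[of t] ps
        by (intro mult_mono) (auto simp: I_def)
      also have "\<dots> = C * (32 * m\<^sup>2 / (1 + s\<^sup>2)) ^ l * t ^ (\<alpha> + k)" by (simp add: power_add)
      also have "\<dots> \<le> C * (32 * m\<^sup>2 / (1 + s\<^sup>2)) ^ l * ((1 + s\<^sup>2) ^ (\<alpha> + k) / m ^ (\<alpha> + k))"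
        using 3 ps \<open>C > 0\<close> by (intro mult_left_mono) auto
      finally have "w \<mu> t * (1 + s\<^sup>2)
          \<le> C * (32 * m\<^sup>2 / (1 + s\<^sup>2)) ^ l * ((1 + s\<^sup>2) ^ (\<alpha> + k) / m ^ (\<alpha> + k)) * (1 + s\<^sup>2)"
        using ps by (intro mult_right_mono) auto
      also have "\<dots> = U * ((m\<^sup>2) ^ l / m ^ (\<alpha> + k)) * ((1 + s\<^sup>2) ^ (\<alpha> + k + 1) / (1 + s\<^sup>2) ^ l)"
        by (simp add: U_def power_mult_distrib power_divide mult_ac)
      also have "(m\<^sup>2) ^ l / m ^ (\<alpha> + k) = m ^ (l + 2)"
      proof -
        have "(m\<^sup>2) ^ l = m ^ (l + 2) * m ^ (\<alpha> + k)"
          unfolding power_mult[symmetric] power_add[symmetric] by (rule arg_cong[where f="(^) m"]) (simp add: l_def)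
        then show ?thesis using m by simp
      qed
      also have "(1 + s\<^sup>2) ^ (\<alpha> + k + 1) / (1 + s\<^sup>2) ^ l = 1 / (1 + s\<^sup>2)"
        using ps by (simp add: l_def)
      finally show ?thesis by (simp add: s_def)
    qed
    have powr: "t powr \<beta> \<le> m powr (- \<beta>) * (1 + (m * t)\<^sup>2)" if "t \<in> I" for t
    proof -
      have t: "0 < t" using that by (simp add: I_def)
      have s: "0 < m * t" using t m by simp
      have "(m * t) powr \<beta> \<le> 1 + (m * t)\<^sup>2"
      proof (cases "m * t \<le> 1")
        case True
        then have "(m * t) powr \<beta> \<le> 1" using s \<beta> by (intro powr_le1) auto
        then show ?thesis by (smt (verit) zero_le_power2)
      next
        case False
        then have "(m * t) powr \<beta> \<le> (m * t) powr 2" using \<beta> by (intro powr_mono) auto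
        then show ?thesis using s by (simp add: powr_numeral)
      qed
      then have "m powr (- \<beta>) * (m * t) powr \<beta> \<le> m powr (- \<beta>) * (1 + (m * t)\<^sup>2)"
        by (intro mult_left_mono) auto
      moreover have "m powr (- \<beta>) * (m * t) powr \<beta> = t powr \<beta>"
        using m t by (simp add: powr_mult powr_minus field_simps)
      ultimately show ?thesis by simp
    qed
    have up2: "w \<mu> t * t powr \<beta> \<le> m powr (- \<beta>) * (U * m ^ (l + 2)) * ?g t" if t: "t \<in> I" for t
    proof -
      have "w \<mu> t * t powr \<beta> \<le> w \<mu> t * (m powr (- \<beta>) * (1 + (m * t)\<^sup>2))"
        by (intro mult_left_mono powr w0 t)
      also have "\<dots> = m powr (- \<beta>) * (w \<mu> t * (1 + (m * t)\<^sup>2))" by simp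
      also have "\<dots> \<le> m powr (- \<beta>) * (U * m ^ (l + 2) * ?g t)"
        by (intro mult_left_mono up t) simp
      finally show ?thesis by (simp only: mult.assoc)
    qed
    have up1: "w \<mu> t \<le> U * m ^ (l + 2) * ?g t" if t: "t \<in> I" for t
    proof -
      have "w \<mu> t * 1 \<le> w \<mu> t * (1 + (m * t)\<^sup>2)" using w0[OF t] by (intro mult_left_mono) auto
      then show ?thesis using up[OF t] by simp
    qed
    have wm: "set_borel_measurable lborel I (w \<mu>)"
    proof -
      have "(\<lambda>t. (sin (m * t / 2) / sin (t / 2)) ^ (2 * l) * (indicator I t * V t) * sin t ^ k) \<in> borel_measurable lborel"
        unfolding I_def by measurable
      then show ?thesis by (simp add: set_borel_measurable_def w_def m_def mult_ac)
    qed
    have gi: "set_integrable lborel I (\<lambda>t. D * ?g t)" for D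
      using g(1) m by (intro set_integrable_mult_right) auto
    have wi: "set_integrable lborel I (w \<mu>)"
    proof (rule set_integrable_bound[OF gi[of "U * m ^ (l + 2)"] wm], intro AE_I2 impI)
      fix t assume "t \<in> I"
      then show "norm (w \<mu> t) \<le> norm (U * m ^ (l + 2) * ?g t)"
        unfolding real_norm_def using up1[of t] w0[of t] by linarith
    qed
    have wbm: "set_borel_measurable lborel I (\<lambda>t. w \<mu> t * t powr \<beta>)"
    proof -
      have [measurable]: "(\<lambda>t. indicator I t * w \<mu> t) \<in> borel_measurable lborel"
        using wm by (simp add: set_borel_measurable_def)
      have "(\<lambda>t. (indicator I t * w \<mu> t) * t powr \<beta>) \<in> borel_measurable lborel" by measurable
      then show ?thesis by (simp add: set_borel_measurable_def mult_ac)
    qed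
    have wbi: "set_integrable lborel I (\<lambda>t. w \<mu> t * t powr \<beta>)"
    proof (rule set_integrable_bound[OF gi[of "m powr (- \<beta>) * (U * m ^ (l + 2))"] wbm], intro AE_I2 impI)
      fix t assume t: "t \<in> I"
      have "0 \<le> w \<mu> t * t powr \<beta>" using w0[OF t] by simp
      then show "norm (w \<mu> t * t powr \<beta>) \<le> norm (m powr (- \<beta>) * (U * m ^ (l + 2)) * ?g t)"
        unfolding real_norm_def using up2[OF t] by linarith
    qed
    have "(LBINT t:I. w \<mu> t * t powr \<beta>) \<le> (LBINT t:I. m powr (- \<beta>) * (U * m ^ (l + 2)) * ?g t)"
      by (rule set_integral_mono[OF wbi gi up2])
    also have "\<dots> = m powr (- \<beta>) * (U * m ^ (l + 2)) * (LBINT t:I. ?g t)"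
      by (rule set_integral_mult_right)
    also have "\<dots> \<le> m powr (- \<beta>) * (U * m ^ (l + 2)) * (pi / (2 * m))"
      using g(2) m UL by (intro mult_left_mono) auto
    also have "\<dots> = A * m powr (- \<beta>) * (L * m ^ (l + 1))"
      using m UL by (simp add: A_def)
    finally have upper: "(LBINT t:I. w \<mu> t * t powr \<beta>) \<le> A * m powr (- \<beta>) * (L * m ^ (l + 1))" .
    define S where "S = {pi / (2 * m)<..<pi / m}"
    have pm: "pi / m \<le> pi / 2" using m by (intro divide_left_mono) auto
    have S: "S \<subseteq> I" using m pm by (auto simp: S_def I_def intro: le_less_trans[OF _ less_trans])
    have low: "L * m ^ (l + 2) \<le> w \<mu> t" if t: "t \<in> S" for t
    proof -
      have t1: "pi / (2 * m) \<le> t" "t \<le> pi / m" using t by (auto simp: S_def)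
      have "1 / m \<le> pi / (2 * m)" using m pi_ge_two by (simp add: field_simps)
      then have t2: "1 / m \<le> t" using t1 by simp
      have t3: "0 < t" using t2 m by (smt (verit) divide_pos_pos)
      have t4: "t < pi / 2" using t pm unfolding S_def greaterThanLessThan_iff by linarith
      have "(m / 4) ^ (2 * l) \<le> (sin (m * t / 2) / sin (t / 2)) ^ (2 * l)"
        using m by (intro power_mono sine_quotient_lower t1) auto
      moreover have "c * (1 / m) ^ \<alpha> \<le> c * t ^ \<alpha>"
        using \<open>c > 0\<close> t2 m by (intro mult_left_mono power_mono) auto
      then have "c * (1 / m) ^ \<alpha> \<le> V t" using Vl[of t] t3 t4 by auto
      moreover have "(1 / m / 2) ^ k \<le> sin t ^ k"
      proof (rule power_mono)
        have "1 / m / 2 \<le> t / 2" using t2 by simp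
        also have "\<dots> \<le> sin t" using t3 t4 by (intro sin_ge_half) auto
        finally show "1 / m / 2 \<le> sin t" .
      qed (use m in auto)
      ultimately have "(m / 4) ^ (2 * l) * (c * (1 / m) ^ \<alpha>) * (1 / m / 2) ^ k \<le> w \<mu> t"
        unfolding w_def m_def[symmetric] using \<open>c > 0\<close> m V0[of t] t S
        by (intro mult_mono) (auto simp: I_def)
      moreover have "(m / 4) ^ (2 * l) * (c * (1 / m) ^ \<alpha>) * (1 / m / 2) ^ k = L * m ^ (l + 2)"
      proof -
        have "m ^ (2 * l) = m ^ (l + 2) * m ^ (\<alpha> + k)"
          unfolding power_add[symmetric] by (rule arg_cong[where f="(^) m"]) (simp add: l_def)
        moreover have "(4::real) ^ (2 * l) = 16 ^ l" by (simp add: power_mult)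
        ultimately show ?thesis using m by (simp add: L_def power_divide power_add)
      qed
      ultimately show ?thesis by simp
    qed
    have Sle: "pi / (2 * m) \<le> pi / m" using m by (intro divide_left_mono) auto
    then have Sm: "emeasure lborel S < \<infinity>" by (simp add: S_def)
    have "L * m ^ (l + 1) \<le> L * m ^ (l + 2) * (pi / (2 * m))"
      using UL m pi_ge_two by (simp add: mult_left_mono)
    also have "pi / (2 * m) = measure lborel S"
      using m Sle by (simp add: S_def field_simps)
    also have "L * m ^ (l + 2) * measure lborel S = (LBINT t:S. L * m ^ (l + 2))"
      using Sm by (simp add: S_def set_lebesgue_integral_def)
    also have "\<dots> \<le> (LBINT t:S. w \<mu> t)"
    proof (rule set_integral_mono)
      show "set_integrable lborel S (\<lambda>t. L * m ^ (l + 2))"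
        using Sm by (simp add: set_integrable_def S_def integrable_real_mult_indicator)
      show "set_integrable lborel S (w \<mu>)"
        by (rule set_integrable_subset[OF wi]) (use S in \<open>auto simp: S_def\<close>)
    qed (rule low)
    also have "\<dots> \<le> (LBINT t:I. w \<mu> t)"
      by (rule set_integral_subset_mono[OF wi _ S w0]) (simp add: S_def)
    finally have lower: "L * m ^ (l + 1) \<le> (LBINT t:I. w \<mu> t)" .
    moreover have "0 < L * m ^ (l + 1)" using UL m by simp
    ultimately have pos: "0 < (LBINT t:I. w \<mu> t)" by simp
    have "A * m powr (- \<beta>) * (L * m ^ (l + 1)) \<le> A * m powr (- \<beta>) * (LBINT t:I. w \<mu> t)"
      using lower UL by (intro mult_left_mono) (auto simp: A_def)
    with upper have "(LBINT t:I. w \<mu> t * t powr \<beta>) \<le> A * m powr (- \<beta>) * (LBINT t:I. w \<mu> t)" by simp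
    with wi pos wbi show ?thesis by (simp add: m_def)
  qed
  moreover have "A > 0" using UL by (simp add: A_def)
  ultimately show ?thesis unfolding I_def by blast
qed

section \<open>Zonal functions on the sphere\<close>

lemma nn_integral_lborel_translate:
  fixes c :: "'a::euclidean_space"
  assumes [measurable]: "g \<in> borel_measurable borel"
  shows "(\<integral>\<^sup>+x. g (c + x) \<partial>lborel) = (\<integral>\<^sup>+x. g x \<partial>lborel)"
proof -
  have "(\<integral>\<^sup>+x. g x \<partial>lborel) = (\<integral>\<^sup>+x. g x \<partial>distr lborel borel ((+) c))"
    by (simp add: lborel_distr_plus)
  also have "\<dots> = (\<integral>\<^sup>+x. g (c + x) \<partial>lborel)" by (rule nn_integral_distr) auto
  finally show ?thesis by simp
qed

lemma orthogonal_transformation_measurable: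
  "orthogonal_transformation (f :: 'a::euclidean_space \<Rightarrow> 'a) \<Longrightarrow> f \<in> borel_measurable borel"
  by (intro borel_measurable_continuous_onI linear_continuous_on linear_conv_bounded_linear[THEN iffD1]
      orthogonal_transformation_linear)

text \<open>Uniqueness of translation invariant measures: comparing with the unit ball \<open>A\<close>, the double
  integral of \<open>1\<^sub>A(x) 1\<^sub>B(f y + x)\<close> is \<open>\<lambda>(A) \<lambda>(f\<^sup>-\<^sup>1 B)\<close> when integrated over \<open>y\<close> first, and, after
  substituting \<open>x - f y\<close> for \<open>x\<close>, it is \<open>\<lambda>(B)\<close> times the volume of a unit ball.\<close>

lemma lborel_distr_orthogonal:
  fixes f :: "'a::euclidean_space \<Rightarrow> 'a"
  assumes f: "orthogonal_transformation f"
  shows "distr lborel borel f = lborel"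
proof (rule measure_eqI)
  fix B :: "'a set" assume "B \<in> sets (distr lborel borel f)"
  then have B [measurable]: "B \<in> sets borel" by simp
  have [measurable]: "f \<in> borel_measurable borel" by (rule orthogonal_transformation_measurable[OF f])
  have [measurable]: "ball (0::'a) 1 \<in> sets borel" by simp
  define a where "a = emeasure lborel (ball (0::'a) 1)"
  have a: "a \<noteq> 0" "a \<noteq> \<infinity>" by (auto simp: a_def emeasure_ball unit_ball_vol_pos less_imp_neq[symmetric])
  have add: "f (u + v) = f u + f v" for u v
    using orthogonal_transformation_linear[OF f] by (rule linear_add)
  have inv: "\<exists>g. f g = x" for x
    using orthogonal_transformation_surj[OF f] by (metis surjD)
  have 1: "(\<integral>\<^sup>+y. indicator B (f y + x) \<partial>lborel) = emeasure (distr lborel borel f) B" for x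
  proof -
    obtain g where g: "f g = x" using inv by blast
    have "(\<integral>\<^sup>+y. indicator B (f y + x) \<partial>lborel) = (\<integral>\<^sup>+y. indicator B (f (g + y)) \<partial>lborel)"
      by (simp add: add g add.commute)
    also have "\<dots> = (\<integral>\<^sup>+y. indicator B (f y) \<partial>lborel)"
      by (rule nn_integral_lborel_translate) simp
    also have "\<dots> = emeasure (distr lborel borel f) B"
      by (subst nn_integral_distr[symmetric]) (auto intro: nn_integral_indicator)
    finally show ?thesis .
  qed
  have 2: "(\<integral>\<^sup>+y. indicator (ball 0 1) (x - f y) \<partial>lborel) = a" for x
  proof -
    obtain g where g: "f g = x" using inv by blast
    have "norm (x - f y) = norm (g - y)" for y
      using orthogonal_transformation_norm[OF f, of "g - y"] orthogonal_transformation_linear[OF f]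
      by (simp add: linear_diff g)
    then have "f y \<in> ball x 1 \<longleftrightarrow> y \<in> ball g 1" for y by (simp add: dist_norm)
    then have "(\<integral>\<^sup>+y. indicator (ball 0 1) (x - f y) \<partial>lborel) = (\<integral>\<^sup>+y. indicator (ball g 1) y \<partial>lborel)"
      by (intro nn_integral_cong) (auto simp: indicator_def dist_norm norm_minus_commute)
    also have "\<dots> = a" by (simp add: a_def emeasure_ball)
    finally show ?thesis .
  qed
  have "a * emeasure (distr lborel borel f) B
      = (\<integral>\<^sup>+x. indicator (ball (0::'a) 1) x * emeasure (distr lborel borel f) B \<partial>lborel)"
    by (subst nn_integral_multc) (auto simp: a_def intro!: borel_measurable_indicator)
  also have "\<dots> = (\<integral>\<^sup>+x. \<integral>\<^sup>+y. indicator (ball (0::'a) 1) x * indicator B (f y + x) \<partial>lborel \<partial>lborel)"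
    by (simp add: 1 nn_integral_cmult)
  also have "\<dots> = (\<integral>\<^sup>+y. \<integral>\<^sup>+x. indicator (ball (0::'a) 1) x * indicator B (f y + x) \<partial>lborel \<partial>lborel)"
    by (rule lborel_pair.Fubini'[symmetric]) measurable
  also have "\<dots> = (\<integral>\<^sup>+y. \<integral>\<^sup>+x. indicator (ball 0 1) (x - f y) * indicator B x \<partial>lborel \<partial>lborel)"
  proof (rule nn_integral_cong)
    fix y :: 'a
    show "(\<integral>\<^sup>+x. indicator (ball (0::'a) 1) x * indicator B (f y + x) \<partial>lborel)
        = (\<integral>\<^sup>+x. indicator (ball 0 1) (x - f y) * indicator B x \<partial>lborel)"
      using nn_integral_lborel_translate[of "\<lambda>x. indicator (ball 0 1) (x - f y) * indicator B x" "f y"] by simp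
  qed
  also have "\<dots> = (\<integral>\<^sup>+x. \<integral>\<^sup>+y. indicator (ball 0 1) (x - f y) * indicator B x \<partial>lborel \<partial>lborel)"
    by (rule lborel_pair.Fubini') measurable
  also have "\<dots> = (\<integral>\<^sup>+x. a * indicator B x \<partial>lborel)"
    by (simp add: nn_integral_multc 2)
  also have "\<dots> = a * emeasure lborel B" by (simp add: nn_integral_cmult)
  finally show "emeasure (distr lborel borel f) B = emeasure lborel B"
    using a by (simp add: ennreal_mult_cancel_left)
qed simp

lemma householder_reflection:
  fixes x e :: "'a::euclidean_space"
  assumes "norm x = 1" "norm e = 1"
  obtains f where "orthogonal_transformation f" "f e = x"
proof (cases "x = e")
  case True
  then show thesis using that[of "\<lambda>x. x"] by simp
next
  case False
  define v where "v = x - e"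
  define f where "f z = z - (2 * (z \<bullet> v) / (v \<bullet> v)) *\<^sub>R v" for z
  have v: "v \<bullet> v \<noteq> 0" using False by (simp add: v_def)
  have "linear f"
    by (rule linearI) (simp_all add: f_def inner_add_left add_divide_distrib algebra_simps)
  moreover have "f y \<bullet> f z = y \<bullet> z" for y z
  proof -
    have "f y \<bullet> f z = y \<bullet> z - 2 * (z \<bullet> v) / (v \<bullet> v) * (y \<bullet> v) - 2 * (y \<bullet> v) / (v \<bullet> v) * (v \<bullet> z)
        + 2 * (y \<bullet> v) / (v \<bullet> v) * (2 * (z \<bullet> v) / (v \<bullet> v)) * (v \<bullet> v)"
      by (simp add: f_def inner_diff_left inner_diff_right)
    then show ?thesis using v by (simp add: inner_commute[of v z])
  qed
  ultimately have "orthogonal_transformation f" by (simp add: orthogonal_transformation_def)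
  moreover have "f e = x"
  proof -
    have "v \<bullet> v = 2 - 2 * (e \<bullet> x)"
    proof -
      have "x \<bullet> x = 1" "e \<bullet> e = 1" using assms by (auto simp: dot_square_norm)
      then show ?thesis by (simp only: v_def inner_diff_left inner_diff_right inner_commute[of x e])
    qed
    moreover have "e \<bullet> v = (e \<bullet> x) - 1" using assms by (simp add: v_def inner_diff_right dot_square_norm)
    ultimately have "2 * (e \<bullet> v) = - (v \<bullet> v)" by simp
    then have "2 * (e \<bullet> v) / (v \<bullet> v) = - 1" using v by simp
    then show ?thesis by (simp add: f_def v_def)
  qed
  ultimately show thesis by (rule that)
qed

text \<open>The substitution \<open>u = s / sqrt (s\<^sup>2 + \<rho>\<^sup>2)\<close> for the cosine of the angle with the axis, on the line at
  distance \<open>\<rho>\<close> from it. The inverse \<open>g\<close> maps \<open>[-r\<^sub>n, r\<^sub>n]\<close> to \<open>[-\<rho> (n + 1), \<rho> (n + 1)]\<close>, and these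
  intervals exhaust the line.\<close>

lemma nn_integral_cosine_substitution:
  fixes \<psi> :: "real \<Rightarrow> ennreal"
  assumes [measurable]: "\<psi> \<in> borel_measurable borel" and \<rho>: "\<rho> > 0"
  shows "(\<integral>\<^sup>+s. \<psi> (s / sqrt (s\<^sup>2 + \<rho>\<^sup>2)) \<partial>lborel)
    \<le> (\<integral>\<^sup>+u. \<psi> u * ennreal (\<rho> / ((1 - u\<^sup>2) * sqrt (1 - u\<^sup>2))) * indicator {-1<..<1} u \<partial>lborel)" (is "_ \<le> ?R")
proof -
  define g where "g u = \<rho> * (u / sqrt (1 - u\<^sup>2))" for u
  define g' where "g' u = \<rho> / ((1 - u\<^sup>2) * sqrt (1 - u\<^sup>2))" for u
  let ?f = "\<lambda>s. \<psi> (s / sqrt (s\<^sup>2 + \<rho>\<^sup>2))"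
  let ?J = "\<lambda>n s. ?f s * indicator {- (\<rho> * real (Suc n))..\<rho> * real (Suc n)} s"
  define r where "r n = real (Suc n) / sqrt ((real (Suc n))\<^sup>2 + 1)" for n
  have sq1: "(real (Suc n))\<^sup>2 + 1 > 0" for n by (simp add: add_nonneg_pos)
  have r: "0 < r n" "r n < 1" for n
  proof -
    show "0 < r n" using sq1[of n] by (simp add: r_def del: of_nat_Suc)
    have "real (Suc n) < sqrt ((real (Suc n))\<^sup>2 + 1)" by (rule real_less_rsqrt) simp
    then show "r n < 1" using sq1[of n] by (simp add: r_def del: of_nat_Suc)
  qed
  have gr: "g (r n) = \<rho> * real (Suc n)" for n
  proof -
    have "1 - (r n)\<^sup>2 = 1 / ((real (Suc n))\<^sup>2 + 1)"
      using sq1[of n] by (simp add: r_def power_divide field_simps del: of_nat_Suc)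
    then have "sqrt (1 - (r n)\<^sup>2) = 1 / sqrt ((real (Suc n))\<^sup>2 + 1)" by (simp add: real_sqrt_divide)
    then show ?thesis using sq1[of n] by (simp add: g_def r_def del: of_nat_Suc)
  qed
  have gm: "g (- r n) = - (\<rho> * real (Suc n))" for n using gr[of n] by (simp add: g_def)
  have q: "0 < 1 - u\<^sup>2" if "u \<in> {- r n..r n}" for u n
  proof -
    have "\<bar>u\<bar> < 1" using that r[of n] by auto
    then show ?thesis by (simp add: abs_square_less_1)
  qed
  have deriv: "(g has_real_derivative g' u) (at u)" if u: "u \<in> {- r n..r n}" for u n
  proof -
    define w where "w = sqrt (1 - u\<^sup>2)"
    have w: "w > 0" "w\<^sup>2 = 1 - u\<^sup>2" using q[OF u] by (auto simp: w_def)
    have "(g has_real_derivative \<rho> * ((1 * w - u * ((- (2 * u)) * (inverse w / 2))) / (w * w))) (at u)"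
      unfolding g_def[abs_def] w_def using q[OF u]
      by (intro DERIV_cmult DERIV_divide) (auto intro!: derivative_eq_intros)
    moreover have "\<rho> * ((1 * w - u * ((- (2 * u)) * (inverse w / 2))) / (w * w)) = \<rho> * ((w\<^sup>2 + u\<^sup>2) / (w * w\<^sup>2))"
      using w(1) by (simp add: field_simps power2_eq_square)
    ultimately show ?thesis using w by (simp add: g'_def w_def[symmetric] mult.commute)
  qed
  have bound: "(\<integral>\<^sup>+s. ?J n s \<partial>lborel) \<le> ?R" for n
  proof -
    have "(\<integral>\<^sup>+s. ?f s * indicator {g (- r n)..g (r n)} s \<partial>lborel)
        = (\<integral>\<^sup>+u. ?f (g u) * g' u * indicator {- r n..r n} u \<partial>lborel)"
    proof (rule nn_integral_substitution_aux[OF _ _ deriv])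
      show "?f \<in> borel_measurable borel" by measurable
      show "continuous_on {- r n..r n} g'"
        unfolding g'_def[abs_def] using q[of _ n]
        by (intro continuous_intros) (fastforce simp: mult_eq_0_iff)
      show "0 \<le> g' u" if "u \<in> {- r n..r n}" for u
        using q[OF that] \<rho> by (simp add: g'_def)
      show "- r n < r n" using r[of n] by simp
    qed auto
    also have "\<dots> \<le> ?R"
    proof (intro nn_integral_mono)
      fix u
      show "?f (g u) * ennreal (g' u) * indicator {- r n..r n} u
          \<le> \<psi> u * ennreal (\<rho> / ((1 - u\<^sup>2) * sqrt (1 - u\<^sup>2))) * indicator {-1<..<1} u"
      proof (cases "u \<in> {- r n..r n}")
        case True
        have p: "1 - u\<^sup>2 > 0" by (rule q[OF True])
        have "(g u)\<^sup>2 + \<rho>\<^sup>2 = \<rho>\<^sup>2 / (1 - u\<^sup>2)"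
          using p by (simp add: g_def power_mult_distrib power_divide field_simps)
        then have "sqrt ((g u)\<^sup>2 + \<rho>\<^sup>2) = \<rho> / sqrt (1 - u\<^sup>2)" using \<rho> by (simp add: real_sqrt_divide)
        then have "g u / sqrt ((g u)\<^sup>2 + \<rho>\<^sup>2) = u" using \<rho> p by (simp add: g_def)
        moreover have "u \<in> {-1<..<1}" using True r[of n] by auto
        ultimately show ?thesis using True by (simp add: g'_def)
      qed simp
    qed
    finally show ?thesis by (simp add: gr gm)
  qed
  have "(\<integral>\<^sup>+s. ?f s \<partial>lborel) = (\<integral>\<^sup>+s. (SUP n. ?J n s) \<partial>lborel)"
  proof (rule nn_integral_cong)
    fix s :: real
    obtain n :: nat where n: "\<bar>s\<bar> / \<rho> < real n" using reals_Archimedean2 by blast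
    then have "\<bar>s\<bar> \<le> \<rho> * real (Suc n)" using \<rho> by (simp add: field_simps)
    then have s: "s \<in> {- (\<rho> * real (Suc n))..\<rho> * real (Suc n)}" by auto
    show "?f s = (SUP n. ?J n s)"
    proof (rule antisym)
      show "?f s \<le> (SUP n. ?J n s)"
        using s by (intro SUP_upper2[of n]) auto
      show "(SUP n. ?J n s) \<le> ?f s"
        by (intro SUP_least) (auto simp: indicator_def)
    qed
  qed
  also have "\<dots> = (SUP n. \<integral>\<^sup>+s. ?J n s \<partial>lborel)"
  proof (rule nn_integral_monotone_convergence_SUP)
    show "incseq (\<lambda>n s. ?J n s)"
    proof (intro incseq_SucI le_funI mult_left_mono)
      fix n s
      have "\<rho> * real (Suc n) \<le> \<rho> * real (Suc (Suc n))" using \<rho> by simp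
      then show "indicator {- (\<rho> * real (Suc n))..\<rho> * real (Suc n)} s
          \<le> (indicator {- (\<rho> * real (Suc (Suc n)))..\<rho> * real (Suc (Suc n))} s :: ennreal)"
        by (auto simp: indicator_def simp del: of_nat_Suc)
    qed simp
  qed measurable
  also have "\<dots> \<le> ?R" by (intro SUP_least bound)
  finally show ?thesis .
qed

text \<open>Split \<open>z = s e + w\<close> and substitute \<open>u = e \<bullet> sgn z\<close> for \<open>s\<close>. The unit ball becomes \<open>\<bar>w\<bar>\<^sup>2 < 1 - u\<^sup>2\<close>, the
  Jacobian is at most \<open>1 / (1 - u\<^sup>2)\<close> there, and the \<open>m\<close>-dimensional ball of the vectors \<open>w\<close> contributes
  \<open>(1 - u\<^sup>2)\<^sup>m\<^sup>/\<^sup>2\<close>; the product is the density of \<open>\<omega>\<^sub>m\<close>.\<close>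

lemma zonal_integral_basis_le:
  fixes \<phi> :: "real \<Rightarrow> ennreal" and e :: "'a::euclidean_space"
  assumes [measurable]: "\<phi> \<in> borel_measurable borel" and e: "e \<in> Basis"
    and m: "m \<ge> 1" "DIM('a) = m + 1"
  shows "(\<integral>\<^sup>+z. \<phi> (e \<bullet> sgn z) * indicator (ball 0 1) z \<partial>(lborel :: 'a measure))
    \<le> ennreal (unit_ball_vol (real m)) *
      (\<integral>\<^sup>+u. \<phi> u * ennreal ((1 - u\<^sup>2) powr ((real m - 2) / 2)) * indicator {-1..1} u \<partial>lborel)"
proof -
  define I where "I = Basis - {e}"
  have I: "finite I" "e \<notin> I" "card I = m" "I \<noteq> {}" "insert e I = Basis"
  proof -
    show c: "card I = m" using e m by (simp add: I_def)
    then show "I \<noteq> {}" using m by auto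
  qed (use e in \<open>auto simp: I_def\<close>)
  have ne: "b \<noteq> e" if "b \<in> I" for b using that I(2) by auto
  interpret product_sigma_finite "\<lambda>_::'a. lborel :: real measure" ..
  interpret PI: finite_product_sigma_finite "\<lambda>_::'a. lborel :: real measure" I
    by standard (rule I(1))
  interpret pp: pair_sigma_finite lborel "Pi\<^sub>M I (\<lambda>_. lborel :: real measure)"
    by (intro pair_sigma_finite.intro sigma_finite_lborel PI.sigma_finite_measure_axioms)
  let ?P = "Pi\<^sub>M I (\<lambda>_. lborel :: real measure)"
  define q where "q w = (\<Sum>b\<in>I. (w b)\<^sup>2)" for w :: "'a \<Rightarrow> real"
  have [measurable]: "q \<in> borel_measurable ?P" unfolding q_def[abs_def] by measurable
  have q0: "0 \<le> q w" for w by (simp add: q_def sum_nonneg)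
  let ?H = "\<lambda>u w. \<phi> u * ennreal (1 / (1 - u\<^sup>2)) * indicator {-1<..<1} u * indicator {..<1 - u\<^sup>2} (q w)"
  let ?G = "\<lambda>z::'a. \<phi> (e \<bullet> sgn z) * indicator (ball 0 1) z"
  let ?\<Sigma> = "\<lambda>w. \<Sum>b\<in>Basis. w b *\<^sub>R b :: 'a"
  have [measurable]: "ball (0::'a) 1 \<in> sets borel" by simp
  have G [measurable]: "?G \<in> borel_measurable borel"
    unfolding sgn_div_norm by measurable
  have "(\<integral>\<^sup>+z. ?G z \<partial>lborel) = (\<integral>\<^sup>+w. ?G (?\<Sigma> w) \<partial>Pi\<^sub>M Basis (\<lambda>_. lborel))"
    by (subst lborel_eq) (rule nn_integral_distr, measurable)
  also have "\<dots> = (\<integral>\<^sup>+w. \<integral>\<^sup>+s. ?G (?\<Sigma> (w(e := s))) \<partial>lborel \<partial>?P)"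
    unfolding I(5)[symmetric] by (rule product_nn_integral_insert[OF I(1,2)]) measurable
  also have "\<dots> = (\<integral>\<^sup>+w. \<integral>\<^sup>+s. \<phi> (s / sqrt (s\<^sup>2 + q w)) * indicator {..<1} (s\<^sup>2 + q w) \<partial>lborel \<partial>?P)"
  proof (intro nn_integral_cong)
    fix w :: "'a \<Rightarrow> real" and s :: real
    let ?z = "?\<Sigma> (w(e := s))"
    have in_e: "e \<bullet> ?z = s" unfolding inner_commute[of e] using e by simp
    have "(norm ?z)\<^sup>2 = (\<Sum>b\<in>Basis. (?z \<bullet> b) * (?z \<bullet> b))"
      by (simp only: power2_norm_eq_inner euclidean_inner[of ?z ?z])
    also have "\<dots> = (\<Sum>b\<in>insert e I. ((w(e := s)) b)\<^sup>2)"
      unfolding I(5) by (intro sum.cong) (auto simp: power2_eq_square)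
    also have "\<dots> = s\<^sup>2 + q w"
      unfolding q_def sum.insert[OF I(1,2)] using ne by (auto intro!: sum.cong)
    finally have n2: "(norm ?z)\<^sup>2 = s\<^sup>2 + q w" .
    then have n: "norm ?z = sqrt (s\<^sup>2 + q w)" by (metis norm_ge_zero real_sqrt_unique)
    have "?z \<in> ball 0 1 \<longleftrightarrow> s\<^sup>2 + q w < 1"
      by (simp only: mem_ball dist_0_norm n real_sqrt_lt_1_iff)
    then show "?G ?z = \<phi> (s / sqrt (s\<^sup>2 + q w)) * indicator {..<1} (s\<^sup>2 + q w)"
      by (simp only: sgn_div_norm inner_scaleR_right in_e n indicator_def lessThan_iff divide_inverse mult.commute)
  qed
  also have "\<dots> \<le> (\<integral>\<^sup>+w. \<integral>\<^sup>+u. ?H u w \<partial>lborel \<partial>?P)"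
  proof (rule nn_integral_mono_AE)
    \<comment> \<open>on the axis, \<open>w = 0\<close>, the substitution degenerates\<close>
    have "AE w in ?P. q w \<noteq> 0"
    proof (rule AE_I)
      let ?N = "Pi\<^sub>E I (\<lambda>_. {0::real})"
      show "{w \<in> space ?P. \<not> q w \<noteq> 0} \<subseteq> ?N"
      proof
        fix w assume "w \<in> {w \<in> space ?P. \<not> q w \<noteq> 0}"
        then have "w \<in> extensional I" "\<forall>b\<in>I. w b = 0"
          using I(1) by (auto simp: q_def sum_nonneg_eq_0_iff space_PiM PiE_def)
        then show "w \<in> ?N" unfolding PiE_iff by simp
      qed
      show "emeasure ?P ?N = 0"
        using I by (subst emeasure_PiM) auto
      show "?N \<in> sets ?P" using I(1) by (intro sets_PiM_I_finite) auto
    qed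
    then show "AE w in ?P. (\<integral>\<^sup>+s. \<phi> (s / sqrt (s\<^sup>2 + q w)) * indicator {..<1} (s\<^sup>2 + q w) \<partial>lborel)
        \<le> (\<integral>\<^sup>+u. ?H u w \<partial>lborel)"
    proof eventually_elim
      case (elim w)
      then have qw: "q w > 0" using q0[of w] by simp
      define \<rho> where "\<rho> = sqrt (q w)"
      have \<rho>: "\<rho> > 0" "\<rho>\<^sup>2 = q w" using qw by (auto simp: \<rho>_def)
      let ?\<psi> = "\<lambda>u. \<phi> u * indicator {..<1 - u\<^sup>2} (q w)"
      have [measurable]: "?\<psi> \<in> borel_measurable borel"
        unfolding indicator_def lessThan_iff by measurable
      have "(\<integral>\<^sup>+s. \<phi> (s / sqrt (s\<^sup>2 + q w)) * indicator {..<1} (s\<^sup>2 + q w) \<partial>lborel)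
          = (\<integral>\<^sup>+s. ?\<psi> (s / sqrt (s\<^sup>2 + \<rho>\<^sup>2)) \<partial>lborel)"
      proof (rule nn_integral_cong)
        fix s :: real
        have p: "s\<^sup>2 + q w > 0" using qw by (simp add: add_nonneg_pos)
        have "1 - (s / sqrt (s\<^sup>2 + q w))\<^sup>2 = q w / (s\<^sup>2 + q w)"
          using p by (simp add: power_divide field_simps)
        moreover have "q w < q w / (s\<^sup>2 + q w) \<longleftrightarrow> s\<^sup>2 + q w < 1"
          using p qw by (simp add: pos_less_divide_eq)
        ultimately show "\<phi> (s / sqrt (s\<^sup>2 + q w)) * indicator {..<1} (s\<^sup>2 + q w) = ?\<psi> (s / sqrt (s\<^sup>2 + \<rho>\<^sup>2))"
          by (simp add: \<rho>(2) indicator_def)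
      qed
      also have "\<dots> \<le> (\<integral>\<^sup>+u. ?\<psi> u * ennreal (\<rho> / ((1 - u\<^sup>2) * sqrt (1 - u\<^sup>2))) * indicator {-1<..<1} u \<partial>lborel)"
        by (rule nn_integral_cosine_substitution[OF _ \<rho>(1)]) measurable
      also have "\<dots> \<le> (\<integral>\<^sup>+u. ?H u w \<partial>lborel)"
      proof (rule nn_integral_mono)
        fix u :: real
        show "?\<psi> u * ennreal (\<rho> / ((1 - u\<^sup>2) * sqrt (1 - u\<^sup>2))) * indicator {-1<..<1} u
            \<le> ?H u w"
        proof (cases "q w < 1 - u\<^sup>2")
          case True
          have p: "0 < 1 - u\<^sup>2" using True qw by simp
          have "\<rho> \<le> sqrt (1 - u\<^sup>2)" using True by (simp add: \<rho>_def)
          then have "\<rho> / ((1 - u\<^sup>2) * sqrt (1 - u\<^sup>2)) \<le> sqrt (1 - u\<^sup>2) / ((1 - u\<^sup>2) * sqrt (1 - u\<^sup>2))"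
            using p by (intro divide_right_mono) auto
          also have "\<dots> = 1 / (1 - u\<^sup>2)" using p by simp
          finally have "ennreal (\<rho> / ((1 - u\<^sup>2) * sqrt (1 - u\<^sup>2))) \<le> ennreal (1 / (1 - u\<^sup>2))"
            by (rule ennreal_leI)
          then have "\<phi> u * ennreal (\<rho> / ((1 - u\<^sup>2) * sqrt (1 - u\<^sup>2))) * indicator {-1<..<1} u
              \<le> \<phi> u * ennreal (1 / (1 - u\<^sup>2)) * indicator {-1<..<1} u"
            by (intro mult_right_mono mult_left_mono) auto
          then show ?thesis using True by simp
        qed simp
      qed
      finally show ?case .
    qed
  qed
  also have "\<dots> = (\<integral>\<^sup>+u. \<integral>\<^sup>+w. ?H u w \<partial>?P \<partial>lborel)"
    unfolding indicator_def[of "{..<_}"] lessThan_iff by (rule pp.Fubini') measurable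
  also have "\<dots> \<le> (\<integral>\<^sup>+u. ennreal (unit_ball_vol (real m)) *
      (\<phi> u * ennreal ((1 - u\<^sup>2) powr ((real m - 2) / 2)) * indicator {-1..1} u) \<partial>lborel)"
  proof (rule nn_integral_mono)
    fix u :: real
    show "(\<integral>\<^sup>+w. ?H u w \<partial>?P)
        \<le> ennreal (unit_ball_vol (real m)) *
          (\<phi> u * ennreal ((1 - u\<^sup>2) powr ((real m - 2) / 2)) * indicator {-1..1} u)"
    proof (cases "u \<in> {-1<..<1}")
      case True
      then have "\<bar>u\<bar> < 1" by auto
      then have p: "1 - u\<^sup>2 > 0" by (simp add: abs_square_less_1)
      define r where "r = sqrt (1 - u\<^sup>2)"
      have r: "r > 0" "r\<^sup>2 = 1 - u\<^sup>2" using p by (auto simp: r_def)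
      let ?S = "{w. sqrt (\<Sum>i\<in>I. (w i)\<^sup>2) \<le> r} \<inter> space ?P"
      have [measurable]: "?S \<in> sets ?P" by measurable
      have "(\<integral>\<^sup>+w. indicator {..<1 - u\<^sup>2} (q w) \<partial>?P) \<le> (\<integral>\<^sup>+w. indicator ?S w \<partial>?P)"
      proof (rule nn_integral_mono)
        fix w assume w: "w \<in> space ?P"
        have "sqrt (q w) \<le> r" if "q w < 1 - u\<^sup>2" using that by (simp add: r_def)
        then show "indicator {..<1 - u\<^sup>2} (q w) \<le> (indicator ?S w :: ennreal)"
          using w by (auto simp: indicator_def q_def)
      qed
      also have "\<dots> = emeasure ?P ?S" by simp
      also have "\<dots> = ennreal (unit_ball_vol (real m) * r ^ m)"
        using emeasure_cball_aux[OF I(1) r(1)] I(3) by simp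
      finally have le: "(\<integral>\<^sup>+w. indicator {..<1 - u\<^sup>2} (q w) \<partial>?P) \<le> ennreal (unit_ball_vol (real m) * r ^ m)" .
      have "1 / (1 - u\<^sup>2) * r ^ m = (1 - u\<^sup>2) powr ((real m - 2) / 2)"
      proof -
        have "r ^ m = (1 - u\<^sup>2) powr (real m / 2)"
          using p by (simp add: r_def powr_half_sqrt[symmetric] powr_realpow[symmetric] powr_powr)
        moreover have "1 / (1 - u\<^sup>2) = (1 - u\<^sup>2) powr (- 1)" using p by (simp add: powr_minus_divide)
        ultimately have "1 / (1 - u\<^sup>2) * r ^ m = (1 - u\<^sup>2) powr (- 1 + real m / 2)"
          by (simp only: powr_add)
        then show ?thesis by (simp add: diff_divide_distrib)
      qed
      then have eq: "ennreal (1 / (1 - u\<^sup>2)) * ennreal (unit_ball_vol (real m) * r ^ m)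
          = ennreal (unit_ball_vol (real m)) * ennreal ((1 - u\<^sup>2) powr ((real m - 2) / 2))"
        using p r by (simp only: ennreal_mult'[symmetric] flip: \<open>1 / (1 - u\<^sup>2) * r ^ m = _\<close>) (simp add: ennreal_mult'[symmetric])
      have "(\<integral>\<^sup>+w. ?H u w \<partial>?P)
          = \<phi> u * ennreal (1 / (1 - u\<^sup>2)) * indicator {-1<..<1} u * (\<integral>\<^sup>+w. indicator {..<1 - u\<^sup>2} (q w) \<partial>?P)"
        by (rule nn_integral_cmult) measurable
      also have "\<dots> \<le> \<phi> u * ennreal (1 / (1 - u\<^sup>2)) * indicator {-1<..<1} u * ennreal (unit_ball_vol (real m) * r ^ m)"
        by (intro mult_left_mono le) simp
      also have "\<dots> = \<phi> u * (ennreal (1 / (1 - u\<^sup>2)) * ennreal (unit_ball_vol (real m) * r ^ m))"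
        using True by (simp add: mult.assoc)
      also have "\<dots> = ennreal (unit_ball_vol (real m)) *
          (\<phi> u * ennreal ((1 - u\<^sup>2) powr ((real m - 2) / 2)) * indicator {-1..1} u)"
        unfolding eq using True by (simp add: mult_ac)
      finally show ?thesis .
    qed simp
  qed
  also have "\<dots> = ennreal (unit_ball_vol (real m)) *
      (\<integral>\<^sup>+u. \<phi> u * ennreal ((1 - u\<^sup>2) powr ((real m - 2) / 2)) * indicator {-1..1} u \<partial>lborel)"
    by (rule nn_integral_cmult) measurable
  finally show ?thesis .
qed

text \<open>The push-forward of the surface measure under \<open>y \<mapsto> x \<bullet> y\<close> is a multiple of \<open>\<omega>\<^sub>m\<close>; an upper bound
  with some constant suffices for the row integrals. A reflection carries \<open>x\<close> to a basis vector.\<close>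

lemma zonal_integral_le:
  fixes \<phi> :: "real \<Rightarrow> ennreal" and x :: "'a::euclidean_space"
  assumes [measurable]: "\<phi> \<in> borel_measurable borel" and x: "norm x = 1"
    and m: "m \<ge> 1" "DIM('a) = m + 1"
  shows "(\<integral>\<^sup>+y. \<phi> (x \<bullet> y) \<partial>sphere_measure)
    \<le> ennreal (real (m + 1) * unit_ball_vol (real m)) * (\<integral>\<^sup>+u. \<phi> u \<partial>omega_measure m)"
proof -
  obtain e :: 'a where e: "e \<in> Basis" using nonempty_Basis by blast
  obtain f where f: "orthogonal_transformation f" "f e = x"
    using householder_reflection[OF x norm_Basis[OF e]] by blast
  have [measurable]: "f \<in> borel_measurable borel" by (rule orthogonal_transformation_measurable[OF f(1)])
  have [measurable]: "ball (0::'a) 1 \<in> sets borel" by simp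
  have [measurable]: "sgn \<in> borel_measurable (borel :: 'a measure)"
    unfolding sgn_div_norm[abs_def] by measurable
  have sgn_m: "sgn \<in> measurable (restrict_space lborel (ball (0::'a) 1 - {0})) (restrict_space borel (sphere 0 1))"
    by (rule measurable_restrict_space2)
       (auto simp: space_restrict_space norm_sgn intro!: measurable_restrict_space1)
  have \<phi>_m: "(\<lambda>y::'a. \<phi> (x \<bullet> y)) \<in> borel_measurable (restrict_space borel (sphere 0 1))"
    by (intro measurable_restrict_space1) measurable
  have \<phi>_m': "(\<lambda>y::'a. \<phi> (x \<bullet> y)) \<in> borel_measurable
      (distr (restrict_space lborel (ball 0 1 - {0})) (restrict_space borel (sphere 0 1)) sgn)"
    using \<phi>_m by (simp cong: measurable_cong_sets)
  have "(\<integral>\<^sup>+y. \<phi> (x \<bullet> y) \<partial>sphere_measure)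
      = ennreal (real DIM('a)) * (\<integral>\<^sup>+z. \<phi> (x \<bullet> sgn z) \<partial>restrict_space lborel (ball (0::'a) 1 - {0}))"
    unfolding sphere_measure_def
    by (simp only: nn_integral_scale_measure[OF \<phi>_m'] nn_integral_distr[OF sgn_m \<phi>_m'])
  also have "(\<integral>\<^sup>+z. \<phi> (x \<bullet> sgn z) \<partial>restrict_space lborel (ball (0::'a) 1 - {0}))
      \<le> (\<integral>\<^sup>+z. \<phi> (x \<bullet> sgn z) * indicator (ball 0 1) z \<partial>(lborel :: 'a measure))"
    by (subst nn_integral_restrict_space) (auto intro!: nn_integral_mono simp: indicator_def)
  also have "\<dots> = (\<integral>\<^sup>+z. \<phi> (x \<bullet> sgn z) * indicator (ball 0 1) z \<partial>distr lborel borel f)"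
    by (simp add: lborel_distr_orthogonal[OF f(1)])
  also have "\<dots> = (\<integral>\<^sup>+z. \<phi> (x \<bullet> sgn (f z)) * indicator (ball 0 1) (f z) \<partial>lborel)"
    by (rule nn_integral_distr) measurable
  also have "\<dots> = (\<integral>\<^sup>+z. \<phi> (e \<bullet> sgn z) * indicator (ball 0 1) z \<partial>lborel)"
  proof (rule nn_integral_cong)
    fix z :: 'a
    have "norm (f z) = norm z" by (rule orthogonal_transformation_norm[OF f(1)])
    moreover have "x \<bullet> f z = e \<bullet> z" using f by (simp add: orthogonal_transformation_def flip: f(2))
    ultimately show "\<phi> (x \<bullet> sgn (f z)) * indicator (ball 0 1) (f z) = \<phi> (e \<bullet> sgn z) * indicator (ball 0 1) z"
      by (simp add: sgn_div_norm indicator_def)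
  qed
  also have "\<dots> \<le> ennreal (unit_ball_vol (real m)) *
      (\<integral>\<^sup>+u. \<phi> u * ennreal ((1 - u\<^sup>2) powr ((real m - 2) / 2)) * indicator {-1..1} u \<partial>lborel)"
    by (rule zonal_integral_basis_le[OF _ e m]) measurable
  also have "(\<integral>\<^sup>+u. \<phi> u * ennreal ((1 - u\<^sup>2) powr ((real m - 2) / 2)) * indicator {-1..1} u \<partial>lborel)
      = (\<integral>\<^sup>+u. \<phi> u \<partial>omega_measure m)"
  proof -
    have "(\<integral>\<^sup>+u. \<phi> u \<partial>omega_measure m)
        = (\<integral>\<^sup>+u. ennreal ((1 - u\<^sup>2) powr ((real m - 2) / 2)) * \<phi> u \<partial>restrict_space lborel {-1..1})"
      unfolding omega_measure_def by (rule nn_integral_density) (auto intro!: measurable_restrict_space1)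
    also have "\<dots> = (\<integral>\<^sup>+u. ennreal ((1 - u\<^sup>2) powr ((real m - 2) / 2)) * \<phi> u * indicator {-1..1} u \<partial>lborel)"
      by (subst nn_integral_restrict_space) auto
    finally show ?thesis by (simp add: mult_ac)
  qed
  finally show ?thesis
    using m by (simp add: ennreal_mult' mult.assoc mult_left_mono del: of_nat_add of_nat_Suc)
qed

section \<open>Mixtures of averaging kernels\<close>

text \<open>Averages over a parameter \<open>t\<close> of integral operators with kernels \<open>Q t\<close> are the operators of the
  averaged kernel. The average may be infinite on a null set; \<open>enn2real\<close> sets it to 0 there.\<close>

locale kernel_mixture = finite_measure M + N: finite_measure N
  for M :: "'b measure" and N :: "'t measure" +
  fixes Q :: "'t \<Rightarrow> 'b \<Rightarrow> 'b \<Rightarrow> real" and C :: real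
  assumes Q_measurable [measurable]: "(\<lambda>(t, x, y). Q t x y) \<in> borel_measurable (N \<Otimes>\<^sub>M (M \<Otimes>\<^sub>M M))"
    and Q_nonneg: "\<And>t x y. t \<in> space N \<Longrightarrow> x \<in> space M \<Longrightarrow> y \<in> space M \<Longrightarrow> 0 \<le> Q t x y"
    and Q_symmetric: "\<And>t x y. t \<in> space N \<Longrightarrow> x \<in> space M \<Longrightarrow> y \<in> space M \<Longrightarrow> Q t x y = Q t y x"
    and C0: "0 \<le> C"
    and Q_row: "\<And>t x. t \<in> space N \<Longrightarrow> x \<in> space M \<Longrightarrow> (\<integral>\<^sup>+y. ennreal (Q t x y) \<partial>M) \<le> ennreal C"
    and N_prob: "emeasure N (space N) = 1"
begin

definition mixture :: "'b \<Rightarrow> 'b \<Rightarrow> real" where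
  "mixture x y = enn2real (\<integral>\<^sup>+t. ennreal (Q t x y) \<partial>N)"

sublocale NM: pair_sigma_finite N M ..

lemma Q_section [measurable (raw)]:
  assumes "t \<in> measurable L N" "x \<in> measurable L M" "y \<in> measurable L M"
  shows "(\<lambda>z. Q (t z) (x z) (y z)) \<in> borel_measurable L"
proof -
  have "(\<lambda>z. (t z, x z, y z)) \<in> measurable L (N \<Otimes>\<^sub>M (M \<Otimes>\<^sub>M M))"
    using assms by measurable
  from measurable_compose[OF this Q_measurable] show ?thesis by simp
qed

lemma mixture_measurable [measurable]: "(\<lambda>(x, y). mixture x y) \<in> borel_measurable (M \<Otimes>\<^sub>M M)"
  unfolding mixture_def split_beta' by measurable

lemma mixture_row: "x \<in> space M \<Longrightarrow> (\<integral>\<^sup>+y. (\<integral>\<^sup>+t. ennreal (Q t x y) \<partial>N) \<partial>M) \<le> ennreal C"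
proof -
  assume x: "x \<in> space M"
  have "(\<integral>\<^sup>+y. (\<integral>\<^sup>+t. ennreal (Q t x y) \<partial>N) \<partial>M) = (\<integral>\<^sup>+t. (\<integral>\<^sup>+y. ennreal (Q t x y) \<partial>M) \<partial>N)"
    using x by (intro NM.Fubini') measurable
  also have "\<dots> \<le> (\<integral>\<^sup>+t. ennreal C \<partial>N)" by (intro nn_integral_mono Q_row x)
  finally show ?thesis by (simp add: N_prob)
qed

sublocale averaging_kernel M mixture C
proof
  show "(\<lambda>(x, y). mixture x y) \<in> borel_measurable (M \<Otimes>\<^sub>M M)" by measurable
  show "0 \<le> mixture x y" for x y by (simp add: mixture_def)
  show "mixture x y = mixture y x" if "x \<in> space M" "y \<in> space M" for x y
    unfolding mixture_def using Q_symmetric[OF _ that] by (auto intro!: arg_cong[where f=enn2real] nn_integral_cong)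
  show "(\<integral>\<^sup>+y. ennreal (mixture x y) \<partial>M) \<le> ennreal C" if x: "x \<in> space M" for x
  proof -
    have "(\<integral>\<^sup>+y. ennreal (mixture x y) \<partial>M) \<le> (\<integral>\<^sup>+y. (\<integral>\<^sup>+t. ennreal (Q t x y) \<partial>N) \<partial>M)"
    proof (rule nn_integral_mono)
      show "ennreal (mixture x y) \<le> (\<integral>\<^sup>+t. ennreal (Q t x y) \<partial>N)" for y
        unfolding mixture_def by (cases "\<integral>\<^sup>+t. ennreal (Q t x y) \<partial>N") auto
    qed
    also have "\<dots> \<le> ennreal C" by (rule mixture_row[OF x])
    finally show ?thesis .
  qed
qed (rule C0)

text \<open>For integrable \<open>f\<close> the double integral over \<open>t\<close> and \<open>y\<close> converges absolutely for almost every \<open>x\<close>,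
  because its integral over \<open>x\<close> is at most \<open>C \<parallel>f\<parallel>\<^sub>1\<close>.\<close>

lemma avg_eq_mixture:
  assumes f: "integrable M f"
  shows "AE x in M. (LINT t|N. LINT y|M. of_real (Q t x y) * f y) = avg f x"
proof -
  have [measurable]: "f \<in> borel_measurable M" using f by simp
  let ?h = "\<lambda>x. \<integral>\<^sup>+y. (\<integral>\<^sup>+t. ennreal (Q t x y) \<partial>N) * ennreal (cmod (f y)) \<partial>M"
  have "(\<integral>\<^sup>+x. ?h x \<partial>M) = (\<integral>\<^sup>+y. \<integral>\<^sup>+x. (\<integral>\<^sup>+t. ennreal (Q t x y) \<partial>N) * ennreal (cmod (f y)) \<partial>M \<partial>M)"
    by (rule MM.Fubini'[symmetric]) measurable
  also have "\<dots> \<le> (\<integral>\<^sup>+y. ennreal C * ennreal (cmod (f y)) \<partial>M)"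
  proof (rule nn_integral_mono)
    fix y assume y: "y \<in> space M"
    have "(\<integral>\<^sup>+x. (\<integral>\<^sup>+t. ennreal (Q t x y) \<partial>N) * ennreal (cmod (f y)) \<partial>M)
        = (\<integral>\<^sup>+x. (\<integral>\<^sup>+t. ennreal (Q t y x) \<partial>N) * ennreal (cmod (f y)) \<partial>M)"
      using Q_symmetric[OF _ _ y] by (intro nn_integral_cong arg_cong2[where f="(*)"]) auto
    also have "\<dots> = (\<integral>\<^sup>+x. (\<integral>\<^sup>+t. ennreal (Q t y x) \<partial>N) \<partial>M) * ennreal (cmod (f y))"
      using y by (intro nn_integral_multc) measurable
    also have "\<dots> \<le> ennreal C * ennreal (cmod (f y))" by (intro mult_right_mono mixture_row y) simp
    finally show "(\<integral>\<^sup>+x. (\<integral>\<^sup>+t. ennreal (Q t x y) \<partial>N) * ennreal (cmod (f y)) \<partial>M)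
        \<le> ennreal C * ennreal (cmod (f y))" .
  qed
  also have "\<dots> = ennreal C * (\<integral>\<^sup>+y. ennreal (cmod (f y)) \<partial>M)" by (rule nn_integral_cmult) simp
  also have "\<dots> < \<infinity>" using f by (auto simp: integrable_iff_bounded ennreal_mult_less_top)
  finally have "(\<integral>\<^sup>+x. ?h x \<partial>M) \<noteq> \<infinity>" by simp
  then have "AE x in M. ?h x \<noteq> \<infinity>"
    by (intro nn_integral_PInf_AE) measurable
  then show ?thesis
    using AE_space
  proof eventually_elim
    case (elim x)
    note x = elim(2)
    let ?F = "\<lambda>(t, y). of_real (Q t x y) * f y"
    have "(\<integral>\<^sup>+z. ennreal (norm (?F z)) \<partial>(N \<Otimes>\<^sub>M M)) = (\<integral>\<^sup>+y. \<integral>\<^sup>+t. ennreal (norm (?F (t, y))) \<partial>N \<partial>M)"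
      using x by (intro NM.nn_integral_snd[symmetric]) measurable
    also have "\<dots> = ?h x"
    proof (rule nn_integral_cong)
      fix y assume y: "y \<in> space M"
      have "(\<integral>\<^sup>+t. ennreal (norm (?F (t, y))) \<partial>N) = (\<integral>\<^sup>+t. ennreal (Q t x y) * ennreal (cmod (f y)) \<partial>N)"
        using Q_nonneg[OF _ x y] by (intro nn_integral_cong) (simp add: norm_mult ennreal_mult')
      also have "\<dots> = (\<integral>\<^sup>+t. ennreal (Q t x y) \<partial>N) * ennreal (cmod (f y))"
        using x y by (intro nn_integral_multc) measurable
      finally show "(\<integral>\<^sup>+t. ennreal (norm (?F (t, y))) \<partial>N) = (\<integral>\<^sup>+t. ennreal (Q t x y) \<partial>N) * ennreal (cmod (f y))" .
    qed
    finally have "integrable (N \<Otimes>\<^sub>M M) ?F"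
      using elim(1) x by (subst integrable_iff_bounded) (auto simp: less_top)
    then have "(LINT t|N. LINT y|M. of_real (Q t x y) * f y) = (LINT y|M. LINT t|N. of_real (Q t x y) * f y)"
      using NM.Fubini_integral[of "\<lambda>t y. of_real (Q t x y) * f y"] by simp
    also have "\<dots> = avg f x"
      unfolding avg_def
    proof (rule Bochner_Integration.integral_cong)
      fix y assume y: "y \<in> space M"
      have "(LINT t|N. Q t x y) = mixture x y"
        unfolding mixture_def using Q_nonneg[OF _ x y] x y
        by (intro integral_eq_nn_integral) (auto intro!: AE_I2)
      then have "(LINT t|N. complex_of_real (Q t x y)) = of_real (mixture x y)"
        by (simp add: integral_complex_of_real)
      then show "(LINT t|N. of_real (Q t x y) * f y) = of_real (mixture x y) * f y" by simp
    qed simp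
    finally show ?case .
  qed
qed

end

section \<open>Measurability on the sphere\<close>

lemma sphere_measure_finite: "finite_measure (sphere_measure :: 'a::euclidean_space measure)"
proof
  have s: "sphere (0::'a) 1 \<in> sets (restrict_space borel (sphere 0 1))"
    using sets.top[of "restrict_space borel (sphere (0::'a) 1)"] by (simp add: space_restrict_space)
  have "emeasure lborel (sgn -` sphere 0 1 \<inter> (ball (0::'a) 1 - {0})) \<le> emeasure lborel (ball (0::'a) 1)"
    by (rule emeasure_mono) auto
  also have "\<dots> < \<infinity>" by (simp add: emeasure_ball)
  finally show "emeasure (sphere_measure :: 'a measure) (space sphere_measure) \<noteq> \<infinity>"
    by (simp add: emeasure_sphere_measure[OF s] ennreal_mult_less_top less_top[symmetric] ennreal_mult_eq_top_iff)
qed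

lemma measurable_sphereD:
  assumes "x \<in> measurable L (sphere_measure :: 'a::euclidean_space measure)"
  shows "x \<in> borel_measurable L"
proof -
  have "x \<in> measurable L (restrict_space borel (sphere 0 1))"
    using assms by (simp cong: measurable_cong_sets add: sets_sphere_measure)
  then show ?thesis by (simp add: measurable_restrict_space2_iff)
qed

lemma inner_sphere_measurable [measurable (raw)]:
  assumes "x \<in> measurable L (sphere_measure :: 'a::euclidean_space measure)" "y \<in> measurable L sphere_measure"
  shows "(\<lambda>z. x z \<bullet> y z) \<in> measurable L (restrict_space borel {-1..1::real})"
proof (rule measurable_restrict_space2)
  have [measurable]: "x \<in> borel_measurable L" "y \<in> borel_measurable L"
    using assms by (auto intro: measurable_sphereD)
  show "(\<lambda>z. x z \<bullet> y z) \<in> borel_measurable L" by measurable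
  show "(\<lambda>z. x z \<bullet> y z) \<in> space L \<rightarrow> {-1..1}"
  proof
    fix z assume z: "z \<in> space L"
    have "norm (x z) = 1" "norm (y z) = 1"
      using measurable_space[OF assms(1) z] measurable_space[OF assms(2) z] by auto
    then have "\<bar>x z \<bullet> y z\<bar> \<le> 1" using Cauchy_Schwarz_ineq2[of "x z" "y z"] by simp
    then show "x z \<bullet> y z \<in> {-1..1}" by auto
  qed
qed

lemma dist_sphere_measurable [measurable (raw)]:
  assumes "x \<in> measurable L (sphere_measure :: 'a::euclidean_space measure)" "y \<in> measurable L sphere_measure"
  shows "(\<lambda>z. dist (x z) (y z)) \<in> borel_measurable L"
proof -
  have [measurable]: "x \<in> borel_measurable L" "y \<in> borel_measurable L"
    using assms by (auto intro: measurable_sphereD)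
  show ?thesis by measurable
qed

text \<open>A point belongs to the support iff all balls of radius \<open>1 / (n + 1)\<close> around it meet \<open>{f \<noteq> 0}\<close> in
  positive measure. These countably many conditions depend measurably on parameters.\<close>

lemma ess_support_iff:
  fixes f :: "'a::euclidean_space \<Rightarrow> real"
  assumes [measurable]: "f \<in> borel_measurable sphere_measure" and y: "y \<in> sphere 0 1"
  shows "y \<in> ess_support f \<longleftrightarrow>
    (\<forall>n. (\<integral>\<^sup>+z. indicator {..<1 / real (Suc n)} (dist z y) * indicator (- {0}) (f z) \<partial>sphere_measure) \<noteq> 0)"
proof -
  let ?A = "\<lambda>n z. indicator {..<1 / real (Suc n)} (dist z y) * indicator (- {0}) (f z) :: ennreal"
  have ym: "y \<in> space sphere_measure" using y by simp
  have [measurable]: "(\<lambda>z. dist z y) \<in> borel_measurable sphere_measure"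
    by (rule dist_sphere_measurable) (use ym in auto)
  have zero: "(\<integral>\<^sup>+z. ?A n z \<partial>sphere_measure) = 0
      \<longleftrightarrow> (AE z in sphere_measure. z \<in> sphere 0 1 \<inter> ball y (1 / real (Suc n)) \<longrightarrow> f z = 0)" for n
  proof -
    have "(\<integral>\<^sup>+z. ?A n z \<partial>sphere_measure) = 0 \<longleftrightarrow> (AE z in sphere_measure. ?A n z = 0)"
      by (rule nn_integral_0_iff_AE) measurable
    also have "\<dots> \<longleftrightarrow> (AE z in sphere_measure. z \<in> sphere 0 1 \<inter> ball y (1 / real (Suc n)) \<longrightarrow> f z = 0)"
      by (rule AE_cong) (auto simp: indicator_def dist_commute)
    finally show ?thesis .
  qed
  have "y \<notin> ess_support f \<longleftrightarrow> (\<exists>n. (\<integral>\<^sup>+z. ?A n z \<partial>sphere_measure) = 0)"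
  proof
    assume "y \<notin> ess_support f"
    then obtain U where U: "openin (top_of_set (sphere 0 1)) U" "y \<in> U"
        "AE z in sphere_measure. z \<in> U \<longrightarrow> f z = 0"
      using y by (auto simp: ess_support_def)
    then obtain e where e: "e > 0" "ball y e \<inter> sphere 0 1 \<subseteq> U"
      using openin_contains_ball[of "sphere 0 1" U] by blast
    obtain n where "1 / real (Suc n) < e" using e(1) nat_approx_posE by blast
    then have "sphere 0 1 \<inter> ball y (1 / real (Suc n)) \<subseteq> U"
      using e(2) by (auto simp del: of_nat_Suc)
    then have "AE z in sphere_measure. z \<in> sphere 0 1 \<inter> ball y (1 / real (Suc n)) \<longrightarrow> f z = 0"
      using U(3) by (auto elim!: eventually_mono)
    then show "\<exists>n. (\<integral>\<^sup>+z. ?A n z \<partial>sphere_measure) = 0" using zero by blast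
  next
    assume "\<exists>n. (\<integral>\<^sup>+z. ?A n z \<partial>sphere_measure) = 0"
    then obtain n where "AE z in sphere_measure. z \<in> sphere 0 1 \<inter> ball y (1 / real (Suc n)) \<longrightarrow> f z = 0"
      using zero by blast
    moreover have "openin (top_of_set (sphere 0 1)) (sphere 0 1 \<inter> ball y (1 / real (Suc n)))"
      by (rule openin_open_Int) simp
    moreover have "y \<in> sphere 0 1 \<inter> ball y (1 / real (Suc n))" using y by simp
    ultimately show "y \<notin> ess_support f" unfolding ess_support_def by blast
  qed
  then show ?thesis by blast
qed

lemma zonal_measurable:
  fixes Z :: "real \<Rightarrow> real \<Rightarrow> real"
  assumes Z: "case_prod Z \<in> borel_measurable (T \<Otimes>\<^sub>M restrict_space borel {-1..1})"
    and "t \<in> measurable L T" "x \<in> measurable L (sphere_measure :: 'a::euclidean_space measure)"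
      "y \<in> measurable L sphere_measure"
  shows "(\<lambda>z. Z (t z) (x z \<bullet> y z)) \<in> borel_measurable L"
proof -
  have "(\<lambda>z. (t z, x z \<bullet> y z)) \<in> measurable L (T \<Otimes>\<^sub>M restrict_space borel {-1..1})"
    by (intro measurable_Pair assms inner_sphere_measurable)
  from measurable_compose[OF this Z] show ?thesis by simp
qed

text \<open>This gives the integrals over \<open>t\<close> with the factor \<open>V(t)\<close> their meaning, since the Bochner integral of a
  function that is not measurable is 0 by definition.\<close>

lemma support_area_measurable:
  assumes Z: "case_prod Z \<in> borel_measurable (T \<Otimes>\<^sub>M restrict_space borel {-1..1})"
  shows "support_area TYPE('a::euclidean_space) Z \<in> borel_measurable T"
proof -
  interpret S: finite_measure "sphere_measure :: 'a measure" by (rule sphere_measure_finite)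
  define x0 :: 'a where "x0 = (SOME x. x \<in> sphere 0 1)"
  have "(SOME b. b \<in> Basis) \<in> sphere (0::'a) 1" using norm_Basis[OF SOME_Basis] by simp
  then have "\<exists>x::'a. x \<in> sphere 0 1" by blast
  then have x0: "x0 \<in> space sphere_measure"
    unfolding x0_def by (simp only: space_sphere_measure) (rule someI_ex)
  have Zm [measurable (raw)]: "(\<lambda>z. Z (t z) (x0 \<bullet> y z)) \<in> borel_measurable L"
    if "t \<in> measurable L T" "y \<in> measurable L (sphere_measure :: 'a measure)" for L :: "'c measure" and t y
    by (rule zonal_measurable[OF Z]) (use that x0 in auto)
  define h where "h = (\<lambda>n t (y::'a). \<integral>\<^sup>+z. indicator {..<1 / real (Suc n)} (dist z y) * indicator (- {0}) (Z t (x0 \<bullet> z)) \<partial>sphere_measure)"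
  have "(\<lambda>(t, y::'a). h n t y) \<in> borel_measurable (T \<Otimes>\<^sub>M sphere_measure)" for n
  proof -
    have "(\<lambda>(p, z). indicator {..<1 / real (Suc n)} (dist z (snd p)) * indicator (- {0}) (Z (fst p) (x0 \<bullet> z)) :: ennreal)
      \<in> borel_measurable ((T \<Otimes>\<^sub>M sphere_measure) \<Otimes>\<^sub>M sphere_measure)"
    proof -
      have [measurable]: "(\<lambda>q. dist (snd q) (snd (fst q))) \<in> borel_measurable ((T \<Otimes>\<^sub>M sphere_measure) \<Otimes>\<^sub>M (sphere_measure :: 'a measure))"
        by (rule dist_sphere_measurable) measurable
      have [measurable]: "(\<lambda>q. Z (fst (fst q)) (x0 \<bullet> snd q)) \<in> borel_measurable ((T \<Otimes>\<^sub>M sphere_measure) \<Otimes>\<^sub>M (sphere_measure :: 'a measure))"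
        by (rule zonal_measurable[OF Z]) (use x0 in auto)
      show ?thesis unfolding split_beta' by measurable
    qed
    from S.borel_measurable_nn_integral[OF this] show ?thesis by (simp add: split_beta' h_def)
  qed
  then have hm [measurable]: "(\<lambda>p. h n (fst p) (snd p :: 'a)) \<in> borel_measurable (T \<Otimes>\<^sub>M sphere_measure)" for n
    by (simp add: split_beta')
  have "(\<lambda>(t, y::'a). indicator {p. \<forall>n. h n (fst p) (snd p) \<noteq> 0} (t, y) :: ennreal)
      \<in> borel_measurable (T \<Otimes>\<^sub>M sphere_measure)"
    unfolding split_beta' prod.collapse indicator_def mem_Collect_eq by measurable
  from S.borel_measurable_nn_integral[OF this]
  have "(\<lambda>t. enn2real (\<integral>\<^sup>+y. indicator {p. \<forall>n. h n (fst p) (snd p :: 'a) \<noteq> 0} (t, y) \<partial>sphere_measure)) \<in> borel_measurable T"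
    by measurable
  moreover have "support_area TYPE('a) Z t
      = enn2real (\<integral>\<^sup>+y. indicator {p. \<forall>n. h n (fst p) (snd p :: 'a) \<noteq> 0} (t, y) \<partial>sphere_measure)"
    if t: "t \<in> space T" for t
  proof -
    let ?E = "ess_support (\<lambda>y. Z t (x0 \<bullet> y))"
    have fm: "(\<lambda>y. Z t (x0 \<bullet> y)) \<in> borel_measurable (sphere_measure :: 'a measure)"
      by (rule zonal_measurable[OF Z]) (use t x0 in auto)
    have iff: "y \<in> ?E \<longleftrightarrow> (\<forall>n. h n t y \<noteq> 0)" if "y \<in> sphere 0 1" for y
      unfolding h_def by (rule ess_support_iff[OF fm that])
    have sub: "?E \<subseteq> sphere 0 1" by (auto simp: ess_support_def)
    have "{y \<in> space sphere_measure. \<forall>n. h n t y \<noteq> 0} \<in> sets (sphere_measure :: 'a measure)"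
    proof -
      have pm: "(\<lambda>y. (t, y)) \<in> measurable sphere_measure (T \<Otimes>\<^sub>M (sphere_measure :: 'a measure))" using t by measurable
      have [measurable]: "(\<lambda>y::'a. h n t y) \<in> borel_measurable sphere_measure" for n
        using measurable_compose[OF pm hm[of n]] by simp
      show ?thesis by measurable
    qed
    moreover have "?E = {y \<in> space sphere_measure. \<forall>n. h n t y \<noteq> 0}" using iff sub by auto
    ultimately have "?E \<in> sets sphere_measure" by simp
    then have "emeasure sphere_measure ?E = (\<integral>\<^sup>+y. indicator ?E y \<partial>sphere_measure)" by simp
    also have "\<dots> = (\<integral>\<^sup>+y. indicator {p. \<forall>n. h n (fst p) (snd p :: 'a) \<noteq> 0} (t, y) \<partial>sphere_measure)"
      using iff by (intro nn_integral_cong) (auto simp: indicator_def)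
    finally show ?thesis unfolding support_area_def Let_def measure_def x0_def[symmetric] by simp
  qed
  ultimately show ?thesis by (simp cong: measurable_cong)
qed

section \<open>The approximating operators as averages\<close>

locale zonal_family =
  fixes Z :: "real \<Rightarrow> real \<Rightarrow> real" and m \<alpha> :: nat and E :: "'a::euclidean_space itself" and c C1 C2 :: real
  assumes m: "m \<ge> 1" "DIM('a) = m + 1"
    and Z_measurable: "case_prod Z \<in>
      borel_measurable (restrict_space borel {0<..<pi} \<Otimes>\<^sub>M restrict_space borel {-1..1})"
    and Z_nonneg: "\<And>t u. t \<in> {0<..<pi} \<Longrightarrow> u \<in> {-1..1} \<Longrightarrow> 0 \<le> Z t u"
    and Z_integrable: "\<And>t. t \<in> {0<..<pi} \<Longrightarrow> integrable (omega_measure m) (Z t)"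
    and Z_bound: "\<And>t. t \<in> {0<..<pi} \<Longrightarrow> norm_1m m (Z t) \<le> C1"
    and c: "c > 0" and C2: "C2 > 0"
    and area_upper: "\<And>t. t \<in> {0<..<pi} \<Longrightarrow> support_area TYPE('a) Z t \<le> C2 * t ^ \<alpha>"
    and area_lower: "\<And>t. t \<in> {0<..<pi / 2} \<Longrightarrow> c * t ^ \<alpha> \<le> support_area TYPE('a) Z t"
begin

abbreviation \<sigma> :: "'a measure" where "\<sigma> \<equiv> sphere_measure"

definition \<tau> :: real where "\<tau> = measure \<sigma> (sphere 0 1)"

lemma sphere_area_pos: "0 < sphere_area d"
  by (simp add: sphere_area_def)

lemma \<tau>_pos: "0 < \<tau>"
  using measure_sphere_measure[OF m(2)] sphere_area_pos[of m] by (simp add: \<tau>_def)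

text \<open>The constant of \<open>zonal_integral_le\<close> times the bound for \<open>\<parallel>Z\<^sub>t\<parallel>\<^sub>1\<close> in \<open>L\<^sup>1(\<omega>\<^sub>m)\<close> obtained from \<open>C1\<close>, which
  bounds the normalized norm.\<close>

definition row_bound :: real where
  "row_bound = real (m + 1) * unit_ball_vol (real m) * \<bar>C1 * sphere_area m / sphere_area (m - 1)\<bar> / \<tau>"

lemma row_bound_nonneg: "0 \<le> row_bound"
  using \<tau>_pos by (simp add: row_bound_def)

lemma row_integral_le:
  assumes t: "t \<in> {0<..<pi}" and x: "x \<in> sphere 0 1"
  shows "(\<integral>\<^sup>+y. ennreal (Z t (x \<bullet> y) / \<tau>) \<partial>\<sigma>) \<le> ennreal row_bound"
proof -
  have Zt: "Z t \<in> borel_measurable (restrict_space borel {-1..1})"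
  proof -
    have "(\<lambda>u. (t, u)) \<in> measurable (restrict_space borel {-1..1::real})
        (restrict_space borel {0<..<pi} \<Otimes>\<^sub>M restrict_space borel {-1..1})"
      using t by (intro measurable_Pair1') (simp add: space_restrict_space)
    from measurable_compose[OF this Z_measurable] show ?thesis by simp
  qed
  have Z_integral_le: "(LINT u|omega_measure m. \<bar>Z t u\<bar>) \<le> \<bar>C1 * sphere_area m / sphere_area (m - 1)\<bar>"
  proof -
    have "sphere_area (m - 1) / sphere_area m * (LINT u|omega_measure m. \<bar>Z t u\<bar>) \<le> C1"
      using Z_bound[OF t] by (simp add: norm_1m_def)
    then have "(LINT u|omega_measure m. \<bar>Z t u\<bar>) \<le> C1 * sphere_area m / sphere_area (m - 1)"
      using sphere_area_pos[of m] sphere_area_pos[of "m - 1"] by (simp add: field_simps)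
    then show ?thesis by linarith
  qed
  define \<phi> where "\<phi> u = ennreal (indicator {-1..1} u *\<^sub>R Z t u)" for u
  have [measurable]: "\<phi> \<in> borel_measurable borel"
    using Zt unfolding \<phi>_def[abs_def] by (subst (asm) borel_measurable_restrict_space_iff) auto
  have xy: "x \<bullet> y \<in> {-1..1}" if "y \<in> sphere 0 1" for y
  proof -
    have "\<bar>x \<bullet> y\<bar> \<le> 1" using Cauchy_Schwarz_ineq2[of x y] x that by simp
    then show ?thesis by auto
  qed
  have "(\<integral>\<^sup>+y. ennreal (Z t (x \<bullet> y) / \<tau>) \<partial>\<sigma>) = (\<integral>\<^sup>+y. ennreal (1 / \<tau>) * \<phi> (x \<bullet> y) \<partial>\<sigma>)"
    using xy Z_nonneg[OF t] \<tau>_pos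
    by (intro nn_integral_cong) (auto simp: \<phi>_def ennreal_mult'[symmetric])
  also have "\<dots> = ennreal (1 / \<tau>) * (\<integral>\<^sup>+y. \<phi> (x \<bullet> y) \<partial>\<sigma>)"
  proof (rule nn_integral_cmult)
    have "(\<lambda>y. \<phi> (x \<bullet> y)) \<in> borel_measurable (restrict_space borel (sphere 0 1))"
      by (intro measurable_restrict_space1) measurable
    then show "(\<lambda>y. \<phi> (x \<bullet> y)) \<in> borel_measurable \<sigma>" by (simp cong: measurable_cong_sets add: sets_sphere_measure)
  qed
  also have "\<dots> \<le> ennreal (1 / \<tau>) * (ennreal (real (m + 1) * unit_ball_vol (real m)) * (\<integral>\<^sup>+u. \<phi> u \<partial>omega_measure m))"
    using x by (intro mult_left_mono zonal_integral_le m) auto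
  also have "(\<integral>\<^sup>+u. \<phi> u \<partial>omega_measure m) = (\<integral>\<^sup>+u. ennreal \<bar>Z t u\<bar> \<partial>omega_measure m)"
    using Z_nonneg[OF t]
    by (intro nn_integral_cong) (auto simp: \<phi>_def omega_measure_def space_restrict_space)
  also have "\<dots> = ennreal (LINT u|omega_measure m. \<bar>Z t u\<bar>)"
    using Z_integrable[OF t] by (intro nn_integral_eq_integral) auto
  also have "ennreal (1 / \<tau>) * (ennreal (real (m + 1) * unit_ball_vol (real m)) * \<dots>)
      \<le> ennreal (1 / \<tau>) * (ennreal (real (m + 1) * unit_ball_vol (real m)) *
          ennreal \<bar>C1 * sphere_area m / sphere_area (m - 1)\<bar>)"
    by (intro mult_left_mono ennreal_leI Z_integral_le) auto
  also have "\<dots> = ennreal row_bound"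
    using \<tau>_pos by (simp add: row_bound_def ennreal_mult'[symmetric] mult_ac del: of_nat_add of_nat_Suc)
  finally show ?thesis .
qed

text \<open>The weight is \<open>J(t) V(t) (sin t)\<^sup>k\<close> without the normalizing constant, so that \<open>weight_measure\<close> is a
  probability measure on \<open>(0, \<pi>)\<close>.\<close>

definition weight :: "nat \<Rightarrow> nat \<Rightarrow> nat \<Rightarrow> real \<Rightarrow> real" where
  "weight l \<mu> k t = (sin (real \<mu> * t / 2) / sin (t / 2)) ^ (2 * l) * support_area TYPE('a) Z t * sin t ^ k"

definition weight_measure :: "nat \<Rightarrow> nat \<Rightarrow> nat \<Rightarrow> real measure" where
  "weight_measure l \<mu> k = density (restrict_space lborel {0<..<pi})
     (\<lambda>t. ennreal (weight l \<mu> k t / jackson_const TYPE('a) Z l \<mu> k))"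

lemma area_measurable: "support_area TYPE('a) Z \<in> borel_measurable (restrict_space borel {0<..<pi})"
  by (rule support_area_measurable[OF Z_measurable])

lemma area_nonneg: "0 \<le> support_area TYPE('a) Z t"
  by (simp add: support_area_def Let_def)

lemma weight_nonneg: "t \<in> {0<..<pi} \<Longrightarrow> 0 \<le> weight l \<mu> k t"
  using sin_gt_zero[of t] by (simp add: weight_def area_nonneg)

lemma weight_measurable: "weight l \<mu> k \<in> borel_measurable (restrict_space lborel {0<..<pi})"
proof -
  have [measurable]: "support_area TYPE('a) Z \<in> borel_measurable (restrict_space lborel {0<..<pi})"
    using area_measurable by (simp cong: measurable_cong_sets add: sets_restrict_space)
  have [measurable]: "(\<lambda>t. t) \<in> borel_measurable (restrict_space lborel {0<..<pi})"
    by (intro measurable_restrict_space1) simp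
  show ?thesis unfolding weight_def[abs_def] by measurable
qed

lemma jackson_const_eq: "jackson_const TYPE('a) Z l \<mu> k = (LBINT t:{0<..<pi}. weight l \<mu> k t)"
  by (simp add: jackson_const_def weight_def)

lemma weight_moment:
  assumes "0 < \<beta>" "\<beta> \<le> 2"
  shows "\<exists>A>0. \<forall>\<mu>\<ge>2. set_integrable lborel {0<..<pi} (weight (\<alpha> + k + 2) \<mu> k) \<and>
    0 < jackson_const TYPE('a) Z (\<alpha> + k + 2) \<mu> k \<and>
    set_integrable lborel {0<..<pi} (\<lambda>t. weight (\<alpha> + k + 2) \<mu> k t * t powr \<beta>) \<and>
    (LBINT t:{0<..<pi}. weight (\<alpha> + k + 2) \<mu> k t * t powr \<beta>)
      \<le> A * real \<mu> powr (- \<beta>) * jackson_const TYPE('a) Z (\<alpha> + k + 2) \<mu> k"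
proof -
  have "(\<lambda>t. indicator {0<..<pi} t * support_area TYPE('a) Z t) \<in> borel_measurable lborel"
    using area_measurable by (subst (asm) borel_measurable_restrict_space_iff) auto
  from jackson_moment[OF this area_nonneg c C2 area_upper area_lower assms, of k]
  show ?thesis unfolding jackson_const_eq weight_def[abs_def] by blast
qed

lemma weight_measure_space: "space (weight_measure l \<mu> k) = {0<..<pi}"
  by (simp add: weight_measure_def space_restrict_space)

lemma weight_measure_sets: "sets (weight_measure l \<mu> k) = sets (restrict_space borel {0<..<pi})"
  by (simp add: weight_measure_def sets_restrict_space)

lemma weight_measure_integral:
  fixes g :: "real \<Rightarrow> 'c::{banach, second_countable_topology}"
  assumes J: "0 < jackson_const TYPE('a) Z l \<mu> k"
    and g: "g \<in> borel_measurable (restrict_space lborel {0<..<pi})"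
  shows "(LINT t|weight_measure l \<mu> k. g t)
    = (LBINT t:{0<..<pi}. (weight l \<mu> k t / jackson_const TYPE('a) Z l \<mu> k) *\<^sub>R g t)"
proof -
  have [measurable]: "weight l \<mu> k \<in> borel_measurable (restrict_space lborel {0<..<pi})"
    by (rule weight_measurable)
  have "(LINT t|weight_measure l \<mu> k. g t) = (LINT t|restrict_space lborel {0<..<pi}.
      (weight l \<mu> k t / jackson_const TYPE('a) Z l \<mu> k) *\<^sub>R g t)"
    unfolding weight_measure_def using weight_nonneg J g
    by (intro integral_density) (auto intro!: AE_I2 divide_nonneg_pos simp: space_restrict_space)
  then show ?thesis by (simp add: integral_restrict_space set_lebesgue_integral_def)
qed

lemma weight_measure_prob:
  assumes J: "0 < jackson_const TYPE('a) Z l \<mu> k" and int: "set_integrable lborel {0<..<pi} (weight l \<mu> k)"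
  shows "emeasure (weight_measure l \<mu> k) (space (weight_measure l \<mu> k)) = 1"
proof -
  let ?R = "restrict_space lborel {0<..<pi}" and ?J = "jackson_const TYPE('a) Z l \<mu> k"
  have [measurable]: "weight l \<mu> k \<in> borel_measurable ?R" by (rule weight_measurable)
  have i: "integrable ?R (weight l \<mu> k)"
    using int by (simp add: integrable_restrict_space set_integrable_def)
  have "emeasure (weight_measure l \<mu> k) (space (weight_measure l \<mu> k))
      = (\<integral>\<^sup>+t. ennreal (weight l \<mu> k t / ?J) * indicator (space ?R) t \<partial>?R)"
    unfolding weight_measure_def space_density by (rule emeasure_density[OF _ sets.top]) measurable
  also have "\<dots> = (\<integral>\<^sup>+t. ennreal (weight l \<mu> k t / ?J) \<partial>?R)"
    by (intro nn_integral_cong) (simp add: indicator_def)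
  also have "\<dots> = ennreal (LINT t|?R. weight l \<mu> k t / ?J)"
    using i weight_nonneg J
    by (intro nn_integral_eq_integral) (auto intro!: AE_I2 divide_nonneg_pos simp: space_restrict_space)
  also have "(LINT t|?R. weight l \<mu> k t / ?J) = (LINT t|?R. weight l \<mu> k t) / ?J" by simp
  also have "(LINT t|?R. weight l \<mu> k t) = ?J"
    by (simp add: jackson_const_eq integral_restrict_space set_lebesgue_integral_def)
  finally show ?thesis using J by simp
qed

lemma mixture_locale:
  assumes J: "0 < jackson_const TYPE('a) Z l \<mu> k" and int: "set_integrable lborel {0<..<pi} (weight l \<mu> k)"
  shows "kernel_mixture \<sigma> (weight_measure l \<mu> k) (\<lambda>t x y. Z t (x \<bullet> y) / \<tau>) row_bound"
proof -
  note prob = weight_measure_prob[OF J int]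
  interpret S: finite_measure \<sigma> by (rule sphere_measure_finite)
  interpret N: finite_measure "weight_measure l \<mu> k" by standard (simp add: prob)
  show ?thesis
  proof
    have ZN: "case_prod Z \<in> borel_measurable (weight_measure l \<mu> k \<Otimes>\<^sub>M restrict_space borel {-1..1})"
      using Z_measurable by (simp cong: measurable_cong_sets sets_pair_measure_cong add: weight_measure_sets)
    have "(\<lambda>z. Z (fst z) (fst (snd z) \<bullet> snd (snd z))) \<in> borel_measurable (weight_measure l \<mu> k \<Otimes>\<^sub>M (\<sigma> \<Otimes>\<^sub>M \<sigma>))"
      by (rule zonal_measurable[OF ZN]) measurable
    then show "(\<lambda>(t, x, y). Z t (x \<bullet> y) / \<tau>) \<in> borel_measurable (weight_measure l \<mu> k \<Otimes>\<^sub>M (\<sigma> \<Otimes>\<^sub>M \<sigma>))"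
      by (simp add: split_beta')
    show "0 \<le> Z t (x \<bullet> y) / \<tau>"
      if "t \<in> space (weight_measure l \<mu> k)" "x \<in> space \<sigma>" "y \<in> space \<sigma>" for t x y
    proof -
      have "\<bar>x \<bullet> y\<bar> \<le> 1" using Cauchy_Schwarz_ineq2[of x y] that by simp
      then show ?thesis
        using that \<tau>_pos by (intro divide_nonneg_pos Z_nonneg) (auto simp: weight_measure_space)
    qed
    show "(\<integral>\<^sup>+y. ennreal (Z t (x \<bullet> y) / \<tau>) \<partial>\<sigma>) \<le> ennreal row_bound"
      if "t \<in> space (weight_measure l \<mu> k)" "x \<in> space \<sigma>" for t x
      using that by (intro row_integral_le) (auto simp: weight_measure_space)
  qed (auto simp: inner_commute row_bound_nonneg prob)
qed

lemma conv_op_eq: "conv_op Z t f x = (LINT y|\<sigma>. of_real (Z t (x \<bullet> y) / \<tau>) * f y)"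
proof -
  have "(LINT y|\<sigma>. of_real (Z t (x \<bullet> y) / \<tau>) * f y)
      = (LINT y|\<sigma>. inverse (of_real \<tau>) * (of_real (Z t (x \<bullet> y)) * f y))"
    by (intro Bochner_Integration.integral_cong) (auto simp: divide_inverse)
  then show ?thesis by (simp add: conv_op_def \<tau>_def scaleR_conv_of_real)
qed

lemma conv_op_measurable:
  assumes f: "f \<in> borel_measurable \<sigma>" and x: "x \<in> sphere 0 1"
  shows "(\<lambda>t. conv_op Z t f x) \<in> borel_measurable (restrict_space lborel {0<..<pi})"
proof -
  interpret S: finite_measure \<sigma> by (rule sphere_measure_finite)
  note f [measurable]
  have ZN: "case_prod Z \<in> borel_measurable (restrict_space lborel {0<..<pi} \<Otimes>\<^sub>M restrict_space borel {-1..1})"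
    using Z_measurable by (simp cong: measurable_cong_sets sets_pair_measure_cong add: sets_restrict_space)
  have [measurable]: "(\<lambda>z. Z (fst z) (x \<bullet> snd z)) \<in> borel_measurable (restrict_space lborel {0<..<pi} \<Otimes>\<^sub>M \<sigma>)"
    by (rule zonal_measurable[OF ZN]) (use x in auto)
  have "(\<lambda>(t, y). complex_of_real (Z t (x \<bullet> y) / \<tau>) * f y) \<in> borel_measurable (restrict_space lborel {0<..<pi} \<Otimes>\<^sub>M \<sigma>)"
    unfolding split_beta' by measurable
  from S.borel_measurable_lebesgue_integral[OF this] show ?thesis by (simp add: conv_op_eq)
qed

lemma Phi_op_eq:
  assumes J: "0 < jackson_const TYPE('a) Z l \<mu> k" and f: "f \<in> borel_measurable \<sigma>" and x: "x \<in> sphere 0 1"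
  shows "Phi_op Z l \<mu> k f x = (LINT t|weight_measure l \<mu> k. LINT y|\<sigma>. of_real (Z t (x \<bullet> y) / \<tau>) * f y)"
  unfolding conv_op_eq[symmetric] weight_measure_integral[OF J conv_op_measurable[OF f x]]
  by (simp add: Phi_op_def jackson_fun_def weight_def set_lebesgue_integral_def scaleR_conv_of_real mult_ac)

text \<open>The error bound for one value of \<open>\<mu>\<close>: averaging the Hoelder condition over \<open>t\<close> leaves the moment
  of order \<open>\<beta>\<close> of the weight.\<close>

lemma approx_number_one_scale:
  assumes J: "0 < jackson_const TYPE('a) Z l \<mu> k" and int: "set_integrable lborel {0<..<pi} (weight l \<mu> k)"
    and intb: "set_integrable lborel {0<..<pi} (\<lambda>t. weight l \<mu> k t * t powr \<beta>)"
    and moment: "(LBINT t:{0<..<pi}. weight l \<mu> k t * t powr \<beta>) \<le> D * jackson_const TYPE('a) Z l \<mu> k"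
    and K: "positive_integral_operator K Kh" and Holder: "Holder_kernel Z B \<beta> (K :: 'a \<Rightarrow> 'a \<Rightarrow> complex)"
    and B: "AE y in \<sigma>. B y \<le> b" "b \<ge> 0"
    and rank: "op_rank \<sigma> (Phi_op Z l \<mu> k :: ('a \<Rightarrow> complex) \<Rightarrow> 'a \<Rightarrow> complex) \<le> enat r" and r: "r \<ge> 1" and n: "4 * r < n"
  shows "0 \<le> approx_number \<sigma> n (integral_op K)"
    "approx_number \<sigma> n (integral_op K) \<le> b * D * (1 + row_bound) * \<tau> / real r"
proof -
  let ?N = "weight_measure l \<mu> k"
  interpret kernel_mixture \<sigma> ?N "\<lambda>t x y. Z t (x \<bullet> y) / \<tau>" row_bound
    by (rule mixture_locale[OF J int])
  have Phi: "AE x in \<sigma>. Phi_op Z l \<mu> k f x = avg f x" if f: "integrable \<sigma> f" for f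
    using avg_eq_mixture[OF f] AE_space
  proof eventually_elim
    case (elim x)
    then show ?case using Phi_op_eq[OF J, of f x] f by auto
  qed
  have mom: "(LINT t|?N. t powr \<beta>) \<le> D" and momi: "integrable ?N (\<lambda>t. t powr \<beta>)"
  proof -
    let ?J = "jackson_const TYPE('a) Z l \<mu> k" and ?R = "restrict_space lborel {0<..<pi}"
    have m: "(\<lambda>t. t powr \<beta>) \<in> borel_measurable ?R" by (intro measurable_restrict_space1) measurable
    have "(LINT t|?N. t powr \<beta>) = (LBINT t:{0<..<pi}. (1 / ?J) * (weight l \<mu> k t * t powr \<beta>))"
      by (simp add: weight_measure_integral[OF J m] mult_ac)
    also have "\<dots> = (1 / ?J) * (LBINT t:{0<..<pi}. weight l \<mu> k t * t powr \<beta>)"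
      by (rule set_integral_mult_right)
    also have "\<dots> \<le> D" using moment J by (simp add: pos_divide_le_eq)
    finally show "(LINT t|?N. t powr \<beta>) \<le> D" .
    have [measurable]: "weight l \<mu> k \<in> borel_measurable ?R" by (rule weight_measurable)
    have "integrable ?R (\<lambda>t. weight l \<mu> k t * t powr \<beta>)"
      using intb by (simp add: integrable_restrict_space set_integrable_def)
    then have "integrable ?R (\<lambda>t. (1 / ?J) * (weight l \<mu> k t * t powr \<beta>))"
      by (rule integrable_mult_right)
    then have "integrable ?R (\<lambda>t. (weight l \<mu> k t / ?J) *\<^sub>R t powr \<beta>)" by simp
    then show "integrable ?N (\<lambda>t. t powr \<beta>)"
      unfolding weight_measure_def using m weight_nonneg J
      by (subst integrable_density) (auto intro!: AE_I2 divide_nonneg_pos simp: space_restrict_space)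
  qed
  have KL: "case_prod K \<in> L2 (\<sigma> \<Otimes>\<^sub>M \<sigma>)" and R: "L2_operator \<sigma> (integral_op Kh)"
    and pos: "positive_operator \<sigma> (integral_op Kh)"
    and RRK: "\<And>f. f \<in> L2 \<sigma> \<Longrightarrow> AE y in \<sigma>. integral_op Kh (integral_op Kh f) y = (LINT x|\<sigma>. K y x * f x)"
    using K by (auto simp: positive_integral_operator_def is_square_root_def integral_op_def)
  have [measurable]: "(\<lambda>(y, x). K y x) \<in> borel_measurable (\<sigma> \<Otimes>\<^sub>M \<sigma>)" using L2_measurable[OF KL] by simp
  have "AE y in \<sigma>. integrable \<sigma> (\<lambda>x. (cmod (K y x))\<^sup>2)"
    using MM.AE_integrable_fst'[OF L2_integrable_square[OF KL]] by simp
  then have Ky: "AE y in \<sigma>. integrable \<sigma> (K y)"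
    using AE_space by eventually_elim (auto simp: L2_def intro!: L2_integrable)
  have close: "AE y in \<sigma>. AE x in \<sigma>. cmod (K y x - avg (K y) x) \<le> b * D"
    using Ky B(1) AE_space
  proof eventually_elim
    case (elim y)
    have y: "y \<in> sphere 0 1" using elim by simp
    show ?case
      using Phi[OF elim(1)] AE_space
    proof eventually_elim
      case (elim x)
      have x: "x \<in> sphere 0 1" using elim by simp
      have [measurable]: "K y \<in> borel_measurable \<sigma>" using \<open>integrable \<sigma> (K y)\<close> by simp
      let ?g = "\<lambda>t. conv_op Z t (K y) x"
      have gm: "?g \<in> borel_measurable ?N"
        using conv_op_measurable[OF _ x, of "K y"] by (simp add: weight_measure_def)
      have diff: "cmod (?g t - K y x) \<le> b * t powr \<beta>" if t: "t \<in> space ?N" for t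
      proof -
        have "cmod (?g t - K y x) \<le> B y * t powr \<beta>"
          using Holder x y t unfolding Holder_kernel_def weight_measure_space by blast
        also have "\<dots> \<le> b * t powr \<beta>" using \<open>B y \<le> b\<close> by (intro mult_right_mono) auto
        finally show ?thesis .
      qed
      have di: "integrable ?N (\<lambda>t. ?g t - K y x)"
        by (rule Bochner_Integration.integrable_bound[OF integrable_mult_right[OF momi, of b]])
          (use gm diff \<open>b \<ge> 0\<close> in \<open>auto intro!: AE_I2\<close>)
      have one: "measure ?N (space ?N) = 1" by (simp add: measure_def N_prob)
      have gi: "integrable ?N ?g"
      proof -
        have "integrable ?N (\<lambda>t. (?g t - K y x) + K y x)" by (intro Bochner_Integration.integrable_add di) simp
        then show ?thesis by simp
      qed
      have "(LINT t|?N. ?g t - K y x) = (LINT t|?N. ?g t) - K y x"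
        using gi by (simp add: one)
      then have "cmod ((LINT t|?N. ?g t) - K y x) \<le> (LINT t|?N. cmod (?g t - K y x))"
        by (metis integral_norm_bound)
      also have "\<dots> \<le> (LINT t|?N. b * t powr \<beta>)"
        using di momi diff by (intro integral_mono) auto
      also have "\<dots> \<le> b * D" using mom \<open>b \<ge> 0\<close> by (simp add: mult_left_mono)
      finally have "cmod ((LINT t|?N. ?g t) - K y x) \<le> b * D" .
      moreover have "(LINT t|?N. ?g t) = avg (K y) x"
        using elim(1) Phi_op_eq[OF J, of "K y" x] x by (simp add: conv_op_eq)
      ultimately show ?case by (simp add: norm_minus_commute)
    qed
  qed
  obtain F where F: "finite F" "card F \<le> r" "AE_spanned \<sigma> ((Phi_op Z l \<mu> k :: ('a \<Rightarrow> complex) \<Rightarrow> 'a \<Rightarrow> complex) ` L2 \<sigma>) F"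
    using op_rank_le_D[OF rank] by blast
  have F': "AE_spanned \<sigma> (avg ` L2 \<sigma>) F"
    unfolding AE_spanned_def
  proof safe
    fix f assume f: "f \<in> L2 \<sigma>"
    then obtain d where "AE x in \<sigma>. Phi_op Z l \<mu> k f x = (\<Sum>g\<in>F. d g * g x)"
      using F(3) by (auto simp: AE_spanned_def)
    with Phi[OF L2_integrable[OF f]] have "AE x in \<sigma>. avg f x = (\<Sum>g\<in>F. d g * g x)"
      by eventually_elim simp
    then show "\<exists>d. AE x in \<sigma>. avg f x = (\<Sum>g\<in>F. d g * g x)" by - (rule exI)
  qed
  have D: "b * D \<ge> 0"
  proof -
    have "0 \<le> (LINT t|?N. t powr \<beta>)" by (rule Bochner_Integration.integral_nonneg) simp
    then have "0 \<le> D" using mom by linarith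
    then show ?thesis using \<open>b \<ge> 0\<close> by simp
  qed
  have io: "integral_op K = (\<lambda>f y. LINT x|\<sigma>. K y x * f x)" by (intro ext) (simp add: integral_op_def)
  note final = approx_number_integral_operator_le[OF R pos KL RRK close D F(1,2) F' r n]
  show "0 \<le> approx_number \<sigma> n (integral_op K)" unfolding io by (rule final(1))
  show "approx_number \<sigma> n (integral_op K) \<le> b * D * (1 + row_bound) * \<tau> / real r"
    unfolding io using final(2) by (simp add: \<tau>_def)
qed

end

section \<open>The decay rate\<close>

text \<open>With rank \<open>(q (n + 1))\<^sup>\<alpha> \<approx> \<mu>\<^sup>\<alpha>\<close> the bound \<open>\<mu>\<^sup>-\<^sup>\<beta> / rank\<close> is \<open>N\<^sup>-\<^sup>1\<^sup>-\<^sup>\<beta>\<^sup>/\<^sup>\<alpha>\<close> for \<open>N\<close> comparable to the rank; so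
  \<open>\<mu>\<close> is chosen as a multiple of \<open>N\<^sup>1\<^sup>/\<^sup>\<alpha>\<close>.\<close>

lemma bigo_of_scales:
  fixes f :: "nat \<Rightarrow> real"
  assumes bound: "\<And>\<mu> N. \<mu> \<ge> 2 \<Longrightarrow> 4 * (q * (l * (\<mu> - 1) + 1)) ^ \<alpha> < N \<Longrightarrow>
      0 \<le> f N \<and> f N \<le> D * real \<mu> powr (- \<beta>) / real ((q * (l * (\<mu> - 1) + 1)) ^ \<alpha>)"
    and pos: "\<alpha> \<ge> 1" "q \<ge> 1" "l \<ge> 1" "D \<ge> 0" "\<beta> > 0"
  shows "f \<in> O(\<lambda>N. real N powr (- 1 - \<beta> / real \<alpha>))"
proof -
  define a where "a = real \<alpha>"
  define b where "b = real (q * l)"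
  have a: "a > 0" and b: "b \<ge> 1"
    using pos mult_le_mono[of 1 q 1 l] by (auto simp: a_def b_def simp flip: of_nat_mult)
  define G where "G = D * (2 * b) powr (\<beta> + a) * 8 powr ((\<beta> + a) / a)"
  have "\<bar>f N\<bar> \<le> G * \<bar>real N powr (- 1 - \<beta> / a)\<bar>" if N: "real N \<ge> 8 * (2 * b) powr a" for N
  proof -
    \<comment> \<open>the factor 8 leaves room for \<open>4 r \<le> N / 2\<close>\<close>
    define x where "x = (real N / 8) powr (1 / a) / b"
    have N0: "real N > 0" using N b by (smt (verit) powr_gt_zero)
    have "2 * b = ((2 * b) powr a) powr (1 / a)" using a b by (simp add: powr_powr)
    also have "\<dots> \<le> (real N / 8) powr (1 / a)" using N a by (intro powr_mono2) auto
    finally have x2: "x \<ge> 2" using b by (simp add: x_def pos_le_divide_eq)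
    define \<mu> where "\<mu> = nat \<lfloor>x\<rfloor>"
    have \<mu>x: "real \<mu> \<le> x" "x / 2 \<le> real \<mu>" "\<mu> \<ge> 2"
    proof -
      have "real \<mu> = of_int \<lfloor>x\<rfloor>" using x2 by (simp add: \<mu>_def)
      then show "real \<mu> \<le> x" "x / 2 \<le> real \<mu>" using x2 by linarith+
      show "\<mu> \<ge> 2" using x2 by (simp add: \<mu>_def le_nat_iff le_floor_iff)
    qed
    define r where "r = (q * (l * (\<mu> - 1) + 1)) ^ \<alpha>"
    have low: "\<mu> \<le> q * (l * (\<mu> - 1) + 1)"
    proof -
      have "\<mu> - 1 \<le> l * (\<mu> - 1)" using pos(3) by simp
      then have "\<mu> \<le> l * (\<mu> - 1) + 1" by linarith
      also have "\<dots> \<le> q * (l * (\<mu> - 1) + 1)"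
        using mult_le_mono1[OF pos(2), of "l * (\<mu> - 1) + 1"] by (simp only: mult_1)
      finally show ?thesis .
    qed
    have up: "q * (l * (\<mu> - 1) + 1) \<le> q * l * \<mu>"
    proof -
      have "l * (\<mu> - 1) + 1 \<le> l * (\<mu> - 1) + l" using pos(3) by simp
      also have "\<dots> = l * \<mu>" using \<mu>x(3) by (cases \<mu>) auto
      finally show ?thesis unfolding mult.assoc by (rule mult_le_mono2)
    qed
    have "real (q * (l * (\<mu> - 1) + 1)) \<le> real (q * l * \<mu>)" using up by (rule of_nat_mono)
    then have "real r \<le> (b * real \<mu>) ^ \<alpha>"
      unfolding r_def of_nat_power by (intro power_mono) (auto simp: b_def)
    also have "\<dots> \<le> (b * x) ^ \<alpha>" using b \<mu>x by (intro power_mono mult_left_mono) auto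
    also have "b * x = (real N / 8) powr (1 / a)" using b by (simp add: x_def)
    also have "\<dots> ^ \<alpha> = real N / 8"
      using N0 a by (simp add: powr_realpow[symmetric] powr_powr a_def)
    finally have "4 * real r < real N" using N0 by simp
    then have "4 * r < N" by linarith
    then have f: "0 \<le> f N" "f N \<le> D * real \<mu> powr (- \<beta>) / real r"
      using bound[OF \<mu>x(3), of N] by (auto simp: r_def)
    have x: "x / 2 > 0" using x2 by simp
    have scale: "(x / 2) powr (- (\<beta> + a))
        = (2 * b) powr (\<beta> + a) * (8 powr ((\<beta> + a) / a) * real N powr (- 1 - \<beta> / a))"
    proof -
      have 1: "(y powr (1 / a) / (2 * b)) powr (- s) = (2 * b) powr s * y powr (- s / a)" if "y > 0" for y s
      proof -
        have "1 / a * - s = - s / a" by simp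
        then have "(y powr (1 / a)) powr (- s) = y powr (- s / a)" by (simp only: powr_powr)
        moreover have "inverse ((2 * b) powr (- s)) = (2 * b) powr s" by (simp only: powr_minus inverse_inverse_eq)
        moreover have "(y powr (1 / a) / (2 * b)) powr (- s) = (y powr (1 / a)) powr (- s) / (2 * b) powr (- s)"
          by (rule powr_divide)
        ultimately show ?thesis by (simp only: divide_inverse mult.commute)
      qed
      have 2: "(y / 8) powr (- s) = 8 powr s * y powr (- s)" if "y > 0" for y s :: real
      proof -
        have "(y / 8) powr (- s) = y powr (- s) / 8 powr (- s)" by (rule powr_divide)
        then show ?thesis by (simp only: powr_minus divide_inverse inverse_inverse_eq mult.commute)
      qed
      have e: "- (\<beta> + a) / a = - ((\<beta> + a) / a)" "- 1 - \<beta> / a = - ((\<beta> + a) / a)"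
        using a by (simp_all add: field_simps)
      have N8: "real N / 8 > 0" using N0 by simp
      have xe: "x / 2 = (real N / 8) powr (1 / a) / (2 * b)" by (simp add: x_def)
      show ?thesis unfolding xe 1[OF N8] e 2[OF N0] by (rule refl)
    qed
    have "real \<mu> powr a = real (\<mu> ^ \<alpha>)" using \<mu>x by (simp add: a_def powr_realpow)
    also have "\<dots> \<le> real r" unfolding r_def using low by (intro of_nat_mono power_mono) auto
    finally have "real \<mu> powr a \<le> real r" .
    then have "D * real \<mu> powr (- \<beta>) / real r \<le> D * real \<mu> powr (- \<beta>) / real \<mu> powr a"
      using \<mu>x(3) pos(4) by (intro frac_le) auto
    also have "\<dots> = D * real \<mu> powr (- (\<beta> + a))"
      using powr_diff[of "real \<mu>" "- \<beta>" a] by simp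
    also have "\<dots> \<le> D * (x / 2) powr (- (\<beta> + a))"
      using x \<mu>x pos a by (intro mult_left_mono powr_mono2') auto
    also have "\<dots> = G * real N powr (- 1 - \<beta> / a)"
      unfolding scale by (simp add: G_def)
    finally have "f N \<le> G * real N powr (- 1 - \<beta> / a)" using f(2) by linarith
    then show ?thesis using f(1) by simp
  qed
  moreover have "eventually (\<lambda>N. real N \<ge> 8 * (2 * b) powr a) sequentially"
    using filterlim_real_sequentially by (auto simp: filterlim_at_top)
  ultimately show ?thesis
    by (intro bigoI[of _ G]) (auto elim!: eventually_mono simp: a_def)
qed

theorem theorem4p6:
  fixes Z :: "real \<Rightarrow> real \<Rightarrow> real"
    and m \<alpha> k q :: nat
    and K Kh :: "'a::euclidean_space \<Rightarrow> 'a \<Rightarrow> complex"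
    and B :: "'a \<Rightarrow> real"
    and \<beta> :: real
  assumes "m \<ge> 1" and "DIM('a) = m + 1"
    and Z_measurable: "case_prod Z \<in>
      borel_measurable (restrict_space borel {0<..<pi} \<Otimes>\<^sub>M restrict_space borel {-1..1})"
    and Z_nonneg: "\<forall>t\<in>{0<..<pi}. \<forall>u\<in>{-1..1}. Z t u \<ge> 0"
    and Z_integrable: "\<forall>t\<in>{0<..<pi}. integrable (omega_measure m) (Z t)"
    and A1: "\<exists>M. \<forall>t\<in>{0<..<pi}. norm_1m m (Z t) \<le> M"
    and "\<alpha> \<ge> 1"
    and A2: "\<exists>c>0. \<exists>C>0.
      (\<forall>t\<in>{0<..<pi}. support_area TYPE('a) Z t \<le> C * t ^ \<alpha>) \<and>
      (\<forall>t\<in>{0<..<pi / 2}. c * t ^ \<alpha> \<le> support_area TYPE('a) Z t)"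
    and "0 < \<beta>" and "\<beta> \<le> 2"
    and B_measurable: "B \<in> borel_measurable sphere_measure"
    and B_bounded: "\<exists>M. AE y in sphere_measure. B y \<le> M"
    and B_nonneg: "\<forall>y\<in>sphere 0 1. B y \<ge> 0"
    and K_positive: "positive_integral_operator K Kh"
    and K_Holder: "Holder_kernel Z B \<beta> K"
    and "k \<ge> 1" and "q \<ge> 1"
    and rank: "\<forall>n\<ge>1. \<forall>l\<ge>1. \<forall>\<mu>\<ge>2. l * (\<mu> - 1) = n \<longrightarrow>
      op_rank (sphere_measure :: 'a measure) (Phi_op Z l \<mu> k) \<le> enat ((q * (n + 1)) ^ \<alpha>)"
  shows "(\<lambda>n. approx_number sphere_measure n (integral_op K)) \<in> O(\<lambda>n. real n powr (- \<beta> / real \<alpha>)) \<and>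
    ((\<forall>f\<in>L2 sphere_measure. \<exists>g. continuous_on (sphere 0 1) g \<and>
        (AE x in sphere_measure. integral_op Kh f x = g x)) \<longrightarrow>
     (\<lambda>n. approx_number sphere_measure n (integral_op K)) \<in> O(\<lambda>n. real n powr (- 1 - \<beta> / real \<alpha>)))"
proof -
  obtain C1 where C1: "\<And>t. t \<in> {0<..<pi} \<Longrightarrow> norm_1m m (Z t) \<le> C1" using A1 by blast
  obtain c C2 where c: "c > 0" "C2 > 0" "\<And>t. t \<in> {0<..<pi} \<Longrightarrow> support_area TYPE('a) Z t \<le> C2 * t ^ \<alpha>"
      "\<And>t. t \<in> {0<..<pi / 2} \<Longrightarrow> c * t ^ \<alpha> \<le> support_area TYPE('a) Z t" using A2 by blast
  obtain b0 where b0: "AE y in sphere_measure. B y \<le> b0" using B_bounded by blast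
  define b where "b = max b0 0"
  have b: "AE y in sphere_measure. B y \<le> b" "b \<ge> 0" using b0 by (auto simp: b_def)
  interpret zonal_family Z m \<alpha> "TYPE('a)" c C1 C2
    using assms(1,2) Z_measurable Z_nonneg Z_integrable C1 c by unfold_locales auto
  \<comment> \<open>a fixed \<open>l\<close> with bounded second moments; only \<open>\<mu>\<close> varies, so that \<open>l (\<mu> - 1)\<close> is comparable to \<open>\<mu>\<close>\<close>
  define l where "l = \<alpha> + k + 2"
  obtain A where A: "A > 0" and w: "\<And>\<mu>. \<mu> \<ge> 2 \<Longrightarrow> set_integrable lborel {0<..<pi} (weight l \<mu> k) \<and>
      0 < jackson_const TYPE('a) Z l \<mu> k \<and>
      set_integrable lborel {0<..<pi} (\<lambda>t. weight l \<mu> k t * t powr \<beta>) \<and>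
      (LBINT t:{0<..<pi}. weight l \<mu> k t * t powr \<beta>)
        \<le> A * real \<mu> powr (- \<beta>) * jackson_const TYPE('a) Z l \<mu> k"
    using weight_moment[OF \<open>0 < \<beta>\<close> \<open>\<beta> \<le> 2\<close>, of k] unfolding l_def by blast
  let ?a = "\<lambda>n. approx_number sphere_measure n (integral_op K)"
  have strong: "?a \<in> O(\<lambda>n. real n powr (- 1 - \<beta> / real \<alpha>))"
  proof (rule bigo_of_scales[where q = q and l = l and D = "b * A * (1 + row_bound) * \<tau>"])
    fix \<mu> N :: nat assume \<mu>: "\<mu> \<ge> 2" and N: "4 * (q * (l * (\<mu> - 1) + 1)) ^ \<alpha> < N"
    define r where "r = (q * (l * (\<mu> - 1) + 1)) ^ \<alpha>"
    have l1: "l \<ge> 1" by (simp add: l_def)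
    have "l * (\<mu> - 1) \<ge> 1" using \<mu> l1 by simp
    then have rk: "op_rank \<sigma> (Phi_op Z l \<mu> k) \<le> enat r"
      unfolding r_def using rank l1 \<mu> by blast
    have "r \<ge> 1" using \<open>q \<ge> 1\<close> by (simp add: r_def)
    have mom: "(LBINT t:{0<..<pi}. weight l \<mu> k t * t powr \<beta>)
        \<le> (A * real \<mu> powr (- \<beta>)) * jackson_const TYPE('a) Z l \<mu> k"
      and J: "0 < jackson_const TYPE('a) Z l \<mu> k"
      and i1: "set_integrable lborel {0<..<pi} (weight l \<mu> k)"
      and i2: "set_integrable lborel {0<..<pi} (\<lambda>t. weight l \<mu> k t * t powr \<beta>)"
      using w[OF \<mu>] by auto
    note final = approx_number_one_scale[OF J i1 i2 mom K_positive K_Holder b rk \<open>r \<ge> 1\<close> N[folded r_def]]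
    show "0 \<le> ?a N \<and> ?a N \<le> b * A * (1 + row_bound) * \<tau> * real \<mu> powr (- \<beta>) / real ((q * (l * (\<mu> - 1) + 1)) ^ \<alpha>)"
      using final by (simp only: r_def[symmetric] mult_ac)
  qed (use \<open>\<alpha> \<ge> 1\<close> \<open>q \<ge> 1\<close> \<open>0 < \<beta>\<close> A b row_bound_nonneg \<tau>_pos in \<open>auto simp: l_def\<close>)
  have "(\<lambda>n. real n powr (- 1 - \<beta> / real \<alpha>)) \<in> O(\<lambda>n. real n powr (- \<beta> / real \<alpha>))"
  proof (rule bigoI[of _ 1])
    show "eventually (\<lambda>n. norm (real n powr (- 1 - \<beta> / real \<alpha>)) \<le> 1 * norm (real n powr (- \<beta> / real \<alpha>))) sequentially"
      using eventually_ge_at_top[of 1] by eventually_elim (auto intro!: powr_mono)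
  qed
  with strong have weak: "?a \<in> O(\<lambda>n. real n powr (- \<beta> / real \<alpha>))"
    by (rule landau_o.big_trans)
  show ?thesis by (intro conjI impI strong weak)
qed

end
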